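(* Let $n\geqslant 1$ be an integer, $k\in[0,1)$, and let $0\leqslant\mu\leqslant\mu_0(k,n)$ be such that $\mu\leqslant k$ or $\mu\geqslant 2-k$. Assume $p_0\big(k,n+\tfrac{\mu}{1-k}\big)<\infty$ and let $p=p_0\big(k,n+\tfrac{\mu}{1-k}\big)$. Assume that $u_0\in H^1(\mathbb{R}^n)$ and $u_1\in L^2(\mathbb{R}^n)$ are nonnegative, nontrivial and compactly supported functions with supports contained in $B_R$ for some $R>0$. For $\varepsilon>0$, let $$u\in \mathcal{C}\big([1,T),H^1(\mathbb{R}^n)\big)\cap\mathcal{C}^1\big([1,T),L^2(\mathbb{R}^n)\big)\cap L^p_{\mathrm{loc}}\big([1,T)\times\mathbb{R}^n\big)$$ be an energy solution, with lifespan $T=T(\varepsilon)$, to the Cauchy problem $$u_{tt}-t^{-2k}\Delta u+\mu t^{-1}u_t=|u|^p \ \ (x\in\mathbb{R}^n,\ t\in(1,T)),\qquad u(1,x)=\varepsilon u_0(x),\quad u_t(1,x)=\varepsilon u_1(x),$$ satisfying the support condition $\mathrm{supp}\,u(t,\cdot)\subset B_{A_k(t)+R}$ for any $t\in(1,T)$. Then there exists a positive constant $\varepsilon_0=\varepsilon_0(u_0,u_1,n,p,k,\mu,R)$ such that for any $\varepsilon\in(0,\varepsilon_0]$ the energy solution $u$ blows up in finite time. Moreover, the upper bound estimate for the lifespan $$T(\varepsilon)\leqslant\exp\left(C\varepsilon^{-p(p-1)}\right)$$ holds, where the positive constant $C$ is independent of $\varepsilon$.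
   Context: Notation: $B_r$ is the ball of radius $r$ centred at the origin of $\mathbb{R}^n$; $A_k(t)\doteq\int_1^t\tau^{-k}\,\mathrm{d}\tau=\frac{t^{1-k}-1}{1-k}$. Exponent: $p_0\big(k,n+\tfrac{\mu}{1-k}\big)$ is the positive root of the quadratic equation in $p$ $$\left(\tfrac{n-1}{2}+\tfrac{\mu-k}{2(1-k)}\right)p^2-\left(\tfrac{n+1}{2}+\tfrac{\mu+3k}{2(1-k)}\right)p-1=0,$$ and it is set equal to $\infty$ when the coefficient of $p^2$ is not positive. Threshold: $$\mu_0(k,n)\doteq\frac{(1-k)^2n^2+(1-k)(1+2k)n+2}{n(1-k)+2}.$$ Energy solution: $u\in \mathcal{C}([1,T),H^1(\mathbb{R}^n))\cap\mathcal{C}^1([1,T),L^2(\mathbb{R}^n))\cap L^p_{\mathrm{loc}}([1,T)\times\mathbb{R}^n)$ is an energy solution on $[1,T)$ of the Cauchy problem if $u(1,\cdot)=\varepsilon u_0$ in $H^1(\mathbb{R}^n)$ and $$\int_{\mathbb{R}^n}\partial_tu(t,x)\psi(t,x)\,\mathrm{d}x-\varepsilon\int_{\mathbb{R}^n}u_1(x)\psi(1,x)\,\mathrm{d}x-\int_1^t\!\!\int_{\mathbb{R}^n}\partial_tu(s,x)\psi_s(s,x)\,\mathrm{d}x\,\mathrm{d}s+\int_1^t\!\!\int_{\mathbb{R}^n}s^{-2k}\nabla u(s,x)\cdot\nabla\psi(s,x)\,\mathrm{d}x\,\mathrm{d}s+\int_1^t\!\!\int_{\mathbb{R}^n}\mu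 s^{-1}\partial_tu(s,x)\psi(s,x)\,\mathrm{d}x\,\mathrm{d}s=\int_1^t\!\!\int_{\mathbb{R}^n}|u(s,x)|^p\psi(s,x)\,\mathrm{d}x\,\mathrm{d}s$$ for any $\psi\in\mathcal{C}_0^\infty([1,T)\times\mathbb{R}^n)$ and any $t\in(1,T)$. The lifespan $T(\varepsilon)$ is the maximal time such that the solution exists on $[1,T(\varepsilon))$; blow-up in finite time means $T(\varepsilon)<\infty$. *)

theory Defs
  imports "HOL-Analysis.Analysis"
begin

section \<open>Smooth functions and test functions\<close>

text \<open>\<open>C_on m U f\<close>: on the open set \<open>U\<close>, all directional derivatives of \<open>f\<close> of order at most \<open>m\<close>
  exist and are continuous.\<close>

primrec C_on :: "nat \<Rightarrow> 'a::euclidean_space set \<Rightarrow> ('a \<Rightarrow> real) \<Rightarrow> bool" where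
  "C_on 0 U f \<longleftrightarrow> continuous_on U f"
| "C_on (Suc m) U f \<longleftrightarrow>
     (\<forall>x\<in>U. f differentiable (at x)) \<and> (\<forall>v. C_on m U (\<lambda>x. frechet_derivative f (at x) v))"

definition smooth_on :: "'a::euclidean_space set \<Rightarrow> ('a \<Rightarrow> real) \<Rightarrow> bool" where
  "smooth_on U f \<longleftrightarrow> open U \<and> (\<forall>m. C_on m U f)"

text \<open>The space of smooth functions with compact support in \<open>S\<close>. As usual, when \<open>S\<close> is not open
  (such as \<open>[1,T) \<times> \<real>\<^sup>n\<close>), smoothness on \<open>S\<close> means smoothness on an open neighbourhood of \<open>S\<close>,
  and the support is taken inside \<open>S\<close>: it may meet \<open>{1} \<times> \<real>\<^sup>n\<close>, but stays away from \<open>t = T\<close>.\<close>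

definition test_functions :: "'a::euclidean_space set \<Rightarrow> ('a \<Rightarrow> real) set" where
  "test_functions S = {\<phi>. (\<exists>U. S \<subseteq> U \<and> smooth_on U \<phi>) \<and>
                          (\<exists>K. compact K \<and> K \<subseteq> S \<and> (\<forall>x\<in>S - K. \<phi> x = 0))}"

definition grad :: "(real ^ 'n \<Rightarrow> real) \<Rightarrow> real ^ 'n \<Rightarrow> real ^ 'n" where
  "grad \<phi> x = (\<chi> i. frechet_derivative \<phi> (at x) (axis i 1))"


section \<open>Lebesgue and Sobolev spaces\<close>

text \<open>Elements of these spaces are represented by functions; equality of elements is equality
  almost everywhere.\<close>

definition in_L2 :: "('a::euclidean_space \<Rightarrow> 'b::euclidean_space) \<Rightarrow> bool" where
  "in_L2 f \<longleftrightarrow> f \<in> borel_measurable lebesgue \<and> integrable lebesgue (\<lambda>x. (norm (f x))\<^sup>2)"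

definition L2_norm :: "('a::euclidean_space \<Rightarrow> 'b::euclidean_space) \<Rightarrow> real" where
  "L2_norm f = sqrt (LINT x|lebesgue. (norm (f x))\<^sup>2)"

definition has_weak_grad :: "(real ^ 'n \<Rightarrow> real) \<Rightarrow> (real ^ 'n \<Rightarrow> real ^ 'n) \<Rightarrow> bool" where
  "has_weak_grad f g \<longleftrightarrow>
     (\<forall>\<phi>\<in>test_functions UNIV.
        (LINT x|lebesgue. f x *\<^sub>R grad \<phi> x) = - (LINT x|lebesgue. \<phi> x *\<^sub>R g x))"

definition in_H1 :: "(real ^ 'n \<Rightarrow> real) \<Rightarrow> bool" where
  "in_H1 f \<longleftrightarrow> in_L2 f \<and> (\<exists>g. in_L2 g \<and> has_weak_grad f g)"

text \<open>For \<open>f\<close> in \<open>H\<^sup>1\<close> the weak gradient is unique up to null sets.\<close>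

definition weak_grad :: "(real ^ 'n \<Rightarrow> real) \<Rightarrow> real ^ 'n \<Rightarrow> real ^ 'n" where
  "weak_grad f = (SOME g. in_L2 g \<and> has_weak_grad f g)"

definition H1_norm :: "(real ^ 'n \<Rightarrow> real) \<Rightarrow> real" where
  "H1_norm f = sqrt ((L2_norm f)\<^sup>2 + (L2_norm (weak_grad f))\<^sup>2)"

definition in_Lp_loc :: "real \<Rightarrow> 'a::euclidean_space set \<Rightarrow> ('a \<Rightarrow> real) \<Rightarrow> bool" where
  "in_Lp_loc p S f \<longleftrightarrow> set_borel_measurable lebesgue S f \<and>
     (\<forall>K. compact K \<and> K \<subseteq> S \<longrightarrow> set_integrable lebesgue K (\<lambda>x. \<bar>f x\<bar> powr p))"

text \<open>The (closed) essential support, which is invariant under changes on null sets.\<close>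

definition ess_support :: "('a::euclidean_space \<Rightarrow> real) \<Rightarrow> 'a set" where
  "ess_support f = {x. \<forall>r>0. \<not> (AE y in lebesgue. y \<in> ball x r \<longrightarrow> f y = 0)}"


section \<open>Curves with values in Lebesgue and Sobolev spaces\<close>

definition C_L2 :: "real set \<Rightarrow> (real \<Rightarrow> real ^ 'n \<Rightarrow> real) \<Rightarrow> bool" where
  "C_L2 I u \<longleftrightarrow> (\<forall>t\<in>I. in_L2 (u t)) \<and>
     (\<forall>t\<in>I. ((\<lambda>s. L2_norm (\<lambda>x. u s x - u t x)) \<longlongrightarrow> 0) (at t within I))"

definition C_H1 :: "real set \<Rightarrow> (real \<Rightarrow> real ^ 'n \<Rightarrow> real) \<Rightarrow> bool" where
  "C_H1 I u \<longleftrightarrow> (\<forall>t\<in>I. in_H1 (u t)) \<and>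
     (\<forall>t\<in>I. ((\<lambda>s. H1_norm (\<lambda>x. u s x - u t x)) \<longlongrightarrow> 0) (at t within I))"

text \<open>\<open>C1_L2 I u v\<close>: the curve \<open>u\<close> belongs to \<open>C\<^sup>1(I, L\<^sup>2)\<close> and its derivative is \<open>v\<close>.\<close>

definition C1_L2 ::
  "real set \<Rightarrow> (real \<Rightarrow> real ^ 'n \<Rightarrow> real) \<Rightarrow> (real \<Rightarrow> real ^ 'n \<Rightarrow> real) \<Rightarrow> bool" where
  "C1_L2 I u v \<longleftrightarrow> C_L2 I u \<and> C_L2 I v \<and>
     (\<forall>t\<in>I. ((\<lambda>s. L2_norm (\<lambda>x. (u s x - u t x) / (s - t) - v t x)) \<longlongrightarrow> 0) (at t within I))"


section \<open>Energy solutions and their lifespan\<close>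

text \<open>The interval \<open>[1,T)\<close>, where \<open>T = \<infinity>\<close> is allowed.\<close>

definition time_interval :: "ereal \<Rightarrow> real set" where
  "time_interval T = {t. 1 \<le> t \<and> ereal t < T}"

definition energy_solution ::
  "real \<Rightarrow> real \<Rightarrow> real \<Rightarrow> real \<Rightarrow> (real ^ 'n \<Rightarrow> real) \<Rightarrow> (real ^ 'n \<Rightarrow> real) \<Rightarrow>
   ereal \<Rightarrow> (real \<Rightarrow> real ^ 'n \<Rightarrow> real) \<Rightarrow> bool" where
  "energy_solution k \<mu> p \<epsilon> u0 u1 T u \<longleftrightarrow>
     1 < T \<and>
     C_H1 (time_interval T) u \<and>
     in_Lp_loc p (time_interval T \<times> UNIV) (\<lambda>(t, x). u t x) \<and>
     (AE x in lebesgue. u 1 x = \<epsilon> * u0 x) \<and>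
     (\<exists>ut. C1_L2 (time_interval T) u ut \<and>
       (\<forall>\<psi>\<in>test_functions (time_interval T \<times> UNIV). \<forall>t. 1 < t \<and> ereal t < T \<longrightarrow>
          (LINT x|lebesgue. ut t x * \<psi> (t, x))
          - \<epsilon> * (LINT x|lebesgue. u1 x * \<psi> (1, x))
          - (LINT s:{1..t}|lebesgue. LINT x|lebesgue. ut s x * deriv (\<lambda>r. \<psi> (r, x)) s)
          + (LINT s:{1..t}|lebesgue. LINT x|lebesgue.
               s powr (-2 * k) * (weak_grad (u s) x \<bullet> grad (\<lambda>y. \<psi> (s, y)) x))
          + (LINT s:{1..t}|lebesgue. LINT x|lebesgue. \<mu> * inverse s * ut s x * \<psi> (s, x))
          = (LINT s:{1..t}|lebesgue. LINT x|lebesgue. \<bar>u s x\<bar> powr p * \<psi> (s, x))))"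

text \<open>\<open>T\<close> is the lifespan of the energy solution \<open>u\<close>: the solution exists on \<open>[1,T)\<close> and cannot be
  continued as an energy solution to any longer interval.\<close>

definition energy_solution_lifespan ::
  "real \<Rightarrow> real \<Rightarrow> real \<Rightarrow> real \<Rightarrow> (real ^ 'n \<Rightarrow> real) \<Rightarrow> (real ^ 'n \<Rightarrow> real) \<Rightarrow>
   ereal \<Rightarrow> (real \<Rightarrow> real ^ 'n \<Rightarrow> real) \<Rightarrow> bool" where
  "energy_solution_lifespan k \<mu> p \<epsilon> u0 u1 T u \<longleftrightarrow>
     energy_solution k \<mu> p \<epsilon> u0 u1 T u \<and>
     \<not> (\<exists>T' v. T < T' \<and> energy_solution k \<mu> p \<epsilon> u0 u1 T' v \<and>
              (\<forall>t\<in>time_interval T. AE x in lebesgue. v t x = u t x))"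


section \<open>Exponents and thresholds\<close>

definition A_speed :: "real \<Rightarrow> real \<Rightarrow> real" where
  "A_speed k t = integral {1..t} (\<lambda>\<tau>. \<tau> powr (-k))"

text \<open>\<open>crit_exp k n \<mu>\<close> is the exponent \<open>p\<^sub>0(k, n + \<mu>/(1-k))\<close>.\<close>

definition crit_exp :: "real \<Rightarrow> real \<Rightarrow> real \<Rightarrow> ereal" where
  "crit_exp k n \<mu> =
     (let a = (n - 1) / 2 + (\<mu> - k) / (2 * (1 - k));
          b = (n + 1) / 2 + (\<mu> + 3 * k) / (2 * (1 - k))
      in if a > 0 then ereal (THE p. p > 0 \<and> a * p\<^sup>2 - b * p - 1 = 0) else \<infinity>)"

definition \<mu>\<^sub>0 :: "real \<Rightarrow> real \<Rightarrow> real" where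
  "\<mu>\<^sub>0 k n = ((1 - k)\<^sup>2 * n\<^sup>2 + (1 - k) * (1 + 2 * k) * n + 2) / (n * (1 - k) + 2)"

end

theory Submission
  imports Defs
begin

text \<open>A test function method. In the conformal time \<open>t powr (1 - k) / (1 - k)\<close> the linear equation becomes a wave
  equation of speed one with damping \<open>nu / sig\<close>. Pairing \<open>u\<close> with the radial eigenfunctions
  \<open>\<Delta>\<phi> = \<lambda>\<^sup>2\<phi>\<close> gives a scalar equation for each \<open>\<lambda>\<close>, which is tested with the decaying solution of the
  adjoint Bessel-type equation times a logarithmic cutoff \<open>Q (x - ln t)\<close>. For \<open>\<lambda> = 1\<close> the data give, with
  \<open>X x = \<integral>Q (x - ln t) \<integral>\<bar>u\<bar> powr p t powr wt\<close>, the bound \<open>X' \<ge> c \<epsilon> powr p\<close>. Summing over dyadic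
  \<open>\<lambda>\<close> with weights \<open>\<lambda> powr bet\<close> produces a test function that is at least \<open>sig powr (- bet)\<close> in the cone and whose
  derivative behaves like a power \<open>- (p - 1) / p\<close> of the distance to the cone; at the critical exponent all powers of
  \<open>t\<close> cancel in Hoelder's inequality and only a logarithm \<open>x\<close> remains, so \<open>X powr p \<le> C x powr (p - 1) X'\<close>.
  The two differential inequalities force \<open>x \<le> C \<epsilon> powr (- p (p - 1))\<close>.\<close>

section \<open>Smooth functions\<close>

text \<open>The residual of the truncated test function lives where \<open>Q1 (x - ln t)\<close> is
  nonzero, that is on the last e-fold \<open>exp (x - 1) < t < exp x\<close>. As the x-derivative of
  \<open>Q (x - ln t)\<close> is \<open>Q1 (x - ln t)\<close>, Hoelder on that layer produces X'
  itself; this is why the cutoff is logarithmic and parametrised by x. The power - (p - 1) / p of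
  the distance to the cone, raised to the conjugate exponent p / (p - 1), is exactly 1 / distance:
  its integral across the cone is a harmonic sum, the sole source of the logarithm. The alternative
  for \<mu> says that the damping coefficient \<open>nu\<close> is at most 0 or at least 2, the
  range in which the decaying solution is given, up to a power, by a convergent Laplace integral
  with positive integrand. Working with one frequency at a time means that only spatial profiles
  enter the weak formulation; the dependence on time is then handled by one-variable
  calculus.\<close>

lemma C_on_Suc_UNIV:
  "C_on (Suc m) UNIV f \<longleftrightarrow>
     (\<forall>x. f differentiable (at x)) \<and> (\<forall>v. C_on m UNIV (\<lambda>x. frechet_derivative f (at x) v))"
  by simp

lemma C_on_imp_continuous: "C_on m UNIV f \<Longrightarrow> continuous_on UNIV f"
  by (cases m) (simp_all add: continuous_at_imp_continuous_on differentiable_imp_continuous_within)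

lemma C_on_SucD: "C_on (Suc m) UNIV f \<Longrightarrow> C_on m UNIV f"
proof (induction m arbitrary: f)
  case 0
  then show ?case using C_on_imp_continuous[of "Suc 0" f] by simp
next
  case (Suc m)
  then show ?case by (metis C_on_Suc_UNIV)
qed

lemma C_on_const: "C_on m UNIV (\<lambda>x. c)"
  by (induction m arbitrary: c) auto

text \<open>\<open>C_on\<close> speaks of \<open>frechet_derivative\<close>, a chosen object;
  uniqueness of derivatives replaces it by any explicit \<open>D\<close>, after which the closure
  lemmas are inductions on the order.\<close>

lemma C_on_SucI:
  assumes "\<And>x. (f has_derivative D x) (at x)" "\<And>v. C_on m UNIV (\<lambda>x. D x v)"
  shows "C_on (Suc m) UNIV f"
proof -
  have "frechet_derivative f (at x) = D x" for x
    using assms(1) frechet_derivative_at by metis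
  then show ?thesis using assms by (auto simp: differentiable_def)
qed

lemma C_on_bounded_linear: "bounded_linear f \<Longrightarrow> C_on m UNIV f"
proof (cases m)
  case 0
  assume "bounded_linear f"
  then show ?thesis using 0 by (auto intro: linear_continuous_on)
next
  case (Suc k)
  assume f: "bounded_linear f"
  show ?thesis unfolding Suc
    by (rule C_on_SucI[where D="\<lambda>_. f"]) (auto intro: bounded_linear_imp_has_derivative f C_on_const)
qed

lemma has_frechet_derivative:
  "C_on (Suc m) UNIV f \<Longrightarrow> (f has_derivative frechet_derivative f (at x)) (at x)"
  by (simp add: frechet_derivative_works)

lemma C_on_add: "C_on m UNIV f \<Longrightarrow> C_on m UNIV g \<Longrightarrow> C_on m UNIV (\<lambda>x. f x + g x)"
proof (induction m arbitrary: f g)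
  case 0
  then show ?case by (simp add: continuous_on_add continuous_on_mult)
next
  case (Suc m)
  show ?case
  proof (rule C_on_SucI[OF has_derivative_add[OF has_frechet_derivative[OF Suc.prems(1)]
          has_frechet_derivative[OF Suc.prems(2)]]])
    show "C_on m UNIV (\<lambda>x. frechet_derivative f (at x) v + frechet_derivative g (at x) v)" for v
      by (rule Suc.IH) (use Suc.prems in simp_all)
  qed
qed

lemma C_on_mult: "C_on m UNIV f \<Longrightarrow> C_on m UNIV g \<Longrightarrow> C_on m UNIV (\<lambda>x. f x * g x)"
proof (induction m arbitrary: f g)
  case 0
  then show ?case by (simp add: continuous_on_add continuous_on_mult)
next
  case (Suc m)
  have fg: "C_on m UNIV f" "C_on m UNIV g" using Suc.prems C_on_SucD by blast+
  show ?case
  proof (rule C_on_SucI[OF has_derivative_mult[OF has_frechet_derivative[OF Suc.prems(1)]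
          has_frechet_derivative[OF Suc.prems(2)]]])
    fix v
    have "C_on m UNIV (\<lambda>x. frechet_derivative f (at x) v)" "C_on m UNIV (\<lambda>x. frechet_derivative g (at x) v)"
      using Suc.prems by auto
    then show "C_on m UNIV (\<lambda>x. f x * frechet_derivative g (at x) v + frechet_derivative f (at x) v * g x)"
      by (intro C_on_add Suc.IH fg)
  qed
qed

lemma C_on_sum: "(\<And>i. i \<in> I \<Longrightarrow> C_on m UNIV (f i)) \<Longrightarrow> C_on m UNIV (\<lambda>x. \<Sum>i\<in>I. f i x)"
  by (induction I rule: infinite_finite_induct) (auto intro: C_on_add C_on_const)

lemma C_on_compose_real:
  fixes f :: "real \<Rightarrow> real"
  shows "C_on m UNIV f \<Longrightarrow> C_on m UNIV g \<Longrightarrow> C_on m UNIV (\<lambda>x. f (g x))"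
proof (induction m arbitrary: f g)
  case 0
  then show ?case using continuous_on_compose2[of UNIV f UNIV g] by simp
next
  case (Suc m)
  show ?case
  proof (rule C_on_SucI[OF has_derivative_compose[OF has_frechet_derivative[OF Suc.prems(2)]
          has_frechet_derivative[OF Suc.prems(1)]]])
    fix v
    have lin: "linear (frechet_derivative f (at y))" for y
      using has_frechet_derivative[OF Suc.prems(1)] has_derivative_linear by blast
    \<comment> \<open>On the line a linear map is multiplication by its value at 1. This separates
      the direction from the point, so the derivative of the composite is a product of two functions
      within reach of the induction.\<close>
    have eq: "frechet_derivative f (at y) w = w * frechet_derivative f (at y) 1" for y w
      using linear_scale[OF lin, of y w 1] by simp
    have "C_on m UNIV (\<lambda>x. frechet_derivative g (at x) v * frechet_derivative f (at (g x)) 1)"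
    proof (rule C_on_mult)
      show "C_on m UNIV (\<lambda>x. frechet_derivative g (at x) v)" using Suc.prems by simp
      show "C_on m UNIV (\<lambda>x. frechet_derivative f (at (g x)) 1)"
        by (rule Suc.IH[of "\<lambda>y. frechet_derivative f (at y) 1" g])
          (use Suc.prems(1) C_on_SucD[OF Suc.prems(2)] in simp_all)
    qed
    then show "C_on m UNIV (\<lambda>x. frechet_derivative f (at (g x)) (frechet_derivative g (at x) v))"
      by (subst eq)
  qed
qed

lemma C_on_compose_linear:
  assumes "bounded_linear L"
  shows "C_on m UNIV f \<Longrightarrow> C_on m UNIV (\<lambda>x. f (L x))"
proof (induction m arbitrary: f)
  case 0
  then show ?case using continuous_on_compose2[of UNIV f UNIV L] linear_continuous_on[OF assms] by simp
next
  case (Suc m)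
  show ?case
  proof (rule C_on_SucI[OF has_derivative_compose[OF bounded_linear_imp_has_derivative[OF assms]
          has_frechet_derivative[OF Suc.prems]]])
    show "C_on m UNIV (\<lambda>x. frechet_derivative f (at (L x)) (L v))" for v
      by (rule Suc.IH) (use Suc.prems in simp)
  qed
qed

lemma C_on_norm_sq: "C_on m UNIV (\<lambda>x::'a::euclidean_space. (norm x)\<^sup>2)"
proof -
  have "(\<lambda>x::'a. (norm x)\<^sup>2) = (\<lambda>x. \<Sum>b\<in>Basis. (x \<bullet> b) * (x \<bullet> b))"
    unfolding power2_norm_eq_inner by (rule ext) (rule euclidean_inner)
  then show ?thesis
    by (simp only:) (intro C_on_sum C_on_mult C_on_bounded_linear bounded_linear_inner_left)
qed

lemma C_on_real_SucI:
  fixes f :: "real \<Rightarrow> real"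
  assumes "\<And>x. (f has_real_derivative f' x) (at x)" "C_on m UNIV f'"
  shows "C_on (Suc m) UNIV f"
  by (rule C_on_SucI[of _ "\<lambda>x v. f' x * v"])
    (use assms in \<open>auto simp: has_field_derivative_def intro!: C_on_mult C_on_const\<close>)

text \<open>Termwise differentiation replaces \<open>c\<close> by \<open>diffs c\<close>, whose
  series again converges everywhere; hence the induction over arbitrary \<open>c\<close>.\<close>

lemma C_on_power_series:
  fixes c :: "nat \<Rightarrow> real"
  shows "(\<And>x::real. summable (\<lambda>n. c n * x ^ n)) \<Longrightarrow> C_on m UNIV (\<lambda>x. \<Sum>n. c n * x ^ n)"
proof (induction m arbitrary: c)
  case 0
  have "((\<lambda>x. \<Sum>n. c n * x ^ n) has_real_derivative (\<Sum>n. diffs c n * x ^ n)) (at x)" for x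
    by (rule termdiffs_strong_converges_everywhere) (use 0 in auto)
  then have "isCont (\<lambda>x. \<Sum>n. c n * x ^ n) x" for x by (rule DERIV_isCont)
  then show ?case by (simp add: continuous_at_imp_continuous_on)
next
  case (Suc m)
  have "((\<lambda>x. \<Sum>n. c n * x ^ n) has_real_derivative (\<Sum>n. diffs c n * x ^ n)) (at x)" for x
    by (rule termdiffs_strong_converges_everywhere) (use Suc in auto)
  moreover have "C_on m UNIV (\<lambda>x. \<Sum>n. diffs c n * x ^ n)"
    by (rule Suc.IH) (use termdiff_converges_all Suc.prems in blast)
  ultimately show ?case by (rule C_on_real_SucI)
qed

section \<open>Flat functions and a smooth step\<close>

definition flat_exp :: "nat \<Rightarrow> real \<Rightarrow> real" where
  "flat_exp j x = (if x > 0 then inverse x ^ j * exp (- inverse x) else 0)"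

lemma power_over_fact_le_exp:
  fixes x :: real
  assumes "x \<ge> 0"
  shows "x ^ j / fact j \<le> exp x"
proof -
  have "(\<Sum>i\<in>{j}. x ^ i / fact i) \<le> (\<Sum>i. x ^ i / fact i)"
    by (rule sum_le_suminf)
      (use assms summable_exp_generic[of x] in \<open>auto simp: divide_inverse mult.commute scaleR_conv_of_real\<close>)
  then show ?thesis by (simp add: exp_def scaleR_conv_of_real divide_inverse mult.commute)
qed

text \<open>The term of index \<open>j + 2\<close> in the series of \<open>exp (inverse x)\<close>
  beats the pole of order \<open>j\<close> with two powers to spare; the square is what makes the
  difference quotient at 0 tend to 0.\<close>

lemma flat_exp_le:
  assumes "x > 0"
  shows "\<bar>flat_exp j x\<bar> \<le> fact (Suc (Suc j)) * x\<^sup>2"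
proof -
  have "inverse x ^ (j + 2) / fact (j + 2) \<le> exp (inverse x)"
    using assms by (intro power_over_fact_le_exp) simp
  then have "inverse x ^ j * inverse x ^ 2 \<le> fact (j + 2) * exp (inverse x)"
    by (simp add: power_add divide_le_eq mult_ac power2_eq_square del: power_inverse fact_Suc)
  then have "(inverse x ^ j * inverse x ^ 2) * (x\<^sup>2 * exp (- inverse x))
      \<le> (fact (j + 2) * exp (inverse x)) * (x\<^sup>2 * exp (- inverse x))"
    by (rule mult_right_mono) simp
  moreover have "(inverse x ^ j * inverse x ^ 2) * (x\<^sup>2 * exp (- inverse x)) = inverse x ^ j * exp (- inverse x)"
    using assms by (simp add: field_simps)
  moreover have "(fact (j + 2) * exp (inverse x)) * (x\<^sup>2 * exp (- inverse x)) = fact (j + 2) * x\<^sup>2"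
    by (simp add: exp_minus del: fact_Suc)
  ultimately have "inverse x ^ j * exp (- inverse x) \<le> fact (j + 2) * x\<^sup>2"
    by linarith
  then show ?thesis using assms by (simp add: flat_exp_def del: fact_Suc)
qed

text \<open>The derivative stays in the family, with shifted indices. This is why all powers
  \<open>inverse x ^ j\<close> are carried along instead of the case \<open>j = 0\<close>
  alone.\<close>

lemma flat_exp_has_derivative:
  "(flat_exp j has_real_derivative (flat_exp (j + 2) x - real j * flat_exp (j + 1) x)) (at x)"
proof (cases x "0::real" rule: linorder_cases)
  case less
  have "((\<lambda>_. 0) has_real_derivative 0) (at x)" by simp
  moreover have "\<forall>\<^sub>F y in nhds x. flat_exp j y = 0"
    using eventually_nhds_in_open[of "{..<0}" x] less by (auto simp: flat_exp_def elim!: eventually_mono)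
  ultimately have "(flat_exp j has_real_derivative 0) (at x)"
    using DERIV_cong_ev[of x x "flat_exp j" "\<lambda>_. 0" 0 0] by simp
  then show ?thesis using less by (simp add: flat_exp_def)
next
  case equal
  let ?C = "fact (Suc (Suc j)) :: real"
  have "((\<lambda>h. flat_exp j h / h) \<longlongrightarrow> 0) (at 0)"
  proof (rule Lim_null_comparison)
    have "norm (flat_exp j h / h) \<le> ?C * \<bar>h\<bar>" for h
    proof (cases "h > 0")
      case True
      then have "\<bar>flat_exp j h\<bar> / h \<le> ?C * h"
        using flat_exp_le[OF True, of j] by (simp add: divide_le_eq power2_eq_square mult.assoc del: fact_Suc)
      then show ?thesis using True by (simp del: fact_Suc)
    next
      case False
      then have "flat_exp j h = 0" by (simp add: flat_exp_def)
      then show ?thesis by (simp del: fact_Suc)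
    qed
    then show "\<forall>\<^sub>F h in at 0. norm (flat_exp j h / h) \<le> ?C * \<bar>h\<bar>" by (rule always_eventually[rule_format])
    show "((\<lambda>h. ?C * \<bar>h\<bar>) \<longlongrightarrow> 0) (at 0)" by (auto intro!: tendsto_eq_intros)
  qed
  then show ?thesis using equal by (simp add: DERIV_def flat_exp_def)
next
  case greater
  have "((\<lambda>x. inverse x ^ j * exp (- inverse x)) has_real_derivative
      (flat_exp (j + 2) x - real j * flat_exp (j + 1) x)) (at x)"
  proof -
    have "((\<lambda>x. inverse x ^ j * exp (- inverse x)) has_real_derivative
      real j * inverse x ^ (j - 1) * (- (inverse x * 1 * inverse x)) * exp (- inverse x)
      + exp (- inverse x) * (- (- (inverse x * 1 * inverse x))) * inverse x ^ j) (at x)"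
    proof -
      have d: "((\<lambda>x. inverse x) has_real_derivative - (inverse x * 1 * inverse x)) (at x)"
        using greater by (intro DERIV_inverse' DERIV_ident) simp
      show ?thesis
        using DERIV_mult[OF DERIV_power[OF d] DERIV_fun_exp[OF DERIV_minus[OF d]]] by (simp add: mult_ac)
    qed
    also have "real j * inverse x ^ (j - 1) * (- (inverse x * 1 * inverse x)) * exp (- inverse x)
      + exp (- inverse x) * (- (- (inverse x * 1 * inverse x))) * inverse x ^ j
       = flat_exp (j + 2) x - real j * flat_exp (j + 1) x"
      using greater by (cases j) (simp_all add: flat_exp_def algebra_simps power_add power2_eq_square)
    finally show ?thesis .
  qed
  moreover have "\<forall>\<^sub>F y in nhds x. flat_exp j y = inverse y ^ j * exp (- inverse y)"
    using eventually_nhds_in_open[of "{0<..}" x] greater by (auto simp: flat_exp_def elim!: eventually_mono)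
  ultimately show ?thesis using DERIV_cong_ev[OF refl, of "flat_exp j" _ x] by simp
qed

lemma C_on_flat_exp: "C_on m UNIV (flat_exp j)"
proof (induction m arbitrary: j)
  case 0
  have "isCont (flat_exp j) x" for x by (rule DERIV_isCont[OF flat_exp_has_derivative])
  then show ?case by (simp add: continuous_at_imp_continuous_on)
next
  case (Suc m)
  have "C_on m UNIV (\<lambda>x. flat_exp (j + 2) x + (- real j) * flat_exp (j + 1) x)"
    by (intro C_on_add C_on_mult C_on_const Suc.IH)
  then show ?case by (intro C_on_real_SucI[OF flat_exp_has_derivative]) simp
qed

text \<open>One flat function inside another: the inner difference is at most 0 once x \<ge> 1,
  where the outer function vanishes, and equals \<open>flat_exp 0 1\<close> for x \<le> 0, where the
  quotient is 1.\<close>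

definition smooth_step :: "real \<Rightarrow> real" where
  "smooth_step x = flat_exp 0 (flat_exp 0 1 - flat_exp 0 x) / flat_exp 0 (flat_exp 0 1)"

lemma flat_exp_0_mono: "x \<le> y \<Longrightarrow> flat_exp 0 x \<le> flat_exp 0 y"
  by (auto simp: flat_exp_def)

lemma C_on_smooth_step: "C_on m UNIV smooth_step"
proof -
  have "C_on m UNIV (\<lambda>x. flat_exp 0 (flat_exp 0 1 + (-1) * flat_exp 0 x) * (1 / flat_exp 0 (flat_exp 0 1)))"
    by (rule C_on_mult[OF C_on_compose_real[OF C_on_flat_exp
            C_on_add[OF C_on_const C_on_mult[OF C_on_const C_on_flat_exp]]] C_on_const])
  then show ?thesis by (simp add: smooth_step_def[abs_def])
qed

lemma smooth_step_eq_1: "x \<le> 0 \<Longrightarrow> smooth_step x = 1"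
  by (simp add: smooth_step_def flat_exp_def)

lemma smooth_step_eq_0: "x \<ge> 1 \<Longrightarrow> smooth_step x = 0"
  using flat_exp_0_mono[of 1 x] by (simp add: smooth_step_def flat_exp_def[of 0 "_ - _"])

lemma smooth_step_nonneg: "smooth_step x \<ge> 0"
  by (simp add: smooth_step_def flat_exp_def)

text \<open>Absorbs any power into an exponential of arbitrarily small rate. Since the base
  \<open>1 + x\<close> is at least 1, the exponent can be rounded up to a natural number and a
  single term of the exponential series suffices.\<close>

lemma powr_le_exp:
  fixes a \<delta> :: real
  assumes "\<delta> > 0"
  obtains C where "C > 0" "\<And>x. x \<ge> 0 \<Longrightarrow> (1 + x) powr a \<le> C * exp (\<delta> * x)"
proof -
  define N where "N = nat \<lceil>a\<rceil>"
  have N: "a \<le> real N" unfolding N_def by linarith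
  define C where "C = fact N / \<delta> ^ N * exp \<delta>"
  have "(1 + x) powr a \<le> C * exp (\<delta> * x)" if "x \<ge> 0" for x
  proof -
    have "(1 + x) powr a \<le> (1 + x) powr real N"
      using that N by (intro powr_mono) auto
    also have "\<dots> = (1 + x) ^ N" using that by (simp add: powr_realpow)
    also have "\<dots> = fact N / \<delta> ^ N * ((\<delta> * (1 + x)) ^ N / fact N)"
      using assms by (simp add: power_mult_distrib)
    also have "\<dots> \<le> fact N / \<delta> ^ N * exp (\<delta> * (1 + x))"
      by (rule mult_left_mono) (use assms that in \<open>auto intro!: power_over_fact_le_exp\<close>)
    also have "\<dots> = C * exp (\<delta> * x)" by (simp add: C_def distrib_left exp_add)
    finally show ?thesis .
  qed
  moreover have "C > 0" using assms by (simp add: C_def)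
  ultimately show ?thesis using that by blast
qed

section \<open>The radial eigenfunctions of the Laplacian\<close>

text \<open>The Laplacian of |x|^(2i) is 2i (2i + n - 2) |x|^(2i - 2), so these are the coefficients
  of the radial solution of \<Delta>\<phi> = \<phi> with value 1 at the origin: the mean of exp(x .
  \<theta>) over the unit sphere, a normalised modified Bessel function. The series is taken in w =
  |x|^2, which keeps it smooth at the origin.\<close>

definition radial_coeff :: "nat \<Rightarrow> nat \<Rightarrow> real" where
  "radial_coeff n j = inverse (\<Prod>i=1..j. 2 * real i * (2 * real i + real n - 2))"

definition radial_series :: "nat \<Rightarrow> real \<Rightarrow> real" where
  "radial_series n w = (\<Sum>j. radial_coeff n j * w ^ j)"

definition radial_series' :: "nat \<Rightarrow> real \<Rightarrow> real" where
  "radial_series' n w = (\<Sum>j. diffs (radial_coeff n) j * w ^ j)"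

definition radial_series'' :: "nat \<Rightarrow> real \<Rightarrow> real" where
  "radial_series'' n w = (\<Sum>j. diffs (diffs (radial_coeff n)) j * w ^ j)"

lemma radial_coeff_0 [simp]: "radial_coeff n 0 = 1"
  by (simp add: radial_coeff_def)

lemma radial_coeff_Suc:
  "radial_coeff n (Suc j) = radial_coeff n j / (2 * (real j + 1) * (2 * real j + real n))"
proof -
  have "2 * real (Suc j) * (2 * real (Suc j) + real n - 2) = 2 * (real j + 1) * (2 * real j + real n)"
    by (simp add: algebra_simps)
  then show ?thesis
    by (simp only: radial_coeff_def prod.nat_ivl_Suc' le_add1 One_nat_def)
      (simp add: divide_inverse)
qed

context
  fixes n :: nat
  assumes n: "n \<ge> 1"
begin

lemma radial_coeff_pos: "radial_coeff n j > 0"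
  by (induction j) (use n in \<open>auto simp: radial_coeff_Suc intro!: divide_pos_pos mult_pos_pos add_nonneg_pos\<close>)

lemma radial_coeff_rec:
  "2 * (real j + 1) * (2 * real j + real n) * radial_coeff n (Suc j) = radial_coeff n j"
proof -
  have "2 * real j + real n > 0" using n by (intro add_nonneg_pos) auto
  then show ?thesis by (simp add: radial_coeff_Suc)
qed

lemma radial_coeff_le_fact: "radial_coeff n j \<le> 1 / fact j"
proof (induction j)
  case (Suc j)
  have "(real j + 1) * 1 \<le> (2 * (real j + 1)) * (2 * real j + real n)"
    using n by (intro mult_mono) auto
  then have "radial_coeff n j / (2 * (real j + 1) * (2 * real j + real n)) \<le> (1 / fact j) / (real j + 1)"
    by (intro frac_le Suc) auto
  then show ?case by (simp add: radial_coeff_Suc mult.commute add.commute)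
qed simp

lemma radial_coeff_summable: "summable (\<lambda>j. radial_coeff n j * x ^ j)"
proof (rule summable_comparison_test)
  have "summable (\<lambda>j. inverse (fact j) * \<bar>x\<bar> ^ j)"
    using summable_exp[of "\<bar>x\<bar>"] .
  then show "summable (\<lambda>j. inverse (fact j) * \<bar>x\<bar> ^ j)" .
  show "\<exists>N. \<forall>j\<ge>N. norm (radial_coeff n j * x ^ j) \<le> inverse (fact j) * \<bar>x\<bar> ^ j"
  proof (intro exI[of _ 0] allI impI)
    show "norm (radial_coeff n j * x ^ j) \<le> inverse (fact j) * \<bar>x\<bar> ^ j" for j
      using mult_right_mono[OF radial_coeff_le_fact[of j], of "\<bar>x\<bar> ^ j"] radial_coeff_pos[of j]
      by (simp add: abs_mult power_abs inverse_eq_divide)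
  qed
qed

lemma radial_diffs_summable: "summable (\<lambda>j. diffs (radial_coeff n) j * x ^ j)"
  using termdiff_converges_all[OF radial_coeff_summable] .

lemma radial_diffs2_summable: "summable (\<lambda>j. diffs (diffs (radial_coeff n)) j * x ^ j)"
  using termdiff_converges_all[OF radial_diffs_summable] .

lemma radial_series_deriv: "(radial_series n has_real_derivative radial_series' n x) (at x)"
  using termdiffs_strong_converges_everywhere[OF radial_coeff_summable]
  by (simp add: radial_series_def[abs_def] radial_series'_def)

lemma radial_series'_deriv: "(radial_series' n has_real_derivative radial_series'' n x) (at x)"
  using termdiffs_strong_converges_everywhere[OF radial_diffs_summable]
  by (simp add: radial_series'_def[abs_def] radial_series''_def)

lemma C_on_radial_series: "C_on m UNIV (radial_series n)"
  using C_on_power_series[OF radial_coeff_summable] by (simp add: radial_series_def[abs_def])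

text \<open>This is \<phi>'' + (n - 1) / r \<phi>' = \<phi> rewritten in the variable w = r^2,
  checked on coefficients.\<close>

lemma radial_series_ode: "4 * w * radial_series'' n w + 2 * real n * radial_series' n w = radial_series n w"
proof -
  let ?c = "radial_coeff n"
  define h where "h j = real j * diffs ?c j * w ^ j" for j
  have "(\<lambda>j. w * (diffs (diffs ?c) j * w ^ j)) sums (w * radial_series'' n w)"
    unfolding radial_series''_def by (intro sums_mult summable_sums radial_diffs2_summable)
  moreover have "w * (diffs (diffs ?c) j * w ^ j) = h (Suc j)" for j
    by (simp add: h_def diffs_def algebra_simps)
  ultimately have "(\<lambda>j. h (Suc j)) sums (w * radial_series'' n w)" by simp
  \<comment> \<open>The term of index 0 of \<open>h\<close> carries the factor 0, so shifting the
    index costs nothing.\<close>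
  then have "h sums (w * radial_series'' n w)"
    by (subst (asm) sums_Suc_iff) (simp add: h_def)
  then have "(\<lambda>j. 4 * h j + 2 * real n * (diffs ?c j * w ^ j)) sums
      (4 * (w * radial_series'' n w) + 2 * real n * radial_series' n w)"
    unfolding radial_series'_def
    by (intro sums_add sums_mult summable_sums radial_diffs_summable)
  moreover have "4 * h j + 2 * real n * (diffs ?c j * w ^ j) = ?c j * w ^ j" for j
    by (subst radial_coeff_rec[symmetric]) (simp add: h_def diffs_def algebra_simps)
  ultimately have "(\<lambda>j. ?c j * w ^ j) sums (4 * (w * radial_series'' n w) + 2 * real n * radial_series' n w)"
    by simp
  then show ?thesis by (simp add: radial_series_def sums_iff mult.assoc)
qed

lemma radial_series_ge_1: "w \<ge> 0 \<Longrightarrow> radial_series n w \<ge> 1"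
  using sum_le_suminf[OF radial_coeff_summable[of w], of "{0}"] radial_coeff_pos
  by (simp add: radial_series_def less_imp_le)

lemma radial_series_mono: "0 \<le> v \<Longrightarrow> v \<le> w \<Longrightarrow> radial_series n v \<le> radial_series n w"
  unfolding radial_series_def using radial_coeff_pos
  by (intro suminf_le radial_coeff_summable mult_left_mono power_mono) (auto simp: less_imp_le)

text \<open>Squaring the coefficient permits a comparison with factorials instead of Gamma values at
  half-integers; only the ratio of consecutive terms has to be at most 1.\<close>

lemma radial_coeff_sq_le:
  "(radial_coeff n j)\<^sup>2 * (fact (2 * j) * fact (2 * j + n - 1)) \<le> fact (n - 1)"
proof (induction j)
  case 0
  then show ?case using n by simp
next
  case (Suc j)
  let ?x = "real j" and ?n = "real n"
  have f1: "(fact (2 * Suc j) :: real) = (2 * ?x + 2) * (2 * ?x + 1) * fact (2 * j)"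
    by (simp add: algebra_simps)
  have "2 * Suc j + n - 1 = Suc (Suc (2 * j + n - 1))" using n by simp
  then have f2: "(fact (2 * Suc j + n - 1) :: real) = (2 * ?x + ?n + 1) * (2 * ?x + ?n) * fact (2 * j + n - 1)"
    using n by (simp only: fact_Suc) (simp add: of_nat_diff algebra_simps)
  define d where "d = 2 * (?x + 1) * (2 * ?x + ?n)"
  have d: "d > 0" unfolding d_def using n by (intro mult_pos_pos add_nonneg_pos) auto
  \<comment> \<open>The right side exceeds the left by exactly \<open>n - 1\<close>.\<close>
  have key: "(2 * ?x + 1) * (2 * ?x + ?n + 1) \<le> 2 * (?x + 1) * (2 * ?x + ?n)"
    using n by (simp add: algebra_simps)
  have "(2 * ?x + 2) * (2 * ?x + 1) * ((2 * ?x + ?n + 1) * (2 * ?x + ?n))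
      = d * ((2 * ?x + 1) * (2 * ?x + ?n + 1))" by (simp add: d_def algebra_simps)
  also have "\<dots> \<le> d * d" using key d by (intro mult_left_mono) (auto simp: d_def)
  finally have le: "(2 * ?x + 2) * (2 * ?x + 1) * ((2 * ?x + ?n + 1) * (2 * ?x + ?n)) / d\<^sup>2 \<le> 1"
    using d by (simp add: power2_eq_square)
  have "(radial_coeff n (Suc j))\<^sup>2 * (fact (2 * Suc j) * fact (2 * Suc j + n - 1))
     = ((radial_coeff n j)\<^sup>2 * (fact (2 * j) * fact (2 * j + n - 1)))
       * ((2 * ?x + 2) * (2 * ?x + 1) * ((2 * ?x + ?n + 1) * (2 * ?x + ?n)) / d\<^sup>2)"
    unfolding f1 f2 radial_coeff_Suc d_def[symmetric] by (simp add: power_divide mult_ac)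
  also have "\<dots> \<le> ((radial_coeff n j)\<^sup>2 * (fact (2 * j) * fact (2 * j + n - 1))) * 1"
    by (intro mult_left_mono le) simp
  also have "\<dots> \<le> fact (n - 1)" using Suc by simp
  finally show ?case .
qed

lemma exp_series_sparse_le:
  fixes r :: real
  assumes "r \<ge> 0"
  shows "summable (\<lambda>j. r ^ (2 * j + N) / fact (2 * j + N))" "(\<Sum>j. r ^ (2 * j + N) / fact (2 * j + N)) \<le> exp r"
proof -
  let ?f = "\<lambda>i. r ^ i / fact i"
  have s: "summable ?f" using summable_exp[of r] by (simp add: divide_inverse mult.commute)
  have e: "suminf ?f = exp r" by (simp add: exp_def scaleR_conv_of_real divide_inverse mult.commute)
  have le: "(\<Sum>j<K. ?f (2 * j + N)) \<le> exp r" for K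
  proof -
    have "(\<Sum>j<K. ?f (2 * j + N)) = sum ?f ((\<lambda>j. 2 * j + N) ` {..<K})"
      by (subst sum.reindex) (auto simp: inj_on_def)
    also have "\<dots> \<le> suminf ?f"
      by (rule sum_le_suminf[OF s]) (use assms in auto)
    finally show ?thesis unfolding e .
  qed
  show su: "summable (\<lambda>j. ?f (2 * j + N))"
    by (rule summableI_nonneg_bounded[where x="exp r"]) (use le assms in auto)
  show "(\<Sum>j. ?f (2 * j + N)) \<le> exp r"
    by (rule suminf_le_const[OF su le])
qed

text \<open>The coefficient bound is the geometric mean of the coefficients of \<open>exp\<close> and of \<open>r powr (1 - n) * exp r\<close>.\<close>

lemma radial_series_le_large:
  assumes r: "r > 0"
  shows "radial_series n (r\<^sup>2) \<le> sqrt (fact (n - 1)) * r powr (- (real n - 1) / 2) * exp r"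
proof -
  define \<theta> where "\<theta> = r powr (- (real n - 1) / 2)"
  define S where "S = sqrt (fact (n - 1) :: real)"
  have \<theta>: "\<theta> > 0" using r by (simp add: \<theta>_def)
  have "r ^ (n - 1) = r powr (real n - 1)" using r n by (simp add: powr_realpow[symmetric] of_nat_diff)
  then have \<theta>2: "\<theta> * \<theta> * r ^ (n - 1) = 1" using r unfolding \<theta>_def by (simp add: powr_add[symmetric])
  have t: "radial_coeff n j * (r\<^sup>2) ^ j \<le>
     S * \<theta> / 2 * (r ^ (2 * j + 0) / fact (2 * j + 0) + r ^ (2 * j + (n - 1)) / fact (2 * j + (n - 1)))" for j
  proof -
    define a where "a = r ^ (2 * j) / fact (2 * j)"
    define b where "b = r ^ (2 * j + (n - 1)) / fact (2 * j + (n - 1))"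
    have ab: "a \<ge> 0" "b \<ge> 0" using r by (auto simp: a_def b_def)
    have "(radial_coeff n j * r ^ (2 * j))\<^sup>2 * (fact (2 * j) * fact (2 * j + n - 1))
        = ((radial_coeff n j)\<^sup>2 * (fact (2 * j) * fact (2 * j + n - 1))) * (r ^ (2 * j))\<^sup>2"
      by (simp add: power_mult_distrib mult_ac)
    also have "\<dots> \<le> fact (n - 1) * (r ^ (2 * j))\<^sup>2"
      by (rule mult_right_mono[OF radial_coeff_sq_le]) simp
    finally have "(radial_coeff n j * r ^ (2 * j))\<^sup>2 \<le> fact (n - 1) * (r ^ (2 * j))\<^sup>2 / (fact (2 * j) * fact (2 * j + n - 1))"
      by (simp add: pos_le_divide_eq)
    also have "\<dots> = fact (n - 1) * (\<theta> * \<theta> * r ^ (n - 1)) * (r ^ (2 * j))\<^sup>2 / (fact (2 * j) * fact (2 * j + n - 1))"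
      by (simp only: \<theta>2 mult_1_right)
    also have "\<dots> = (S * \<theta>)\<^sup>2 * (a * b)"
    proof -
      have SS: "fact (n - 1) = S * S" by (simp add: S_def)
      have e: "2 * j + n - 1 = 2 * j + (n - 1)" using n by simp
      show ?thesis unfolding e SS by (simp add: a_def b_def power_add power2_eq_square mult_ac)
    qed
    also have "\<dots> \<le> (S * \<theta>)\<^sup>2 * ((a + b) / 2)\<^sup>2"
    proof (rule mult_left_mono)
      show "a * b \<le> ((a + b) / 2)\<^sup>2"
        using sum_squares_bound[of a b] by (simp add: power2_eq_square field_simps)
    qed simp
    also have "\<dots> = (S * \<theta> / 2 * (a + b))\<^sup>2" by (simp add: power_mult_distrib power_divide)
    finally have "radial_coeff n j * r ^ (2 * j) \<le> S * \<theta> / 2 * (a + b)"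
      by (rule power2_le_imp_le) (use ab \<theta> in \<open>auto simp: S_def\<close>)
    then show ?thesis by (simp add: a_def b_def power_mult)
  qed
  have "radial_series n (r\<^sup>2) \<le> (\<Sum>j. S * \<theta> / 2 * (r ^ (2 * j + 0) / fact (2 * j + 0) + r ^ (2 * j + (n - 1)) / fact (2 * j + (n - 1))))"
    unfolding radial_series_def
    by (intro suminf_le t radial_coeff_summable summable_mult summable_add exp_series_sparse_le(1)) (use r in auto)
  also have "\<dots> = S * \<theta> / 2 * ((\<Sum>j. r ^ (2 * j + 0) / fact (2 * j + 0)) + (\<Sum>j. r ^ (2 * j + (n - 1)) / fact (2 * j + (n - 1))))"
  proof -
    have "summable (\<lambda>j. r ^ (2 * j + 0) / fact (2 * j + 0))" "summable (\<lambda>j. r ^ (2 * j + (n - 1)) / fact (2 * j + (n - 1)))"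
      using exp_series_sparse_le(1)[of r 0] exp_series_sparse_le(1)[of r "n - 1"] r by simp_all
    then show ?thesis by (simp only: suminf_add suminf_mult summable_add)
  qed
  also have "\<dots> \<le> S * \<theta> / 2 * (exp r + exp r)"
    using r \<theta> by (intro mult_left_mono add_mono exp_series_sparse_le(2)) (auto simp: S_def)
  finally show ?thesis by (simp add: S_def \<theta>_def)
qed

text \<open>The exponent \<open>- (n - 1) / 2\<close> is the sharp one; it enters \<open>hh\<close>,
  where the critical case leaves no room for loss. Near 0 monotonicity replaces the bound for large
  r, and \<open>2 powr q\<close> pays for passing from r to 1 + r.\<close>

lemma radial_series_le:
  obtains C where "C > 0"
    "\<And>r. r \<ge> 0 \<Longrightarrow> radial_series n (r\<^sup>2) \<le> C * (1 + r) powr (- (real n - 1) / 2) * exp r"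
proof -
  define q where "q = (real n - 1) / 2"
  have q: "q \<ge> 0" using n by (simp add: q_def)
  define C where "C = (sqrt (fact (n - 1)) + radial_series n 1) * 2 powr q"
  have R1: "radial_series n 1 \<ge> 1" by (rule radial_series_ge_1) simp
  have C: "C > 0" unfolding C_def using R1 by (intro mult_pos_pos add_nonneg_pos) auto
  have "radial_series n (r\<^sup>2) \<le> C * (1 + r) powr (- q) * exp r" if r: "r \<ge> 0" for r
  proof (cases "r \<le> 1")
    case True
    have "radial_series n (r\<^sup>2) \<le> radial_series n 1"
      using r True by (intro radial_series_mono) (auto simp: power_le_one)
    also have "\<dots> \<le> radial_series n 1 * ((2 powr q * (1 + r) powr (- q)) * exp r)"
    proof -
      have "(1 + r) powr q \<le> 2 powr q" using r True q by (intro powr_mono2) auto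
      then have "1 \<le> 2 powr q * (1 + r) powr (- q)" using r by (simp add: powr_minus field_simps)
      moreover have "1 \<le> exp r" using r by simp
      ultimately have "1 * 1 \<le> (2 powr q * (1 + r) powr (- q)) * exp r" by (intro mult_mono) auto
      then show ?thesis using R1 by (metis mult.right_neutral mult_left_mono order_trans zero_le_one)
    qed
    also have "\<dots> \<le> C * (1 + r) powr (- q) * exp r"
      unfolding C_def by (simp add: algebra_simps)
    finally show ?thesis .
  next
    case False
    then have r1: "r > 1" by simp
    have "radial_series n (r\<^sup>2) \<le> sqrt (fact (n - 1)) * r powr (- q) * exp r"
      using radial_series_le_large[of r] r1 by (simp add: q_def minus_divide_left)
    also have "r powr (- q) \<le> 2 powr q * (1 + r) powr (- q)"
    proof -
      have "(1 + r) powr q \<le> (2 * r) powr q" using r1 q by (intro powr_mono2) auto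
      then show ?thesis using r1 by (simp add: powr_minus powr_mult field_simps)
    qed
    then have "sqrt (fact (n - 1)) * r powr (- q) * exp r \<le> sqrt (fact (n - 1)) * (2 powr q * (1 + r) powr (- q)) * exp r"
      by (intro mult_right_mono mult_left_mono) auto
    also have "\<dots> \<le> C * (1 + r) powr (- q) * exp r"
      unfolding C_def using R1 by (simp add: algebra_simps)
    finally show ?thesis .
  qed
  then show ?thesis using that[OF C] by (simp add: q_def minus_divide_left)
qed

end

section \<open>Decaying solutions of the modified Bessel equation\<close>

text \<open>Serves to differentiate under an integral sign: a pointwise Taylor bound with quadratic
  remainder is integrated and yields the derivative directly. It is applied to the Bessel integrals
  and to the functional \<open>X\<close>.\<close>

lemma DERIV_quadratic_remainder:
  fixes f :: "real \<Rightarrow> real"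
  assumes "\<delta> > 0" "\<And>h. \<bar>h\<bar> < \<delta> \<Longrightarrow> \<bar>f (x + h) - f x - h * D\<bar> \<le> C * h\<^sup>2"
  shows "(f has_real_derivative D) (at x)"
proof -
  have "((\<lambda>h. (f (x + h) - f x) / h - D) \<longlongrightarrow> 0) (at 0)"
  proof (rule Lim_null_comparison)
    have "norm ((f (x + h) - f x) / h - D) \<le> C * \<bar>h\<bar>" if "h \<noteq> 0" "\<bar>h\<bar> < \<delta>" for h
    proof -
      have "(f (x + h) - f x) / h - D = (f (x + h) - f x - h * D) / h" using that by (simp add: field_simps)
      then have "norm ((f (x + h) - f x) / h - D) = \<bar>f (x + h) - f x - h * D\<bar> / \<bar>h\<bar>" by simp
      also have "\<dots> \<le> C * h\<^sup>2 / \<bar>h\<bar>" by (intro divide_right_mono assms that) auto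
      also have "\<dots> = C * \<bar>h\<bar>" using that by (simp add: power2_eq_square field_simps)
      finally show ?thesis .
    qed
    then show "\<forall>\<^sub>F h in at 0. norm ((f (x + h) - f x) / h - D) \<le> C * \<bar>h\<bar>"
      unfolding eventually_at using assms(1) by (intro exI[of _ \<delta>]) auto
    show "((\<lambda>h. C * \<bar>h\<bar>) \<longlongrightarrow> 0) (at 0)" by (auto intro!: tendsto_eq_intros)
  qed
  then show ?thesis unfolding DERIV_def by (simp add: LIM_zero_iff)
qed

lemma abs_exp_minus_one_le: "\<bar>exp x - 1\<bar> \<le> \<bar>x\<bar> * exp \<bar>x\<bar>" for x :: real
proof -
  have "exp x - 1 \<le> x * exp x"
  proof -
    have "1 - x \<le> exp (- x)" using exp_ge_add_one_self[of "- x"] by simp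
    then have "(1 - x) * exp x \<le> exp (- x) * exp x" by (rule mult_right_mono) simp
    then show ?thesis by (simp add: algebra_simps exp_minus)
  qed
  moreover have "exp x - 1 \<ge> x" using exp_ge_add_one_self[of x] by linarith
  moreover have "\<bar>x\<bar> * exp x \<le> \<bar>x\<bar> * exp \<bar>x\<bar>" by (intro mult_left_mono) auto
  moreover have "\<bar>x\<bar> * 1 \<le> \<bar>x\<bar> * exp \<bar>x\<bar>" by (intro mult_left_mono) auto
  moreover have "x \<le> \<bar>x\<bar> \<and> - x \<le> \<bar>x\<bar>" "x * exp x \<le> \<bar>x\<bar> * exp x" by (auto intro: mult_right_mono)
  ultimately have "exp x - 1 \<le> \<bar>x\<bar> * exp \<bar>x\<bar>" "- (exp x - 1) \<le> \<bar>x\<bar> * exp \<bar>x\<bar>" by linarith+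
  then show ?thesis by (rule abs_leI)
qed

lemma exp_taylor_1_le: "\<bar>exp x - 1 - x\<bar> \<le> x\<^sup>2 * exp \<bar>x\<bar>" for x :: real
proof -
  have "(1 - x) * exp x \<le> exp (- x) * exp x"
    using exp_ge_add_one_self[of "- x"] by (intro mult_right_mono) auto
  then have "exp x - 1 - x \<le> x * (exp x - 1)" by (simp add: algebra_simps exp_minus)
  also have "\<dots> \<le> \<bar>x\<bar> * \<bar>exp x - 1\<bar>" by (metis abs_ge_self abs_mult)
  also have "\<dots> \<le> \<bar>x\<bar> * (\<bar>x\<bar> * exp \<bar>x\<bar>)" by (intro mult_left_mono abs_exp_minus_one_le) auto
  finally have "exp x - 1 - x \<le> x\<^sup>2 * exp \<bar>x\<bar>" by (simp add: power2_eq_square mult.assoc)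
  then show ?thesis using exp_ge_add_one_self[of x] by linarith
qed

lemma norm_LINT_le:
  fixes f g :: "'a \<Rightarrow> real"
  assumes "integrable M f" "integrable M g" "\<And>x. norm (f x) \<le> g x"
  shows "norm (integral\<^sup>L M f) \<le> integral\<^sup>L M g"
proof -
  have "norm (integral\<^sup>L M f) \<le> (LINT x|M. norm (f x))" by (rule integral_norm_bound)
  also have "\<dots> \<le> integral\<^sup>L M g" by (intro integral_mono integrable_norm assms)
  finally show ?thesis .
qed

lemma exp_decay_integrable:
  assumes "z > (0::real)"
  shows "set_integrable lborel {0<..} (\<lambda>s. exp (- z * s))" "(LINT s:{0<..}|lborel. exp (- z * s)) = 1 / z"
proof -
  have h: "((\<lambda>s. exp (- z * s)) has_integral exp (- z * 0) / z) {0..}"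
    by (rule has_integral_exp_minus_to_infinity[OF assms])
  have "negligible {x::real. x \<in> {0..} - {0<..} \<and> exp (- z * x) \<noteq> 0}"
       "negligible {x::real. x \<in> {0<..} - {0..} \<and> exp (- z * x) \<noteq> 0}"
    by (rule negligible_subset[OF negligible_sing[of 0]], auto)+
  then have h': "((\<lambda>s. exp (- z * s)) has_integral 1 / z) {0<..}"
    using has_integral_spike_set_eq[of "{0..}" "{0<..}" "\<lambda>s. exp (- z * s)" "1 / z"] h by simp
  have ai: "(\<lambda>s. exp (- z * s)) absolutely_integrable_on {0<..}"
    using h' by (intro nonnegative_absolutely_integrable_1) (auto simp: integrable_on_def)
  show si: "set_integrable lborel {0<..} (\<lambda>s. exp (- z * s))"
    using ai unfolding set_integrable_def by (subst (asm) integrable_completion) auto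
  show "(LINT s:{0<..}|lborel. exp (- z * s)) = 1 / z"
    using set_borel_integral_eq_integral(2)[OF si] h' by (simp add: integral_unique)
qed

text \<open>After the shift of \<open>s\<close> by 1,
  \<open>exp (- z) * bessel_J \<alpha> 0 z\<close> is a constant multiple of z^(- \<alpha> - 1/2)
  K(z), where K is the modified Bessel function of the second kind of order \<alpha> + 1/2. The
  index \<open>m\<close> counts derivatives in \<open>z\<close>, up to sign.\<close>

definition bessel_J :: "real \<Rightarrow> nat \<Rightarrow> real \<Rightarrow> real" where
  "bessel_J \<alpha> m z = (LINT s:{0<..}|lborel. exp (- z * s) * (s ^ m * (s * (s + 2)) powr \<alpha>))"

context
  fixes \<alpha> :: real
  assumes \<alpha>: "\<alpha> \<ge> 0"
begin

lemma bessel_weight_le: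
  assumes "\<delta> > 0"
  obtains C where "C > 0" "\<And>s. s > 0 \<Longrightarrow> s ^ m * (s * (s + 2)) powr \<alpha> \<le> C * exp (\<delta> * s)"
proof -
  obtain C where C: "C > 0" "\<And>x. x \<ge> 0 \<Longrightarrow> (1 + x) powr (real m + 2 * \<alpha>) \<le> C * exp (\<delta> * x)"
    using powr_le_exp[OF assms] by blast
  have "s ^ m * (s * (s + 2)) powr \<alpha> \<le> (C * exp \<delta>) * exp (\<delta> * s)" if "s > 0" for s
  proof -
    have "s ^ m * (s * (s + 2)) powr \<alpha> \<le> (2 + s) ^ m * ((2 + s) * (2 + s)) powr \<alpha>"
      using that \<alpha> by (intro mult_mono power_mono powr_mono2) auto
    also have "\<dots> = (1 + (1 + s)) powr (real m + 2 * \<alpha>)"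
    proof -
      have "(2 + s) ^ m = (2 + s) powr real m" using that by (subst powr_realpow) auto
      moreover have "((2 + s) * (2 + s)) powr \<alpha> = (2 + s) powr (2 * \<alpha>)"
        unfolding mult_2[of \<alpha>] powr_add by (rule powr_mult)
      moreover have "1 + (1 + s) = 2 + s" by simp
      ultimately show ?thesis by (simp only: powr_add)
    qed
    also have "\<dots> \<le> C * exp (\<delta> * (1 + s))" using that by (intro C) auto
    finally show ?thesis by (simp add: distrib_left exp_add mult.assoc)
  qed
  then show ?thesis using that[of "C * exp \<delta>"] C by simp
qed

lemma bessel_integrable:
  assumes "z > 0"
  shows "set_integrable lborel {0<..} (\<lambda>s. exp (- z * s) * (s ^ m * (s * (s + 2)) powr \<alpha>))"
proof -
  obtain C where C: "C > 0" "\<And>s. s > 0 \<Longrightarrow> s ^ m * (s * (s + 2)) powr \<alpha> \<le> C * exp (z / 2 * s)"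
    using bessel_weight_le[of "z / 2" m] assms by auto
  have i: "set_integrable lborel {0<..} (\<lambda>s. C * exp (- (z / 2) * s))"
    using exp_decay_integrable(1)[of "z / 2"] assms by (intro set_integrable_mult_right) auto
  show ?thesis
  proof (rule set_integrable_bound[OF i])
    show "set_borel_measurable lborel {0<..} (\<lambda>s. exp (- z * s) * (s ^ m * (s * (s + 2)) powr \<alpha>))"
      by (simp add: set_borel_measurable_def)
    have "norm (exp (- z * s) * (s ^ m * (s * (s + 2)) powr \<alpha>)) \<le> norm (C * exp (- (z / 2) * s))"
      if "s > 0" for s
    proof -
      have "exp (- z * s) * (s ^ m * (s * (s + 2)) powr \<alpha>) \<le> exp (- z * s) * (C * exp (z / 2 * s))"
        using C(2)[OF that] by (intro mult_left_mono) auto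
      also have "\<dots> = C * exp (- (z / 2) * s)" by (simp add: exp_add[symmetric] algebra_simps)
      finally show ?thesis using that C by (simp add: abs_mult)
    qed
    then show "AE s in lborel. s \<in> {0<..} \<longrightarrow>
      norm (exp (- z * s) * (s ^ m * (s * (s + 2)) powr \<alpha>)) \<le> norm (C * exp (- (z / 2) * s))" by simp
  qed
qed

lemma bessel_J_pos:
  assumes "z > 0"
  shows "bessel_J \<alpha> m z > 0"
proof -
  let ?f = "\<lambda>s. exp (- z * s) * (s ^ m * (s * (s + 2)) powr \<alpha>)"
  have nn: "AE s in lborel. 0 \<le> indicator {0<..} s *\<^sub>R ?f s"
    by (auto simp: indicator_def)
  have "\<not> (AE s in lborel. indicator {0<..} s *\<^sub>R ?f s = 0)"
  proof
    assume "AE s in lborel. indicator {0<..} s *\<^sub>R ?f s = 0"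
    then have "AE s in lborel. s \<notin> {0<..<1::real}"
      by eventually_elim (auto simp: indicator_def)
    then have "{0<..<1::real} \<in> null_sets lborel"
      using AE_iff_null_sets[of "{0<..<1::real}" lborel] by simp
    then have "emeasure lborel {0<..<1::real} = 0" by (rule null_setsD1)
    then show False by (simp only: emeasure_lborel_Ioo[of 0 1, OF zero_le_one]) simp
  qed
  then have "(LINT s|lborel. indicator {0<..} s *\<^sub>R ?f s) \<noteq> 0"
    using integral_nonneg_eq_0_iff_AE[OF bessel_integrable[OF assms, unfolded set_integrable_def] nn] by blast
  moreover have "(LINT s|lborel. indicator {0<..} s *\<^sub>R ?f s) \<ge> 0" by (intro integral_nonneg_AE nn)
  ultimately show ?thesis by (simp add: bessel_J_def set_lebesgue_integral_def)
qed

text \<open>The remainder is controlled by the integral with two more powers of s at half the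
  argument: for |h| < z / 2 the factor exp(|h| s) uses up at most half of the decay exp(- z
  s).\<close>

lemma bessel_J_deriv:
  assumes z: "z > 0"
  shows "(bessel_J \<alpha> m has_real_derivative - bessel_J \<alpha> (Suc m) z) (at z)"
proof (rule DERIV_quadratic_remainder[where \<delta> = "z / 2" and C = "bessel_J \<alpha> (Suc (Suc m)) (z / 2)"])
  show "z / 2 > 0" using z by simp
  fix h :: real assume h: "\<bar>h\<bar> < z / 2"
  let ?w = "\<lambda>m s. s ^ m * (s * (s + 2)) powr \<alpha>"
  have zh: "z + h > 0" "z / 2 > 0" using h z by auto
  note I = bessel_integrable[of "z + h" m, OF zh(1)] bessel_integrable[of z m, OF z]
    bessel_integrable[of z "Suc m", OF z] bessel_integrable[of "z / 2" "Suc (Suc m)", OF zh(2)]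
  have D: "bessel_J \<alpha> m (z + h) - bessel_J \<alpha> m z - h * - bessel_J \<alpha> (Suc m) z
     = (LINT s:{0<..}|lborel. exp (- (z + h) * s) * ?w m s - exp (- z * s) * ?w m s + h * (exp (- z * s) * ?w (Suc m) s))"
    unfolding bessel_J_def using I
    by (simp add: set_integral_add set_integral_diff set_integrable_mult_right)
  have "\<bar>bessel_J \<alpha> m (z + h) - bessel_J \<alpha> m z - h * - bessel_J \<alpha> (Suc m) z\<bar>
     \<le> (LINT s:{0<..}|lborel. h\<^sup>2 * (exp (- (z / 2) * s) * ?w (Suc (Suc m)) s))"
    unfolding D real_norm_def[symmetric] set_lebesgue_integral_def
  proof (rule norm_LINT_le)
    show "integrable lborel (\<lambda>s. indicator {0<..} s *\<^sub>R (exp (- (z + h) * s) * ?w m s - exp (- z * s) * ?w m s + h * (exp (- z * s) * ?w (Suc m) s)))"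
      using I unfolding set_integrable_def[symmetric] by (intro set_integral_add set_integral_diff set_integrable_mult_right) auto
    show "integrable lborel (\<lambda>s. indicator {0<..} s *\<^sub>R (h\<^sup>2 * (exp (- (z / 2) * s) * ?w (Suc (Suc m)) s)))"
      using I unfolding set_integrable_def[symmetric] by (intro set_integrable_mult_right) auto
    fix s :: real
    show "norm (indicator {0<..} s *\<^sub>R (exp (- (z + h) * s) * ?w m s - exp (- z * s) * ?w m s + h * (exp (- z * s) * ?w (Suc m) s)))
      \<le> indicator {0<..} s *\<^sub>R (h\<^sup>2 * (exp (- (z / 2) * s) * ?w (Suc (Suc m)) s))"
    proof (cases "s > 0")
      case True
      have w: "?w m s \<ge> 0" using True by simp
      have e: "\<bar>exp (- (h * s)) - 1 + h * s\<bar> \<le> (h * s)\<^sup>2 * exp (\<bar>h\<bar> * s)"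
        using exp_taylor_1_le[of "- (h * s)"] True by (simp add: abs_mult)
      have "exp (- (z + h) * s) = exp (- z * s) * exp (- (h * s))" by (simp add: exp_add[symmetric] algebra_simps)
      then have "exp (- (z + h) * s) * ?w m s - exp (- z * s) * ?w m s + h * (exp (- z * s) * ?w (Suc m) s)
        = (exp (- z * s) * ?w m s) * (exp (- (h * s)) - 1 + h * s)" by (simp add: algebra_simps)
      then have "\<bar>exp (- (z + h) * s) * ?w m s - exp (- z * s) * ?w m s + h * (exp (- z * s) * ?w (Suc m) s)\<bar>
        = (exp (- z * s) * ?w m s) * \<bar>exp (- (h * s)) - 1 + h * s\<bar>"
        using abs_mult_pos'[of "exp (- z * s) * ?w m s"] w by (metis (no_types, lifting) exp_ge_zero mult_nonneg_nonneg)
      also have "\<dots> \<le> (exp (- z * s) * ?w m s) * ((h * s)\<^sup>2 * exp (z / 2 * s))"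
      proof (intro mult_left_mono order_trans[OF e])
        show "exp (\<bar>h\<bar> * s) \<le> exp (z / 2 * s)" using h True by (simp add: mult_right_mono)
      qed (use w in auto)
      also have "\<dots> = h\<^sup>2 * ((exp (- z * s) * exp (z / 2 * s)) * ?w (Suc (Suc m)) s)"
        by (simp add: power_mult_distrib power2_eq_square mult_ac)
      also have "exp (- z * s) * exp (z / 2 * s) = exp (- (z / 2) * s)"
        by (simp add: exp_add[symmetric] algebra_simps)
      finally show ?thesis using True by simp
    qed (simp add: indicator_def)
  qed
  also have "\<dots> = h\<^sup>2 * bessel_J \<alpha> (Suc (Suc m)) (z / 2)" by (simp add: bessel_J_def)
  finally show "\<bar>bessel_J \<alpha> m (z + h) - bessel_J \<alpha> m z - h * - bessel_J \<alpha> (Suc m) z\<bar>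
    \<le> bessel_J \<alpha> (Suc (Suc m)) (z / 2) * h\<^sup>2" by (simp add: mult.commute)
qed

text \<open>The derivative of \<open>exp (- z * s) * (s * (s + 2)) powr (\<alpha> + 1)\<close> has
  integral zero over the half-line, because this function vanishes at both ends. Written in terms of
  the moments, this is the Bessel equation.\<close>

lemma bessel_J_relation:
  assumes z: "z > 0"
  shows "z * (bessel_J \<alpha> 2 z + 2 * bessel_J \<alpha> 1 z) = (2 * \<alpha> + 2) * (bessel_J \<alpha> 1 z + bessel_J \<alpha> 0 z)"
proof -
  let ?e = "\<lambda>m s. exp (- z * s) * (s ^ m * (s * (s + 2)) powr \<alpha>)"
  define P where "P s = exp (- z * s) * (s * (s + 2)) powr (\<alpha> + 1)" for s
  define p where "p s = (2 * \<alpha> + 2) * (?e 1 s + ?e 0 s) - z * (?e 2 s + 2 * ?e 1 s)" for s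
  note I = bessel_integrable[OF z, of 0] bessel_integrable[OF z, of 1] bessel_integrable[OF z, of 2]
  have ip: "set_integrable lborel {0<..} p"
    unfolding p_def using I by (intro set_integral_add set_integral_diff set_integrable_mult_right) auto
  have dP: "(P has_real_derivative p s) (at s)" if "s > 0" for s
  proof -
    have "((\<lambda>s. (s * (s + 2)) powr (\<alpha> + 1)) has_real_derivative
       (\<alpha> + 1) * (s * (s + 2)) powr (\<alpha> + 1 - 1) * (s + 2 + s)) (at s)"
      using that by (intro DERIV_fun_powr[THEN DERIV_cong]) (auto intro!: derivative_eq_intros)
    moreover have "((\<lambda>s. exp (- z * s)) has_real_derivative - z * exp (- z * s)) (at s)"
      by (auto intro!: derivative_eq_intros)
    ultimately have "(P has_real_derivative (- z * exp (- z * s)) * (s * (s + 2)) powr (\<alpha> + 1)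
       + ((\<alpha> + 1) * (s * (s + 2)) powr (\<alpha> + 1 - 1) * (s + 2 + s)) * exp (- z * s)) (at s)"
      unfolding P_def[abs_def] by (intro DERIV_mult)
    moreover have "(s * (s + 2)) powr (\<alpha> + 1) = (s * (s + 2)) powr \<alpha> * (s * (s + 2))"
      using that by (simp add: powr_add)
    ultimately show ?thesis
      by (simp add: p_def power2_eq_square algebra_simps)
  qed
  have "(LBINT s=0..\<infinity>. p s) = 0 - 0"
  proof (rule interval_integral_FTC_integrable[of 0 \<infinity> P])
    show "(P has_vector_derivative p s) (at s)" if "0 < ereal s" "ereal s < \<infinity>" for s
      using dP[of s] that by (simp add: has_real_derivative_iff_has_vector_derivative)
    show "isCont p s" if "0 < ereal s" "ereal s < \<infinity>" for s
      using that unfolding p_def by (intro continuous_intros) auto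
    show "set_integrable lborel (einterval 0 \<infinity>) p" using ip by (simp add: einterval_def greaterThan_def)
    have "((\<lambda>s. exp (- z * s) * (s * (s + 2)) powr (\<alpha> + 1)) \<longlongrightarrow> exp (- z * 0) * 0) (at_right 0)"
      using \<alpha> by (intro tendsto_mult tendsto_zero_powrI[where b="\<alpha> + 1"])
        (auto intro!: tendsto_eq_intros simp: eventually_at_right_less eventually_at_filter)
    then show "((P \<circ> real_of_ereal) \<longlongrightarrow> 0) (at_right 0)"
      by (simp add: P_def[abs_def] zero_ereal_def ereal_tendsto_simps)
    have "(P \<longlongrightarrow> 0) at_top"
    proof -
      obtain C where C: "C > 0" "\<And>s. s > 0 \<Longrightarrow> s ^ 1 * (s * (s + 2)) powr (\<alpha> + 1) \<le> C * exp (z / 2 * s)"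
      proof -
        obtain C where C: "C > 0" "\<And>s. s > 0 \<Longrightarrow> s ^ 3 * (s * (s + 2)) powr \<alpha> \<le> C * exp (z / 2 * s)"
          using bessel_weight_le[of "z / 2" 3] z by auto
        obtain C' where C': "C' > 0" "\<And>s. s > 0 \<Longrightarrow> s ^ 2 * (s * (s + 2)) powr \<alpha> \<le> C' * exp (z / 2 * s)"
          using bessel_weight_le[of "z / 2" 2] z by auto
        have "s ^ 1 * (s * (s + 2)) powr (\<alpha> + 1) \<le> (C + 2 * C') * exp (z / 2 * s)" if "s > 0" for s
          using C(2)[OF that] C'(2)[OF that] that
          by (simp add: powr_add power3_eq_cube power2_eq_square algebra_simps)
        then show ?thesis using that[of "C + 2 * C'"] C(1) C'(1) by auto
      qed
      show ?thesis
      proof (rule Lim_null_comparison)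
        show "\<forall>\<^sub>F s in at_top. norm (P s) \<le> C * inverse s"
          using eventually_gt_at_top[of 0]
        proof eventually_elim
          case (elim s)
          have "P s * s = exp (- z * s) * (s ^ 1 * (s * (s + 2)) powr (\<alpha> + 1))" by (simp add: P_def)
          also have "\<dots> \<le> exp (- z * s) * (C * exp (z / 2 * s))" using C elim by (intro mult_left_mono) auto
          also have "\<dots> = C * exp (- (z / 2) * s)" by (simp add: exp_add[symmetric] algebra_simps)
          also have "\<dots> \<le> C * 1" using C(1) elim z by (intro mult_left_mono) auto
          finally have "P s \<le> C * inverse s" using elim by (simp add: field_simps)
          moreover have "P s \<ge> 0" by (simp add: P_def)
          ultimately show ?case by simp
        qed
        show "((\<lambda>s. C * inverse s) \<longlongrightarrow> 0) at_top"
          by (intro tendsto_mult_right_zero tendsto_inverse_0_at_top filterlim_ident)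
      qed
    qed
    then show "((P \<circ> real_of_ereal) \<longlongrightarrow> 0) (at_left \<infinity>)" by (simp add: ereal_tendsto_simps)
  qed simp
  then have "(LINT s:{0<..}|lborel. p s) = 0"
    by (simp add: interval_lebesgue_integral_def einterval_def greaterThan_def)
  moreover have "(LINT s:{0<..}|lborel. p s) =
     (2 * \<alpha> + 2) * (bessel_J \<alpha> 1 z + bessel_J \<alpha> 0 z) - z * (bessel_J \<alpha> 2 z + 2 * bessel_J \<alpha> 1 z)"
    unfolding p_def bessel_J_def using I
    by (simp only: set_integral_add set_integral_diff set_integrable_mult_right set_integral_mult_right)
  ultimately show ?thesis by simp
qed

text \<open>The decay exp(- z s) is split as 1/4 + 1/2 + 1/4. The first part absorbs (z s)^\<alpha>
  and leaves z^(- \<alpha>); the second absorbs the growth of the remaining factors, uniformly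
  because z \<ge> z0; the third is integrated and gives 4 / z.\<close>

lemma bessel_J_le:
  assumes z0: "z0 > 0"
  obtains C where "C > 0" "\<And>z. z \<ge> z0 \<Longrightarrow> bessel_J \<alpha> m z \<le> C * z powr (- 1 - \<alpha>)"
proof -
  obtain C1 where C1: "C1 > 0" "\<And>x. x \<ge> 0 \<Longrightarrow> (1 + x) powr \<alpha> \<le> C1 * exp (1 / 4 * x)"
    using powr_le_exp[of "1/4"] by auto
  obtain C2 where C2: "C2 > 0" "\<And>x. x \<ge> 0 \<Longrightarrow> (1 + x) powr (real m + \<alpha>) \<le> C2 * exp (z0 / 2 * x)"
    using powr_le_exp[of "z0 / 2"] z0 by auto
  define C where "C = 4 * (C1 * (C2 * exp (z0 / 2)))"
  have "bessel_J \<alpha> m z \<le> C * z powr (- 1 - \<alpha>)" if zz: "z \<ge> z0" for z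
  proof -
    have z: "z > 0" using zz z0 by simp
    let ?K = "z powr (- \<alpha>) * (C1 * (C2 * exp (z0 / 2)))"
    have pw: "exp (- z * s) * (s ^ m * (s * (s + 2)) powr \<alpha>) \<le> ?K * exp (- (z / 4) * s)" if s: "s > 0" for s
    proof -
      have a: "s powr \<alpha> \<le> z powr (- \<alpha>) * (C1 * exp (1 / 4 * (z * s)))"
      proof -
        have "s powr \<alpha> = z powr (- \<alpha>) * (z * s) powr \<alpha>"
          using z s by (simp add: powr_mult powr_minus field_simps)
        also have "\<dots> \<le> z powr (- \<alpha>) * (1 + z * s) powr \<alpha>"
          using z s \<alpha> by (intro mult_left_mono powr_mono2) auto
        also have "\<dots> \<le> z powr (- \<alpha>) * (C1 * exp (1 / 4 * (z * s)))"
          using z s by (intro mult_left_mono C1) auto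
        finally show ?thesis .
      qed
      have "s ^ m * (s + 2) powr \<alpha> \<le> (2 + s) ^ m * (2 + s) powr \<alpha>"
        using s \<alpha> by (intro mult_mono power_mono powr_mono2) auto
      also have "\<dots> = (1 + (1 + s)) powr (real m + \<alpha>)"
      proof -
        have "(2 + s) ^ m = (2 + s) powr real m" using s by (subst powr_realpow) auto
        moreover have "1 + (1 + s) = 2 + s" by simp
        ultimately show ?thesis by (simp only: powr_add)
      qed
      also have "\<dots> \<le> C2 * exp (z0 / 2 * (1 + s))" using s by (intro C2) auto
      also have "\<dots> \<le> C2 * (exp (z0 / 2) * exp (z / 2 * s))"
        using C2(1) zz s by (intro mult_left_mono) (auto simp: exp_add[symmetric] algebra_simps mult_left_mono)
      finally have b: "s ^ m * (s + 2) powr \<alpha> \<le> C2 * (exp (z0 / 2) * exp (z / 2 * s))" .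
      have "exp (- z * s) * (s ^ m * (s * (s + 2)) powr \<alpha>) = exp (- z * s) * (s powr \<alpha> * (s ^ m * (s + 2) powr \<alpha>))"
        using s by (simp add: powr_mult mult_ac)
      also have "\<dots> \<le> exp (- z * s) * ((z powr (- \<alpha>) * (C1 * exp (1 / 4 * (z * s)))) * (C2 * (exp (z0 / 2) * exp (z / 2 * s))))"
        by (intro mult_left_mono mult_mono a b) (use s C1 in auto)
      also have "\<dots> = ?K * (exp (- z * s) * exp (1 / 4 * (z * s)) * exp (z / 2 * s))" by (simp add: mult_ac)
      also have "exp (- z * s) * exp (1 / 4 * (z * s)) * exp (z / 2 * s) = exp (- (z / 4) * s)"
        by (simp add: exp_add[symmetric] algebra_simps)
      finally show ?thesis .
    qed
    have "bessel_J \<alpha> m z \<le> (LINT s:{0<..}|lborel. ?K * exp (- (z / 4) * s))"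
      unfolding bessel_J_def
      using exp_decay_integrable(1)[of "z / 4"] z pw
      by (intro set_integral_mono bessel_integrable set_integrable_mult_right) auto
    also have "\<dots> = ?K * (4 / z)" using exp_decay_integrable(2)[of "z / 4"] z by simp
    also have "\<dots> = C * z powr (- 1 - \<alpha>)"
    proof -
      have "z powr (- 1 - \<alpha>) = z powr (- \<alpha>) / z" using z by (simp add: powr_diff powr_minus field_simps)
      then show ?thesis by (simp add: C_def)
    qed
    finally show ?thesis .
  qed
  moreover have "C > 0" using C1(1) C2(1) by (simp add: C_def)
  ultimately show ?thesis using that by blast
qed

end

text \<open>\<open>x powr \<nu> * y' x\<close> has the positive derivative
  \<open>x powr \<nu> * y x\<close>. Were it positive at one point, it would stay above a positive
  constant, against the exponential decay of \<open>y'\<close>.\<close>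

lemma decaying_deriv_nonpos:
  fixes y y' :: "real \<Rightarrow> real"
  assumes pos: "\<And>z. z > 0 \<Longrightarrow> y z > 0"
    and d: "\<And>z. z > 0 \<Longrightarrow> (y' has_real_derivative y z - \<nu> / z * y' z) (at z)"
    and bd: "\<And>z. z \<ge> 1 \<Longrightarrow> \<bar>y' z\<bar> \<le> C * z powr a * exp (- z)"
    and z: "z > 0"
  shows "y' z \<le> 0"
proof (rule ccontr)
  assume "\<not> y' z \<le> 0"
  define f where "f x = x powr \<nu> * y' x" for x
  have df: "(f has_real_derivative x powr \<nu> * y x) (at x)" if "x > 0" for x
  proof -
    have "((\<lambda>x. x powr \<nu>) has_real_derivative \<nu> * x powr (\<nu> - 1)) (at x)"
      using that by (intro has_real_derivative_powr)
    from DERIV_mult[OF this d[OF that]]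
    have "(f has_real_derivative \<nu> * x powr (\<nu> - 1) * y' x + (y x - \<nu> / x * y' x) * x powr \<nu>) (at x)"
      by (simp add: f_def[abs_def])
    moreover have "x powr (\<nu> - 1) = x powr \<nu> / x" using that by (simp add: powr_diff)
    ultimately show ?thesis by (simp add: algebra_simps)
  qed
  have fz: "f z > 0" using \<open>\<not> y' z \<le> 0\<close> z by (simp add: f_def)
  have mono: "f z \<le> f x" if "x \<ge> z" for x
  proof (rule DERIV_nonneg_imp_nondecreasing[OF that])
    fix t assume "z \<le> t" "t \<le> x"
    then show "\<exists>d. (f has_real_derivative d) (at t) \<and> 0 \<le> d"
      using df[of t] pos[of t] z by (intro exI[of _ "t powr \<nu> * y t"]) auto
  qed
  obtain K where K: "K > 0" "\<And>x. x \<ge> 0 \<Longrightarrow> (1 + x) powr (\<bar>\<nu> + a\<bar>) \<le> K * exp (1 / 2 * x)"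
    using powr_le_exp[of "1/2" "\<bar>\<nu> + a\<bar>"] by auto
  have C: "C \<ge> 0"
  proof -
    have "0 \<le> C * 1 powr a * exp (- 1)" using bd[of 1] by (meson abs_ge_zero order_refl order_trans)
    then show ?thesis by (simp add: zero_le_mult_iff)
  qed
  have ub: "f x \<le> C * K * exp (- (1 / 2) * x)" if "x \<ge> 1" for x
  proof -
    have "f x \<le> x powr \<nu> * (C * x powr a * exp (- x))"
      unfolding f_def using bd[OF that] by (intro mult_left_mono) auto
    also have "\<dots> = C * (x powr (\<nu> + a) * exp (- x))" by (simp add: powr_add)
    also have "\<dots> \<le> C * ((K * exp (1 / 2 * x)) * exp (- x))"
    proof (intro mult_left_mono mult_right_mono C)
      have "x powr (\<nu> + a) \<le> x powr \<bar>\<nu> + a\<bar>" using that by (intro powr_mono) auto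
      also have "\<dots> \<le> (1 + x) powr \<bar>\<nu> + a\<bar>" using that by (intro powr_mono2) auto
      also have "\<dots> \<le> K * exp (1 / 2 * x)" using that by (intro K) auto
      finally show "x powr (\<nu> + a) \<le> K * exp (1 / 2 * x)" .
    qed auto
    also have "\<dots> = C * K * exp (- (1 / 2) * x)" by (simp add: exp_add[symmetric] mult.assoc)
    finally show ?thesis .
  qed
  have "((\<lambda>x::real. C * K * exp (- (1 / 2) * x)) \<longlongrightarrow> C * K * 0) at_top"
    by (intro tendsto_mult tendsto_const filterlim_compose[OF exp_at_bot]
        filterlim_tendsto_neg_mult_at_bot[OF tendsto_const]) (auto intro: filterlim_ident)
  then have "\<forall>\<^sub>F x in at_top. C * K * exp (- (1 / 2) * x) < f z"
    using fz by (auto dest: order_tendstoD(2))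
  moreover have "\<forall>\<^sub>F x in at_top. x \<ge> max 1 z" by (rule eventually_ge_at_top)
  ultimately have "\<forall>\<^sub>F x in at_top. (False::bool) \<and> x = (x::real)"
  proof eventually_elim
    case (elim x)
    then show ?case using mono[of x] ub[of x] by auto
  qed
  then show False by simp
qed

text \<open>The factor exp(- z) undoes the shift of the integration variable. Then
  \<open>bessel_J_relation\<close> becomes L'' + (2 \<alpha> + 2) / z L' = L, and the power - 1 -
  \<alpha> in the decay is minus half of the coefficient 2 \<alpha> + 2.\<close>

lemma bessel_L:
  assumes \<alpha>: "\<alpha> \<ge> 0"
  defines "L \<equiv> \<lambda>z. exp (- z) * bessel_J \<alpha> 0 z"
    and "L' \<equiv> \<lambda>z. - exp (- z) * (bessel_J \<alpha> 0 z + bessel_J \<alpha> 1 z)"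
  shows "z > 0 \<Longrightarrow> L z > 0"
    and "z > 0 \<Longrightarrow> (L has_real_derivative L' z) (at z)"
    and "z > 0 \<Longrightarrow> (L' has_real_derivative L z - (2 * \<alpha> + 2) / z * L' z) (at z)"
    and "z0 > 0 \<Longrightarrow> \<exists>C>0. \<forall>z\<ge>z0. L z + \<bar>L' z\<bar> \<le> C * z powr (- 1 - \<alpha>) * exp (- z)"
proof -
  note J = bessel_J_pos[OF \<alpha>] and dJ = bessel_J_deriv[OF \<alpha>]
  show "L z > 0" if "z > 0" using J[OF that] by (simp add: L_def)
  have dE: "((\<lambda>z. exp (- z)) has_real_derivative - exp (- z)) (at z)" for z :: real
    by (auto intro!: derivative_eq_intros)
  show "(L has_real_derivative L' z) (at z)" if "z > 0"
    using DERIV_mult[OF dE dJ[OF that, of 0]] unfolding L_def L'_def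
    by (rule DERIV_cong) (simp add: algebra_simps)
  show "(L' has_real_derivative L z - (2 * \<alpha> + 2) / z * L' z) (at z)" if z: "z > 0"
  proof -
    define c where "c = (2 * \<alpha> + 2) / z"
    have r: "bessel_J \<alpha> 2 z + 2 * bessel_J \<alpha> 1 z = c * (bessel_J \<alpha> 1 z + bessel_J \<alpha> 0 z)"
      using bessel_J_relation[OF \<alpha> z] z unfolding c_def by (simp add: field_simps)
    have "(L' has_real_derivative exp (- z) * (bessel_J \<alpha> 0 z + bessel_J \<alpha> 1 z)
       + (- bessel_J \<alpha> (Suc 0) z + - bessel_J \<alpha> (Suc 1) z) * (- exp (- z))) (at z)"
      unfolding L'_def
      using DERIV_mult[OF DERIV_minus[OF dE] DERIV_add[OF dJ[OF z, of 0] dJ[OF z, of 1]]] by simp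
    then show ?thesis
    proof (rule DERIV_cong)
      have "exp (- z) * (bessel_J \<alpha> 0 z + bessel_J \<alpha> 1 z)
       + (- bessel_J \<alpha> (Suc 0) z + - bessel_J \<alpha> (Suc 1) z) * (- exp (- z))
        = exp (- z) * bessel_J \<alpha> 0 z + exp (- z) * (bessel_J \<alpha> 2 z + 2 * bessel_J \<alpha> 1 z)"
        by (simp add: algebra_simps numeral_2_eq_2)
      then show "exp (- z) * (bessel_J \<alpha> 0 z + bessel_J \<alpha> 1 z)
       + (- bessel_J \<alpha> (Suc 0) z + - bessel_J \<alpha> (Suc 1) z) * (- exp (- z)) = L z - (2 * \<alpha> + 2) / z * L' z"
        unfolding r c_def[symmetric] L_def L'_def by (simp add: algebra_simps)
    qed
  qed
  show "\<exists>C>0. \<forall>z\<ge>z0. L z + \<bar>L' z\<bar> \<le> C * z powr (- 1 - \<alpha>) * exp (- z)" if z0: "z0 > 0"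
  proof -
    obtain C0 where C0: "C0 > 0" "\<And>z. z \<ge> z0 \<Longrightarrow> bessel_J \<alpha> 0 z \<le> C0 * z powr (- 1 - \<alpha>)"
      using bessel_J_le[OF \<alpha> z0] by blast
    obtain C1 where C1: "C1 > 0" "\<And>z. z \<ge> z0 \<Longrightarrow> bessel_J \<alpha> 1 z \<le> C1 * z powr (- 1 - \<alpha>)"
      using bessel_J_le[OF \<alpha> z0] by blast
    have "L z + \<bar>L' z\<bar> \<le> (2 * C0 + C1) * z powr (- 1 - \<alpha>) * exp (- z)" if "z \<ge> z0" for z
    proof -
      have z: "z > 0" using that z0 by simp
      have "L z + \<bar>L' z\<bar> = exp (- z) * (2 * bessel_J \<alpha> 0 z + bessel_J \<alpha> 1 z)"
      proof -
        have "L' z = - (exp (- z) * (bessel_J \<alpha> 0 z + bessel_J \<alpha> 1 z))" by (simp add: L'_def)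
        then have "\<bar>L' z\<bar> = exp (- z) * (bessel_J \<alpha> 0 z + bessel_J \<alpha> 1 z)"
          using J[OF z, of 0] J[OF z, of 1] by (simp only: abs_minus abs_of_nonneg add_nonneg_nonneg mult_nonneg_nonneg less_imp_le exp_ge_zero)
        then show ?thesis by (simp add: L_def algebra_simps)
      qed
      also have "\<dots> \<le> exp (- z) * (2 * (C0 * z powr (- 1 - \<alpha>)) + C1 * z powr (- 1 - \<alpha>))"
        using C0(2)[OF that] C1(2)[OF that] by (intro mult_left_mono) auto
      finally show ?thesis by (simp add: algebra_simps)
    qed
    then show ?thesis using C0(1) C1(1) by (intro exI[of _ "2 * C0 + C1"]) auto
  qed
qed

lemma bessel_L_exists:
  assumes "\<alpha> \<ge> 0"
  shows "\<exists>L L'. (\<forall>z>0. L z > 0 \<and> (L has_real_derivative L' z) (at z)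
      \<and> (L' has_real_derivative L z - (2 * \<alpha> + 2) / z * L' z) (at z))
    \<and> (\<forall>z0>0. \<exists>C>0. \<forall>z\<ge>z0. L z + \<bar>L' z\<bar> \<le> C * z powr (- 1 - \<alpha>) * exp (- z))"
  by (rule exI[of _ "\<lambda>z. exp (- z) * bessel_J \<alpha> 0 z"],
      rule exI[of _ "\<lambda>z. - exp (- z) * (bessel_J \<alpha> 0 z + bessel_J \<alpha> 1 z)"])
    (use bessel_L[OF assms] in blast)

text \<open>For \<nu> \<ge> 2 the integral with 2 \<alpha> + 2 = \<nu> is the solution. For \<nu>
  \<le> 0 the substitution y = z^(1 - \<nu>) L exchanges the coefficients \<nu> and 2 - \<nu>. In
  both cases \<alpha> \<ge> 0, as the integral estimates assume, and the rate z^(- \<nu> / 2) exp(-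
  z) comes out the same.\<close>

lemma decaying_solution:
  fixes \<nu> :: real
  assumes \<nu>: "\<nu> \<le> 0 \<or> \<nu> \<ge> 2"
  obtains y y' :: "real \<Rightarrow> real" where
    "\<And>z. z > 0 \<Longrightarrow> y z > 0"
    "\<And>z. z > 0 \<Longrightarrow> (y has_real_derivative y' z) (at z)"
    "\<And>z. z > 0 \<Longrightarrow> (y' has_real_derivative y z - \<nu> / z * y' z) (at z)"
    "\<And>z. z > 0 \<Longrightarrow> y' z \<le> 0"
    "\<And>z0. z0 > 0 \<Longrightarrow> \<exists>C>0. \<forall>z\<ge>z0. y z + \<bar>y' z\<bar> \<le> C * z powr (- \<nu> / 2) * exp (- z)"
proof -
  have "\<exists>y y'. (\<forall>z>0. y z > 0 \<and> (y has_real_derivative y' z) (at z)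
      \<and> (y' has_real_derivative y z - \<nu> / z * y' z) (at z))
    \<and> (\<forall>z0>0. \<exists>C>0. \<forall>z\<ge>z0. y z + \<bar>y' z\<bar> \<le> C * z powr (- \<nu> / 2) * exp (- z))"
    using \<nu>
  proof
    assume "\<nu> \<ge> 2"
    define \<alpha> where "\<alpha> = \<nu> / 2 - 1"
    have \<alpha>: "\<alpha> \<ge> 0" "2 * \<alpha> + 2 = \<nu>" "- 1 - \<alpha> = - \<nu> / 2" using \<open>\<nu> \<ge> 2\<close> by (auto simp: \<alpha>_def)
    show ?thesis
      using bessel_L_exists[OF \<alpha>(1)] unfolding \<alpha>(2,3) .
  next
    assume "\<nu> \<le> 0"
    define \<alpha> where "\<alpha> = - \<nu> / 2"
    have \<alpha>: "\<alpha> \<ge> 0" "2 * \<alpha> + 2 = 2 - \<nu>" "- 1 - \<alpha> = \<nu> / 2 - 1" using \<open>\<nu> \<le> 0\<close> by (auto simp: \<alpha>_def)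
    obtain L L' :: "real \<Rightarrow> real" where L: "\<And>z. z > 0 \<Longrightarrow> L z > 0"
      "\<And>z. z > 0 \<Longrightarrow> (L has_real_derivative L' z) (at z)"
      "\<And>z. z > 0 \<Longrightarrow> (L' has_real_derivative L z - (2 - \<nu>) / z * L' z) (at z)"
      "\<And>z0. z0 > 0 \<Longrightarrow> \<exists>C>0. \<forall>z\<ge>z0. L z + \<bar>L' z\<bar> \<le> C * z powr (\<nu> / 2 - 1) * exp (- z)"
      using bessel_L_exists[OF \<alpha>(1)] unfolding \<alpha>(2,3) by blast
    define y where "y z = z powr (1 - \<nu>) * L z" for z
    define y' where "y' z = z powr (1 - \<nu>) * L' z + (1 - \<nu>) * z powr (- \<nu>) * L z" for z
    have p: "((\<lambda>z. z powr b) has_real_derivative b * z powr (b - 1)) (at z)" if "z > 0" for z b :: real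
      using that by (intro has_real_derivative_powr)
    have dy: "(y has_real_derivative y' z) (at z)" if z: "z > 0" for z
      using DERIV_mult[OF p[OF z, of "1 - \<nu>"] L(2)[OF z]] unfolding y_def[abs_def] y'_def
      by (rule DERIV_cong) (simp add: algebra_simps)
    have dy': "(y' has_real_derivative y z - \<nu> / z * y' z) (at z)" if z: "z > 0" for z
    proof -
      have "(y' has_real_derivative ((1 - \<nu>) * z powr (1 - \<nu> - 1) * L' z + (L z - (2 - \<nu>) / z * L' z) * z powr (1 - \<nu>))
         + ((1 - \<nu>) * (- \<nu> * z powr (- \<nu> - 1)) * L z + L' z * ((1 - \<nu>) * z powr (- \<nu>)))) (at z)"
        unfolding y'_def[abs_def]
        by (intro DERIV_add DERIV_mult p z L(2,3) DERIV_cmult)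
      then show ?thesis
      proof (rule DERIV_cong)
        have e: "z powr (1 - \<nu>) = z powr (- \<nu>) * z" "z powr (- \<nu> - 1) = z powr (- \<nu>) / z"
          "z powr (1 - \<nu> - 1) = z powr (- \<nu>)"
          using z powr_add[of z 1 "- \<nu>"] by (simp_all add: powr_diff)
        show "((1 - \<nu>) * z powr (1 - \<nu> - 1) * L' z + (L z - (2 - \<nu>) / z * L' z) * z powr (1 - \<nu>))
         + ((1 - \<nu>) * (- \<nu> * z powr (- \<nu> - 1)) * L z + L' z * ((1 - \<nu>) * z powr (- \<nu>))) = y z - \<nu> / z * y' z"
          unfolding y_def y'_def e using z by (simp add: field_simps)
      qed
    qed
    have bd: "\<exists>C>0. \<forall>z\<ge>z0. y z + \<bar>y' z\<bar> \<le> C * z powr (- \<nu> / 2) * exp (- z)" if z0: "z0 > 0" for z0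
    proof -
      obtain C where C: "C > 0" "\<And>z. z \<ge> z0 \<Longrightarrow> L z + \<bar>L' z\<bar> \<le> C * z powr (\<nu> / 2 - 1) * exp (- z)"
        using L(4)[OF z0] by blast
      have "y z + \<bar>y' z\<bar> \<le> ((1 + (1 - \<nu>) / z0) * C) * z powr (- \<nu> / 2) * exp (- z)" if zz: "z \<ge> z0" for z
      proof -
        have z: "z > 0" using zz z0 by simp
        have Lp: "L z > 0" using L(1)[OF z] .
        have e: "z powr (- \<nu>) = z powr (1 - \<nu>) / z" using z powr_add[of z 1 "- \<nu>"] by simp
        have "\<bar>y' z\<bar> \<le> z powr (1 - \<nu>) * \<bar>L' z\<bar> + (1 - \<nu>) * z powr (- \<nu>) * L z"
          unfolding y'_def using Lp \<open>\<nu> \<le> 0\<close> by (intro order_trans[OF abs_triangle_ineq]) (simp add: abs_mult)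
        also have "(1 - \<nu>) * z powr (- \<nu>) * L z \<le> z powr (1 - \<nu>) * ((1 - \<nu>) / z0 * L z)"
        proof -
          have "(1 - \<nu>) / z \<le> (1 - \<nu>) / z0" using zz z0 \<open>\<nu> \<le> 0\<close> by (intro divide_left_mono) auto
          then have "z powr (1 - \<nu>) * ((1 - \<nu>) / z * L z) \<le> z powr (1 - \<nu>) * ((1 - \<nu>) / z0 * L z)"
            using Lp by (intro mult_left_mono mult_right_mono) auto
          then show ?thesis unfolding e by (simp add: mult_ac)
        qed
        finally have "y z + \<bar>y' z\<bar> \<le> z powr (1 - \<nu>) * ((1 + (1 - \<nu>) / z0) * L z + \<bar>L' z\<bar>)"
          unfolding y_def by (simp add: algebra_simps)
        also have "\<dots> \<le> z powr (1 - \<nu>) * ((1 + (1 - \<nu>) / z0) * L z + (1 + (1 - \<nu>) / z0) * \<bar>L' z\<bar>)"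
        proof -
          have "1 * \<bar>L' z\<bar> \<le> (1 + (1 - \<nu>) / z0) * \<bar>L' z\<bar>"
            using z0 \<open>\<nu> \<le> 0\<close> by (intro mult_right_mono) auto
          then show ?thesis by (intro mult_left_mono) auto
        qed
        also have "\<dots> = (1 + (1 - \<nu>) / z0) * (z powr (1 - \<nu>) * (L z + \<bar>L' z\<bar>))" by (simp add: algebra_simps)
        also have "\<dots> \<le> (1 + (1 - \<nu>) / z0) * (z powr (1 - \<nu>) * (C * z powr (\<nu> / 2 - 1) * exp (- z)))"
          using C(2)[OF zz] z0 \<open>\<nu> \<le> 0\<close> by (intro mult_left_mono) auto
        also have "\<dots> = ((1 + (1 - \<nu>) / z0) * C) * (z powr (1 - \<nu>) * z powr (\<nu> / 2 - 1)) * exp (- z)" by (simp add: mult_ac)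
        also have "z powr (1 - \<nu>) * z powr (\<nu> / 2 - 1) = z powr (- \<nu> / 2)"
          by (simp add: powr_add[symmetric])
        finally show ?thesis .
      qed
      moreover have "(1 + (1 - \<nu>) / z0) * C > 0" using C(1) z0 \<open>\<nu> \<le> 0\<close> by (intro mult_pos_pos add_pos_nonneg) auto
      ultimately show ?thesis by blast
    qed
    have "y z > 0" if "z > 0" for z using L(1)[OF that] that by (simp add: y_def)
    then show ?thesis using dy dy' bd by blast
  qed
  then obtain y y' where y: "\<And>z. z > 0 \<Longrightarrow> y z > 0"
    "\<And>z. z > 0 \<Longrightarrow> (y has_real_derivative y' z) (at z)"
    "\<And>z. z > 0 \<Longrightarrow> (y' has_real_derivative y z - \<nu> / z * y' z) (at z)"
    "\<And>z0. z0 > 0 \<Longrightarrow> \<exists>C>0. \<forall>z\<ge>z0. y z + \<bar>y' z\<bar> \<le> C * z powr (- \<nu> / 2) * exp (- z)" by blast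
  obtain C where C: "\<And>z. z \<ge> 1 \<Longrightarrow> y z + \<bar>y' z\<bar> \<le> C * z powr (- \<nu> / 2) * exp (- z)"
    using y(4)[of 1] by auto
  have "y' z \<le> 0" if "z > 0" for z
  proof (rule decaying_deriv_nonpos[OF y(1,3) _ that])
    show "\<bar>y' z\<bar> \<le> C * z powr (- \<nu> / 2) * exp (- z)" if "z \<ge> 1" for z
      using C[OF that] y(1)[of z] that by simp
  qed auto
  then show ?thesis using that y by blast
qed

section \<open>Integral and summation estimates\<close>

text \<open>Young's inequality for the factors divided by their norms; a vanishing norm is treated
  apart, the product then being zero almost everywhere.\<close>

lemma Holder_inequality:
  fixes f g :: "'a \<Rightarrow> real"
  assumes p: "p > 1"
    and [measurable]: "f \<in> borel_measurable M" "g \<in> borel_measurable M"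
    and fp: "integrable M (\<lambda>x. \<bar>f x\<bar> powr p)"
    and gq: "integrable M (\<lambda>x. \<bar>g x\<bar> powr (p / (p - 1)))"
  shows "integrable M (\<lambda>x. f x * g x)"
    and "(LINT x|M. \<bar>f x * g x\<bar>) \<le> (LINT x|M. \<bar>f x\<bar> powr p) powr (1 / p) *
           (LINT x|M. \<bar>g x\<bar> powr (p / (p - 1))) powr (1 - 1 / p)"
proof -
  define q where "q = p / (p - 1)"
  have q: "q > 0" "1 / p + 1 / q = 1" "1 - 1 / p = 1 / q" using p by (auto simp: q_def field_simps)
  have young: "a * b \<le> a powr p / p + b powr q / q" if "a \<ge> 0" "b \<ge> 0" for a b
    using Youngs_inequality[of p q a b] p q that by (simp add: q_def field_simps)
  have fq: "integrable M (\<lambda>x. \<bar>g x\<bar> powr q)" using gq by (simp add: q_def)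
  show int: "integrable M (\<lambda>x. f x * g x)"
  proof (rule Bochner_Integration.integrable_bound)
    show "integrable M (\<lambda>x. \<bar>f x\<bar> powr p / p + \<bar>g x\<bar> powr q / q)" using fp fq by auto
    have "norm (f x * g x) \<le> norm (\<bar>f x\<bar> powr p / p + \<bar>g x\<bar> powr q / q)" for x
      using young[of "\<bar>f x\<bar>" "\<bar>g x\<bar>"] p q by (simp add: abs_mult)
    then show "AE x in M. norm (f x * g x) \<le> norm (\<bar>f x\<bar> powr p / p + \<bar>g x\<bar> powr q / q)" by simp
  qed simp
  define A where "A = (LINT x|M. \<bar>f x\<bar> powr p)"
  define B where "B = (LINT x|M. \<bar>g x\<bar> powr q)"
  have AB: "A \<ge> 0" "B \<ge> 0" by (auto simp: A_def B_def)
  show "(LINT x|M. \<bar>f x * g x\<bar>) \<le> (LINT x|M. \<bar>f x\<bar> powr p) powr (1 / p) *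
           (LINT x|M. \<bar>g x\<bar> powr (p / (p - 1))) powr (1 - 1 / p)"
    unfolding q_def[symmetric] q(3) A_def[symmetric] B_def[symmetric]
  proof (cases "A = 0 \<or> B = 0")
    case True
    then have "AE x in M. f x * g x = 0"
    proof
      assume "A = 0"
      then have "AE x in M. \<bar>f x\<bar> powr p = 0"
        using integral_nonneg_eq_0_iff_AE[OF fp] by (simp add: A_def)
      then show ?thesis by eventually_elim simp
    next
      assume "B = 0"
      then have "AE x in M. \<bar>g x\<bar> powr q = 0"
        using integral_nonneg_eq_0_iff_AE[OF fq] by (simp add: B_def)
      then show ?thesis by eventually_elim simp
    qed
    then have "(LINT x|M. \<bar>f x * g x\<bar>) = (LINT x|M. 0)" by (intro integral_cong_AE) auto
    then show "(LINT x|M. \<bar>f x * g x\<bar>) \<le> A powr (1 / p) * B powr (1 / q)" by simp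
  next
    case False
    then have AB': "A > 0" "B > 0" using AB by auto
    define a where "a = A powr (1 / p)"
    define b where "b = B powr (1 / q)"
    have ab: "a > 0" "b > 0" "a powr p = A" "b powr q = B"
      using AB' p q by (auto simp: a_def b_def powr_powr)
    have pw: "\<bar>f x * g x\<bar> \<le> a * b * (\<bar>f x\<bar> powr p / (A * p) + \<bar>g x\<bar> powr q / (B * q))" for x
    proof -
      have "(\<bar>f x\<bar> / a) * (\<bar>g x\<bar> / b) \<le> (\<bar>f x\<bar> / a) powr p / p + (\<bar>g x\<bar> / b) powr q / q"
        using ab by (intro young) auto
      also have "\<dots> = \<bar>f x\<bar> powr p / (A * p) + \<bar>g x\<bar> powr q / (B * q)"
        using ab by (simp add: powr_divide)
      finally have "a * b * ((\<bar>f x\<bar> / a) * (\<bar>g x\<bar> / b)) \<le> a * b * (\<bar>f x\<bar> powr p / (A * p) + \<bar>g x\<bar> powr q / (B * q))"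
        using ab by (intro mult_left_mono) auto
      then show ?thesis using ab by (simp add: abs_mult)
    qed
    have "(LINT x|M. \<bar>f x * g x\<bar>) \<le> (LINT x|M. a * b * (\<bar>f x\<bar> powr p / (A * p) + \<bar>g x\<bar> powr q / (B * q)))"
      using int fp fq pw by (intro integral_mono) auto
    also have "\<dots> = a * b * (A / (A * p) + B / (B * q))"
      using fp fq by (simp add: A_def B_def)
    also have "\<dots> = a * b * (1 / p + 1 / q)" using AB' by simp
    finally show "(LINT x|M. \<bar>f x * g x\<bar>) \<le> A powr (1 / p) * B powr (1 / q)"
      unfolding q(2) a_def b_def by simp
  qed
qed

section \<open>Volumes of shells, dyadic sums and the final differential inequality\<close>

lemma power_diff_le:
  fixes a b :: real
  assumes "0 \<le> a" "a \<le> b"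
  shows "b ^ Suc n - a ^ Suc n \<le> real (Suc n) * b ^ n * (b - a)"
proof (induction n)
  case (Suc n)
  have "b ^ Suc (Suc n) - a ^ Suc (Suc n) = b * (b ^ Suc n - a ^ Suc n) + a ^ Suc n * (b - a)"
    by (simp add: algebra_simps)
  also have "\<dots> \<le> b * (real (Suc n) * b ^ n * (b - a)) + b ^ Suc n * (b - a)"
    using assms by (intro add_mono mult_left_mono Suc mult_right_mono power_mono) auto
  also have "\<dots> = real (Suc (Suc n)) * b ^ Suc n * (b - a)" by (simp add: algebra_simps)
  finally show ?case .
qed simp

text \<open>The ball is cut into shells of width 1 parallel to its boundary. In shell j the distance
  to the boundary is at least j, so the decreasing h is at most \<open>h (1 + real j)\<close>, and
  the volume is at most that of a unit layer at radius \<rho>. The 1 added to the distance keeps the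
  argument in the range where h is controlled.\<close>

lemma ball_integral_le:
  fixes h :: "real \<Rightarrow> real" and \<rho> :: real
  assumes [measurable]: "h \<in> borel_measurable borel"
    and dec: "\<And>v w. 1 \<le> v \<Longrightarrow> v \<le> w \<Longrightarrow> h w \<le> h v"
    and nonneg: "\<And>w. w \<ge> 1 \<Longrightarrow> h w \<ge> 0" and \<rho>: "\<rho> \<ge> 0"
  defines "N \<equiv> DIM('a::euclidean_space)"
  shows "integrable lborel (\<lambda>x::'a. indicator (cball 0 \<rho>) x * h (\<rho> + 1 - norm x))"
    and "(LINT x|lborel. indicator (cball 0 \<rho>) (x::'a) * h (\<rho> + 1 - norm x))
       \<le> unit_ball_vol N * real N * \<rho> ^ (N - 1) * (\<Sum>j\<le>nat \<lfloor>\<rho>\<rfloor>. h (1 + real j))"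
proof -
  let ?f = "\<lambda>x::'a. indicator (cball 0 \<rho>) x * h (\<rho> + 1 - norm x)"
  define Sh where "Sh j = cball (0::'a) (\<rho> - real j) - cball 0 (\<rho> - real j - 1)" for j
  have meas: "measure lborel (cball (0::'a) r) = unit_ball_vol N * r ^ N" if "r \<ge> 0" for r
    using content_cball[OF that, of "0::'a"] by (simp add: N_def)
  have fmc: "cball (0::'a) r \<in> fmeasurable lborel" for r
    using emeasure_lborel_cball_finite[of "0::'a" r] by (intro fmeasurableI) (auto simp: less_top)
  have shf: "Sh j \<in> fmeasurable lborel" for j
    unfolding Sh_def by (intro fmeasurable_Diff) (simp_all add: fmc)
  have shi: "integrable lborel (\<lambda>x. h (1 + real j) * indicator (Sh j) x)" for j
    using shf[of j] by (intro integrable_mult_right) (simp add: fmeasurable_def)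
  have N: "N = Suc (N - 1)" by (simp add: N_def)
  have shm: "measure lborel (Sh j) \<le> unit_ball_vol N * real N * \<rho> ^ (N - 1)" if j: "j \<le> nat \<lfloor>\<rho>\<rfloor>" for j
  proof -
    have jr: "real j \<le> \<rho>" using j \<rho> by linarith
    \<comment> \<open>The innermost shell may be a full ball, whose inner radius would come out
      negative.\<close>
    define a where "a = max 0 (\<rho> - real j - 1)"
    define b where "b = \<rho> - real j"
    have ab: "0 \<le> a" "a \<le> b" "b - a \<le> 1" "b \<le> \<rho>" using jr by (auto simp: a_def b_def)
    have "measure lborel (Sh j) = measure lborel (cball (0::'a) b) - measure lborel (cball (0::'a) (\<rho> - real j - 1))"
      unfolding Sh_def b_def by (intro measure_Diff) (use emeasure_lborel_cball_finite[of "0::'a"] in \<open>auto simp: less_top\<close>)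
    also have "measure lborel (cball (0::'a) (\<rho> - real j - 1)) = unit_ball_vol N * a ^ N"
    proof (cases "\<rho> - real j - 1 \<ge> 0")
      case True
      then show ?thesis by (simp add: meas a_def)
    next
      case False
      then show ?thesis by (simp add: a_def N_def)
    qed
    also have "measure lborel (cball (0::'a) b) - unit_ball_vol N * a ^ N = unit_ball_vol N * (b ^ N - a ^ N)"
      using ab by (simp add: meas algebra_simps)
    also have "\<dots> \<le> unit_ball_vol N * (real N * b ^ (N - 1) * (b - a))"
      using power_diff_le[OF ab(1,2), of "N - 1"] N by (intro mult_left_mono) auto
    also have "\<dots> \<le> unit_ball_vol N * (real N * \<rho> ^ (N - 1) * 1)"
      using ab by (intro mult_left_mono mult_mono power_mono) auto
    finally show ?thesis by simp
  qed
  have pw: "0 \<le> ?f x \<and> ?f x \<le> (\<Sum>j\<le>nat \<lfloor>\<rho>\<rfloor>. h (1 + real j) * indicator (Sh j) x)" for x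
  proof (cases "x \<in> cball 0 \<rho>")
    case True
    then have nx: "norm x \<le> \<rho>" by simp
    define j where "j = nat \<lfloor>\<rho> - norm x\<rfloor>"
    have j1: "real j \<le> \<rho> - norm x" "\<rho> - norm x < real j + 1" using nx unfolding j_def by linarith+
    have j2: "j \<le> nat \<lfloor>\<rho>\<rfloor>" unfolding j_def by (intro nat_mono floor_mono) auto
    have xs: "x \<in> Sh j" using j1 by (auto simp: Sh_def)
    have "?f x = h (\<rho> + 1 - norm x)" using True by simp
    also have "\<dots> \<le> h (1 + real j) * indicator (Sh j) x" using j1 xs by (auto intro!: dec)
    also have "\<dots> \<le> (\<Sum>j\<le>nat \<lfloor>\<rho>\<rfloor>. h (1 + real j) * indicator (Sh j) x)"
      using j2 nonneg by (intro member_le_sum) auto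
    finally show ?thesis using True nx nonneg by auto
  next
    case False
    then show ?thesis using nonneg by (auto intro!: sum_nonneg)
  qed
  have i2: "integrable lborel (\<lambda>x. \<Sum>j\<le>nat \<lfloor>\<rho>\<rfloor>. h (1 + real j) * indicator (Sh j) x)"
    by (intro Bochner_Integration.integrable_sum shi)
  show i1: "integrable lborel ?f"
  proof (rule Bochner_Integration.integrable_bound[OF i2])
    show "AE x in lborel. norm (?f x) \<le> norm (\<Sum>j\<le>nat \<lfloor>\<rho>\<rfloor>. h (1 + real j) * indicator (Sh j) x)"
    proof (intro AE_I2)
      fix x show "norm (?f x) \<le> norm (\<Sum>j\<le>nat \<lfloor>\<rho>\<rfloor>. h (1 + real j) * indicator (Sh j) x)"
        using pw[of x] by (simp only: real_norm_def) linarith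
    qed
  next
    have "(\<lambda>x::'a. h (\<rho> + 1 - norm x)) \<in> borel_measurable borel"
      by (rule measurable_compose[OF _ assms(1)]) measurable
    moreover have "(indicator (cball 0 \<rho>) :: 'a \<Rightarrow> real) \<in> borel_measurable borel"
      by (intro borel_measurable_indicator borel_closed closed_cball)
    ultimately show "?f \<in> borel_measurable lborel" by (simp add: borel_measurable_times)
  qed
  have "(LINT x|lborel. ?f x) \<le> (LINT x|lborel. (\<Sum>j\<le>nat \<lfloor>\<rho>\<rfloor>. h (1 + real j) * indicator (Sh j) x))"
    by (intro integral_mono i1 i2) (use pw in blast)
  also have "\<dots> = (\<Sum>j\<le>nat \<lfloor>\<rho>\<rfloor>. h (1 + real j) * measure lborel (Sh j))"
    by (subst Bochner_Integration.integral_sum[OF shi]) simp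
  also have "\<dots> \<le> (\<Sum>j\<le>nat \<lfloor>\<rho>\<rfloor>. h (1 + real j) * (unit_ball_vol N * real N * \<rho> ^ (N - 1)))"
    by (intro sum_mono mult_left_mono shm nonneg) auto
  finally show "(LINT x|lborel. ?f x) \<le> unit_ball_vol N * real N * \<rho> ^ (N - 1) * (\<Sum>j\<le>nat \<lfloor>\<rho>\<rfloor>. h (1 + real j))"
    by (simp add: sum_distrib_left sum_distrib_right mult_ac)
qed

text \<open>The summand is dominated by \<open>g x - g (x / 2)\<close> for \<open>g x = x powr q / (1 + x powr q)\<close>, so the sum telescopes.\<close>

lemma dyadic_sum_le:
  fixes q :: real
  assumes q: "q > 0"
  obtains C where "C > 0"
    "\<And>w N. w > 0 \<Longrightarrow> (\<Sum>j\<le>N. ((1/2) ^ j) powr q * exp (- ((1/2) ^ j * w / 2))) \<le> C * w powr (- q)"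
proof -
  define c :: real where "c = (1/2) powr q"
  have c: "0 < c" "c < 1" using q powr_less_mono2[of q "1/2" 1] by (auto simp: c_def)
  define g :: "real \<Rightarrow> real" where "g x = x powr q / (1 + x powr q)" for x
  obtain K where K: "K > 0" "\<And>x. x \<ge> 0 \<Longrightarrow> (1 + x) powr (2 * q) \<le> K * exp (1 / 2 * x)"
    using powr_le_exp[of "1/2" "2 * q"] by auto
  have step: "x powr q * exp (- (x / 2)) \<le> 4 * K / (1 - c) * (g x - g (x / 2))" if x: "x > 0" for x
  proof -
    define X where "X = x powr q"
    have X: "X > 0" using x by (simp add: X_def)
    have Xh: "(x / 2) powr q = c * X" using x by (simp add: X_def c_def powr_divide powr_one_eq_one)
    have D: "(1 + X) * (1 + c * X) > 0" using X c by (intro mult_pos_pos add_pos_pos) auto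
    \<comment> \<open>The difference is X (1 - c) over a product of polynomial growth; comparing it
      with \<open>X * exp (- (x / 2))\<close> only needs the exponential to beat that
      product.\<close>
    have g: "g x - g (x / 2) = X * (1 - c) / ((1 + X) * (1 + c * X))"
    proof -
      have "1 + X \<noteq> 0" "1 + c * X \<noteq> 0" using X c mult_pos_pos[of c X] by linarith+
      then show ?thesis unfolding g_def Xh X_def[symmetric] by (simp add: field_simps)
    qed
    have "1 + X \<le> 2 * (1 + x) powr q"
    proof -
      have "X \<le> (1 + x) powr q" unfolding X_def using x q by (intro powr_mono2) auto
      moreover have "1 \<le> (1 + x) powr q" using x q by (intro ge_one_powr_ge_zero) auto
      ultimately show ?thesis by simp
    qed
    then have "(1 + X) * (1 + X) \<le> (2 * (1 + x) powr q) * (2 * (1 + x) powr q)" using X by (intro mult_mono) auto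
    also have "\<dots> = 4 * (1 + x) powr (2 * q)" unfolding mult_2[of q] powr_add by simp
    also have "\<dots> \<le> 4 * (K * exp (1 / 2 * x))" using K(2)[of x] x by simp
    finally have XX: "(1 + X) * (1 + X) \<le> 4 * K * exp (x / 2)" by simp
    have "(1 + X) * (1 + c * X) \<le> (1 + X) * (1 + X)"
      using X c by (intro mult_left_mono add_left_mono) (auto simp: mult_le_cancel_right1)
    then have "(1 + X) * (1 + c * X) * exp (- (x / 2)) \<le> (4 * K * exp (x / 2)) * exp (- (x / 2))"
      using XX by (intro mult_right_mono) auto
    then have "(1 + X) * (1 + c * X) * exp (- (x / 2)) \<le> 4 * K" by (simp add: mult.assoc exp_add[symmetric])
    then have "X * ((1 + X) * (1 + c * X) * exp (- (x / 2))) \<le> X * (4 * K)" using X by (intro mult_left_mono) auto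
    then have "X * exp (- (x / 2)) \<le> X * (4 * K) / ((1 + X) * (1 + c * X))"
      using D by (subst pos_le_divide_eq) (auto simp: mult_ac)
    moreover have "4 * K / (1 - c) * (X * (1 - c) / ((1 + X) * (1 + c * X))) = X * (4 * K) / ((1 + X) * (1 + c * X))"
      using c by simp
    ultimately show ?thesis unfolding g X_def[symmetric] by linarith
  qed
  define C where "C = 4 * K / (1 - c)"
  have C: "C > 0" using K(1) c by (simp add: C_def)
  have "(\<Sum>j\<le>N. ((1/2) ^ j) powr q * exp (- ((1/2) ^ j * w / 2))) \<le> C * w powr (- q)" if w: "w > 0" for w N
  proof -
    define G where "G j = g ((1/2) ^ j * w)" for j
    have "(\<Sum>j\<le>N. ((1/2) ^ j) powr q * exp (- ((1/2) ^ j * w / 2)))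
       = w powr (- q) * (\<Sum>j\<le>N. ((1/2) ^ j * w) powr q * exp (- ((1/2) ^ j * w / 2)))"
      unfolding sum_distrib_left
    proof (rule sum.cong[OF refl])
      fix j
      have "w powr (- q) * ((1/2) ^ j * w) powr q = ((1/2) ^ j) powr q"
        using w by (simp add: powr_mult powr_minus)
      then show "((1/2) ^ j) powr q * exp (- ((1/2) ^ j * w / 2)) =
        w powr (- q) * (((1/2) ^ j * w) powr q * exp (- ((1/2) ^ j * w / 2)))"
        by (simp only: mult.assoc[symmetric])
    qed
    also have "\<dots> \<le> w powr (- q) * (\<Sum>j\<le>N. C * (G j - G (Suc j)))"
    proof (intro mult_left_mono sum_mono)
      fix j
      show "((1/2) ^ j * w) powr q * exp (- ((1/2) ^ j * w / 2)) \<le> C * (G j - G (Suc j))"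
        using step[of "(1/2) ^ j * w"] w by (simp add: C_def G_def mult_ac)
    qed simp
    also have "(\<Sum>j\<le>N. C * (G j - G (Suc j))) = C * (G 0 - G (Suc N))"
      unfolding sum_distrib_left[symmetric] by (simp add: sum_telescope)
    also have "w powr (- q) * (C * (G 0 - G (Suc N))) \<le> w powr (- q) * (C * 1)"
    proof (intro mult_left_mono)
      have "G 0 \<le> 1" by (simp add: G_def g_def divide_le_eq_1 add_pos_nonneg)
      moreover have "G (Suc N) \<ge> 0" by (simp add: G_def g_def)
      ultimately show "G 0 - G (Suc N) \<le> 1" by simp
    qed (use C in auto)
    finally show ?thesis by (simp add: mult.commute)
  qed
  then show ?thesis using that[OF C] by blast
qed

text \<open>The first inequality makes X of size at least \<epsilon>^p K, up to a constant, at H = K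
  / 2. The second makes X^(1 - p) drop between H and K by at least a multiple of K K^(1 - p). Since
  X^(1 - p) at H is at most a multiple of (\<epsilon>^p K)^(1 - p), the factors K^(1 - p) cancel and
  K \<le> C \<epsilon>^(p (1 - p)) is left.\<close>

lemma lifespan_ode_bound:
  fixes X D :: "real \<Rightarrow> real"
  assumes p: "p > 1" and c: "c > 0" and \<epsilon>: "0 < \<epsilon>" "\<epsilon> \<le> 1"
    and X: "\<And>x. x \<in> {1..K} \<Longrightarrow> (X has_real_derivative D x) (at x)" "\<And>x. x \<in> {1..K} \<Longrightarrow> X x \<ge> 0"
    and D1: "\<And>x. x \<in> {1..K} \<Longrightarrow> D x \<ge> c * \<epsilon> powr p"
    and D2: "\<And>x. x \<in> {1..K} \<Longrightarrow> D x \<ge> c * x powr (1 - p) * X x powr p"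
  shows "K \<le> max 4 (2 / ((p - 1) * c) * (c / 4) powr (1 - p)) * \<epsilon> powr (- (p * (p - 1)))"
proof (cases "K \<le> 4")
  case True
  have "1 \<le> \<epsilon> powr (- (p * (p - 1)))"
  proof -
    have "\<epsilon> powr (p * (p - 1)) \<le> 1" using p \<epsilon> by (intro powr_le1) auto
    then show ?thesis unfolding powr_minus using \<epsilon> by (simp add: one_le_inverse)
  qed
  then have "4 * 1 \<le> max 4 (2 / ((p - 1) * c) * (c / 4) powr (1 - p)) * \<epsilon> powr (- (p * (p - 1)))"
    by (intro mult_mono) auto
  then show ?thesis using True by simp
next
  case False
  \<comment> \<open>Here K > 4 gives H > 2, hence \<open>H - 1 \<ge> H / 2\<close>. The range up to
    4 is covered by the 4 in the maximum, because \<open>\<epsilon> \<le> 1\<close>.\<close>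
  define H where "H = K / 2"
  have H: "2 < H" "H < K" "1 \<le> H" using False by (auto simp: H_def)
  have ep: "\<epsilon> powr p > 0" using \<epsilon> by simp
  have XH: "X H \<ge> c / 4 * \<epsilon> powr p * K"
  proof -
    obtain z where z: "z > 1" "z < H" "X H - X 1 = (H - 1) * D z"
      using MVT2[of 1 H X D] X(1) H by (auto simp: less_imp_le)
    have "(H - 1) * (c * \<epsilon> powr p) \<le> (H - 1) * D z" using z H by (intro mult_left_mono D1) auto
    moreover have "(H / 2) * (c * \<epsilon> powr p) \<le> (H - 1) * (c * \<epsilon> powr p)"
      using H c ep by (intro mult_right_mono) auto
    moreover have "X 1 \<ge> 0" using X(2)[of 1] H by simp
    ultimately show ?thesis using z by (simp add: H_def algebra_simps)
  qed
  have cK: "c / 4 * \<epsilon> powr p * K > 0" using c ep H by (intro mult_pos_pos) auto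
  have Xpos: "X x > 0" if "x \<in> {H..K}" for x
  proof -
    have "X H \<le> X x"
    proof (rule DERIV_nonneg_imp_nondecreasing[where f=X])
      show "H \<le> x" using that by simp
      fix t assume t: "H \<le> t" "t \<le> x"
      then have "t \<in> {1..K}" using that H by auto
      then show "\<exists>y. (X has_real_derivative y) (at t) \<and> 0 \<le> y"
        using X(1)[of t] D1[of t] c ep by (intro exI[of _ "D t"]) (auto intro: order_trans[rotated])
    qed
    then show ?thesis using XH cK by simp
  qed
  define W where "W x = X x powr (1 - p)" for x
  have dW: "(W has_real_derivative (1 - p) * X x powr (1 - p - 1) * D x) (at x)" if "x \<in> {H..K}" for x
    unfolding W_def[abs_def]
    using that H Xpos[OF that] X(1)[of x] by (intro DERIV_fun_powr[THEN DERIV_cong]) auto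
  obtain z where z: "z > H" "z < K" "W K - W H = (K - H) * ((1 - p) * X z powr (1 - p - 1) * D z)"
    using MVT2[of H K W "\<lambda>x. (1 - p) * X x powr (1 - p - 1) * D x"] dW H by auto
  have zz: "z \<in> {1..K}" "z \<in> {H..K}" using z H by auto
  have "X z powr (1 - p - 1) * D z \<ge> c * K powr (1 - p)"
  proof -
    have "c * K powr (1 - p) \<le> c * z powr (1 - p)"
      using c p z H by (intro mult_left_mono powr_mono2') auto
    also have "\<dots> = X z powr (1 - p - 1) * (c * z powr (1 - p) * X z powr p)"
      using Xpos[OF zz(2)] by (simp add: powr_minus field_simps)
    also have "\<dots> \<le> X z powr (1 - p - 1) * D z" using D2[OF zz(1)] by (intro mult_left_mono) auto
    finally show ?thesis .
  qed
  then have "(K - H) * (p - 1) * (c * K powr (1 - p)) \<le> (K - H) * (p - 1) * (X z powr (1 - p - 1) * D z)"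
    using H p by (intro mult_left_mono) auto
  also have "\<dots> = W H - W K" using z(3) by (simp add: algebra_simps)
  also have "\<dots> \<le> W H" by (simp add: W_def)
  also have "\<dots> \<le> (c / 4 * \<epsilon> powr p * K) powr (1 - p)"
    unfolding W_def using XH cK p by (intro powr_mono2') auto
  also have "\<dots> = (c / 4) powr (1 - p) * \<epsilon> powr (p * (1 - p)) * K powr (1 - p)"
    by (simp only: powr_mult powr_powr)
  finally have "(K - H) * (p - 1) * c * K powr (1 - p) \<le> (c / 4) powr (1 - p) * \<epsilon> powr (p * (1 - p)) * K powr (1 - p)"
    by (simp add: mult_ac)
  then have "(K - H) * (p - 1) * c \<le> (c / 4) powr (1 - p) * \<epsilon> powr (p * (1 - p))"
    using H by (subst (asm) mult_le_cancel_right_pos) auto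
  then have "K \<le> 2 / ((p - 1) * c) * (c / 4) powr (1 - p) * \<epsilon> powr (p * (1 - p))"
    using p c by (simp add: H_def field_simps)
  also have "p * (1 - p) = - (p * (p - 1))" by (simp add: algebra_simps)
  also have "2 / ((p - 1) * c) * (c / 4) powr (1 - p) * \<epsilon> powr (- (p * (p - 1))) \<le>
     max 4 (2 / ((p - 1) * c) * (c / 4) powr (1 - p)) * \<epsilon> powr (- (p * (p - 1)))"
    by (intro mult_right_mono) auto
  finally show ?thesis .
qed

section \<open>Testing a scalar second-order equation\<close>

lemma set_integrable_continuous_interval:
  fixes f :: "real \<Rightarrow> real"
  assumes "continuous_on {a..b} f"
  shows "set_integrable lborel {a..b} f" "(LINT x:{a..b}|lborel. f x) = integral {a..b} f"
proof -
  show i: "set_integrable lborel {a..b} f"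
    unfolding set_integrable_def using borel_integrable_compact[OF compact_Icc assms] by simp
  show "(LINT x:{a..b}|lborel. f x) = integral {a..b} f"
    by (rule set_borel_integral_eq_integral(2)[OF i])
qed

lemma set_LINT_FTC:
  fixes f f' :: "real \<Rightarrow> real"
  assumes "a \<le> b" "\<And>x. x \<in> {a..b} \<Longrightarrow> (f has_real_derivative f' x) (at x within {a..b})"
    and "continuous_on {a..b} f'"
  shows "(LINT x:{a..b}|lborel. f' x) = f b - f a"
proof -
  have "(f' has_integral (f b - f a)) {a..b}"
    using assms by (intro fundamental_theorem_of_calculus) (auto simp: has_real_derivative_iff_has_vector_derivative)
  then show ?thesis by (simp add: set_integrable_continuous_interval(2)[OF assms(3)] integral_unique)
qed

text \<open>F is merely integrable, so its primitive need not be differentiable everywhere. The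
  identity comes from Fubini on the triangle a \<le> s \<le> r \<le> b, with \<open>Z s\<close>
  written as minus the integral of \<open>z\<close> from s to b; this is where
  \<open>Z b = 0\<close> enters.\<close>

lemma set_LINT_by_parts:
  fixes F z Z :: "real \<Rightarrow> real"
  assumes ab: "a \<le> b" and F: "set_integrable lborel {a..b} F"
    and dZ: "\<And>x. x \<in> {a..b} \<Longrightarrow> (Z has_real_derivative z x) (at x within {a..b})"
    and cz: "continuous_on {a..b} z" and Zb: "Z b = 0"
  shows "(LINT s:{a..b}|lborel. F s * Z s) = - (LINT r:{a..b}|lborel. (LINT s:{a..r}|lborel. F s) * z r)"
proof -
  define Fi where "Fi s = indicator {a..b} s * F s" for s
  define zi where "zi r = indicator {a..b} r * z r" for r
  have Fi: "integrable lborel Fi" using F by (simp add: set_integrable_def Fi_def[abs_def])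
  have zi: "integrable lborel zi"
    using set_integrable_continuous_interval(1)[OF cz] by (simp add: set_integrable_def zi_def[abs_def])
  have [measurable]: "Fi \<in> borel_measurable borel" "zi \<in> borel_measurable borel" using Fi zi by auto
  define G where "G s r = Fi s * (indicator {s..} r * zi r)" for s r
  have Gm: "case_prod G \<in> borel_measurable (lborel \<Otimes>\<^sub>M lborel)"
  proof -
    have "(\<lambda>(s, r). Fi s * ((if s \<le> r then 1 else 0) * zi r)) \<in> borel_measurable (lborel \<Otimes>\<^sub>M lborel)"
      by measurable
    moreover have "(\<lambda>(s, r). Fi s * ((if s \<le> r then 1 else 0) * zi r)) = case_prod G"
      by (auto simp: G_def fun_eq_iff indicator_def)
    ultimately show ?thesis by simp
  qed
  have zis: "integrable lborel (\<lambda>r. indicator {s..} r * zi r)" for s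
    using integrable_mult_indicator[OF _ zi, of "{s..}"] by simp
  have zab: "integrable lborel (\<lambda>r. \<bar>zi r\<bar>)" using zi by simp
  have le: "(LINT r|lborel. norm (G s r)) \<le> \<bar>Fi s\<bar> * (LINT r|lborel. \<bar>zi r\<bar>)" for s
  proof -
    have "(LINT r|lborel. norm (G s r)) = \<bar>Fi s\<bar> * (LINT r|lborel. \<bar>indicator {s..} r * zi r\<bar>)"
      by (simp add: G_def abs_mult)
    also have "\<dots> \<le> \<bar>Fi s\<bar> * (LINT r|lborel. \<bar>zi r\<bar>)"
      by (intro mult_left_mono integral_mono integrable_abs zis zi) (auto simp: indicator_def)
    finally show ?thesis .
  qed
  have Gi: "integrable (lborel \<Otimes>\<^sub>M lborel) (case_prod G)"
  proof (rule lborel_pair.Fubini_integrable[OF Gm])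
    show "integrable lborel (\<lambda>s. LINT r|lborel. norm (case_prod G (s, r)))"
    proof (rule Bochner_Integration.integrable_bound)
      show "integrable lborel (\<lambda>s. \<bar>Fi s\<bar> * (LINT r|lborel. \<bar>zi r\<bar>))" using Fi by auto
      have "(\<lambda>(s, r). norm (case_prod G (s, r))) \<in> borel_measurable (lborel \<Otimes>\<^sub>M lborel)" using Gm by simp
      then show "(\<lambda>s. LINT r|lborel. norm (case_prod G (s, r))) \<in> borel_measurable lborel"
        by (intro lborel.borel_measurable_lebesgue_integral) simp
      have "norm (LINT r|lborel. norm (case_prod G (s, r))) \<le> norm (\<bar>Fi s\<bar> * (LINT r|lborel. \<bar>zi r\<bar>))" for s
        using le[of s] by simp
      then show "AE s in lborel. norm (LINT r|lborel. norm (case_prod G (s, r))) \<le> norm (\<bar>Fi s\<bar> * (LINT r|lborel. \<bar>zi r\<bar>))"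
        by simp
    qed
    show "AE s in lborel. integrable lborel (\<lambda>r. case_prod G (s, r))"
      using zis by (simp add: G_def)
  qed
  have "(LINT r|lborel. LINT s|lborel. G s r) = (LINT s|lborel. LINT r|lborel. G s r)"
    by (rule lborel_pair.Fubini_integral[OF Gi])
  moreover have "(LINT s|lborel. LINT r|lborel. G s r) = - (LINT s:{a..b}|lborel. F s * Z s)"
  proof -
    have "(LINT r|lborel. G s r) = - (indicator {a..b} s * (F s * Z s))" for s
    proof (cases "s \<in> {a..b}")
      case True
      have "(LINT r|lborel. G s r) = Fi s * (LINT r:{s..b}|lborel. z r)"
        unfolding G_def set_lebesgue_integral_def
        by (subst integral_mult_right_zero, rule arg_cong2[where f="(*)"], simp,
            rule Bochner_Integration.integral_cong) (use True in \<open>auto simp: zi_def indicator_def\<close>)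
      also have "(LINT r:{s..b}|lborel. z r) = Z b - Z s"
        using True by (intro set_LINT_FTC continuous_on_subset[OF cz] DERIV_subset[OF dZ]) auto
      finally show ?thesis using True Zb by (simp add: Fi_def)
    qed (simp add: G_def Fi_def)
    then show ?thesis by (simp add: set_lebesgue_integral_def)
  qed
  moreover have "(LINT r|lborel. LINT s|lborel. G s r) = (LINT r:{a..b}|lborel. (LINT s:{a..r}|lborel. F s) * z r)"
    unfolding set_lebesgue_integral_def[of _ "{a..b}"]
  proof (rule Bochner_Integration.integral_cong[OF refl])
    fix r
    show "(LINT s|lborel. G s r) = indicator {a..b} r *\<^sub>R ((LINT s:{a..r}|lborel. F s) * z r)"
    proof (cases "r \<in> {a..b}")
      case True
      have "(LINT s|lborel. G s r) = (LINT s|lborel. (indicator {a..r} s *\<^sub>R F s) * z r)"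
        by (rule Bochner_Integration.integral_cong) (use True in \<open>auto simp: G_def Fi_def zi_def indicator_def\<close>)
      then show ?thesis using True by (simp add: set_lebesgue_integral_def)
    qed (simp add: G_def zi_def)
  qed
  ultimately show ?thesis by simp
qed

lemma integral_has_real_derivative_within:
  fixes g :: "real \<Rightarrow> real"
  assumes "continuous_on {a..b} g" "t \<in> {a..b}"
  shows "((\<lambda>x. integral {a..x} g) has_real_derivative g t) (at t within {a..b})"
  using integral_has_real_derivative[OF assms] .

text \<open>The weak form of \<open>U'' + \<mu>/t U' = c U + F\<close>, integrated once in time, tested with \<open>\<zeta>\<close>. The function
  \<open>\<zeta>1 = \<zeta>' - \<mu>/t \<zeta>\<close> is the flux of the adjoint equation, and \<open>r\<close> its residual.\<close>

lemma weak_ode_tested: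
  fixes U V F c \<zeta> \<zeta>1 r :: "real \<Rightarrow> real"
  assumes b: "1 \<le> b"
    and dU: "\<And>t. t \<in> {1..b} \<Longrightarrow> (U has_real_derivative V t) (at t within {1..b})"
    and cV: "continuous_on {1..b} V" and cc: "continuous_on {1..b} c"
    and F: "set_integrable lborel {1..b} F"
    and V: "\<And>t. t \<in> {1..b} \<Longrightarrow>
      V t = V0 + (LINT s:{1..t}|lborel. c s * U s - \<mu> / s * V s) + (LINT s:{1..t}|lborel. F s)"
    and d\<zeta>: "\<And>t. t \<in> {1..b} \<Longrightarrow> (\<zeta> has_real_derivative \<zeta>1 t + \<mu> / t * \<zeta> t) (at t within {1..b})"
    and d\<zeta>1: "\<And>t. t \<in> {1..b} \<Longrightarrow> (\<zeta>1 has_real_derivative c t * \<zeta> t + r t) (at t within {1..b})"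
    and cr: "continuous_on {1..b} r" and end0: "\<zeta> b = 0" "\<zeta>1 b = 0"
  shows "(LINT s:{1..b}|lborel. F s * \<zeta> s) + V0 * \<zeta> 1 - U 1 * \<zeta>1 1 = (LINT s:{1..b}|lborel. U s * r s)"
proof -
  have cU: "continuous_on {1..b} U" and c\<zeta>: "continuous_on {1..b} \<zeta>" and c\<zeta>1: "continuous_on {1..b} \<zeta>1"
    using dU d\<zeta> d\<zeta>1 by (meson DERIV_continuous continuous_on_eq_continuous_within)+
  have cinv: "continuous_on {1..b} (\<lambda>t. \<mu> / t)" by (intro continuous_intros) auto
  define g where "g s = c s * U s - \<mu> / s * V s" for s
  have cg: "continuous_on {1..b} g" unfolding g_def by (intro continuous_intros cc cU cV cinv) auto
  define I where "I t = integral {1..t} g" for t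
  define Fc where "Fc t = (LINT s:{1..t}|lborel. F s)" for t
  have dI: "(I has_real_derivative g t) (at t within {1..b})" if "t \<in> {1..b}" for t
    unfolding I_def[abs_def] by (rule integral_has_real_derivative_within[OF cg that])
  have cI: "continuous_on {1..b} I"
    using dI by (meson DERIV_continuous continuous_on_eq_continuous_within)
  have Veq: "V t = V0 + I t + Fc t" if t: "t \<in> {1..b}" for t
  proof -
    have "(LINT s:{1..t}|lborel. g s) = I t"
      unfolding I_def using t by (intro set_integrable_continuous_interval(2) continuous_on_subset[OF cg]) auto
    then show ?thesis using V[OF t] by (simp add: g_def Fc_def)
  qed
  define z where "z t = \<zeta>1 t + \<mu> / t * \<zeta> t" for t
  have cz: "continuous_on {1..b} z" unfolding z_def by (intro continuous_intros c\<zeta> c\<zeta>1 cinv) auto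
  \<comment> \<open>Continuity of the primitive of \<open>F\<close> is read off from the equation,
    all of whose other terms are continuous.\<close>
  have cFc: "continuous_on {1..b} Fc"
  proof (rule continuous_on_eq)
    show "continuous_on {1..b} (\<lambda>t. V t - V0 - I t)" by (intro continuous_intros cV cI)
  qed (use Veq in auto)
  \<comment> \<open>\<open>V\<close> may fail to be differentiable where \<open>F\<close> is rough,
    so only its differentiable part \<open>V0 + I\<close> is paired with \<open>\<zeta>\<close>. The
    missing part reappears as \<open>Fc t * z t\<close> in \<open>h\<close> and is treated by
    parts.\<close>
  define H where "H t = (V0 + I t) * \<zeta> t - U t * \<zeta>1 t" for t
  define h where "h t = (- 1) * (Fc t * z t) - U t * r t" for t
  have "(LINT t:{1..b}|lborel. h t) = H b - H 1"
  proof (rule set_LINT_FTC[OF b])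
    show "continuous_on {1..b} h" unfolding h_def by (intro continuous_intros cFc cz cU cr)
    fix t assume t: "t \<in> {1..b}"
    have "((\<lambda>t. V0 + I t) has_real_derivative 0 + g t) (at t within {1..b})"
      by (intro DERIV_add DERIV_const dI[OF t])
    from DERIV_diff[OF DERIV_mult[OF this d\<zeta>[OF t]] DERIV_mult[OF dU[OF t] d\<zeta>1[OF t]]]
    show "(H has_real_derivative h t) (at t within {1..b})" unfolding H_def[abs_def]
    proof (rule DERIV_cong)
      have Fc: "Fc t = V t - V0 - I t" using Veq[OF t] by simp
      obtain m where m: "\<mu> / t = m" by blast
      show "(0 + g t) * \<zeta> t + (\<zeta>1 t + \<mu> / t * \<zeta> t) * (V0 + I t)
         - (V t * \<zeta>1 t + (c t * \<zeta> t + r t) * U t) = h t"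
        unfolding h_def z_def g_def Fc m by (simp add: algebra_simps)
    qed
  qed
  also have "H b - H 1 = - (V0 * \<zeta> 1 - U 1 * \<zeta>1 1)"
    using end0 by (simp add: H_def I_def)
  also have "(LINT t:{1..b}|lborel. h t) = - (LINT t:{1..b}|lborel. Fc t * z t) - (LINT t:{1..b}|lborel. U t * r t)"
  proof -
    have i: "set_integrable lborel {1..b} (\<lambda>t. (- 1) * (Fc t * z t))" "set_integrable lborel {1..b} (\<lambda>t. U t * r t)"
      by (intro set_integrable_continuous_interval continuous_intros cFc cz cU cr)+
    show ?thesis unfolding h_def by (subst set_integral_diff(2)[OF i]) (subst set_integral_mult_right, simp)
  qed
  finally have "- (LINT t:{1..b}|lborel. Fc t * z t) + V0 * \<zeta> 1 - U 1 * \<zeta>1 1 = (LINT t:{1..b}|lborel. U t * r t)"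
    by simp
  moreover have "(LINT s:{1..b}|lborel. F s * \<zeta> s) = - (LINT t:{1..b}|lborel. Fc t * z t)"
    unfolding Fc_def
    by (rule set_LINT_by_parts[where Z=\<zeta> and z=z, OF b F _ cz end0(1)]) (use d\<zeta> in \<open>simp add: z_def\<close>)
  ultimately show ?thesis by simp
qed

section \<open>The weak formulation\<close>

definition compactly_smooth :: "('a::euclidean_space \<Rightarrow> real) \<Rightarrow> bool" where
  "compactly_smooth g \<longleftrightarrow> (\<forall>m. C_on m UNIV g) \<and> (\<exists>K. compact K \<and> (\<forall>x. x \<notin> K \<longrightarrow> g x = 0))"

definition partial :: "(real ^ 'n \<Rightarrow> real) \<Rightarrow> 'n \<Rightarrow> real ^ 'n \<Rightarrow> real" where
  "partial g i x = frechet_derivative g (at x) (axis i 1)"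

definition laplacian :: "(real ^ 'n \<Rightarrow> real) \<Rightarrow> real ^ 'n \<Rightarrow> real" where
  "laplacian g x = (\<Sum>i\<in>UNIV. partial (partial g i) i x)"

lemma compactly_smooth_continuous: "compactly_smooth g \<Longrightarrow> continuous_on UNIV g"
  using C_on_imp_continuous unfolding compactly_smooth_def by blast

lemma compactly_smooth_partial:
  assumes "compactly_smooth g"
  shows "compactly_smooth (partial g i)"
proof -
  obtain K where K: "compact K" "\<And>x. x \<notin> K \<Longrightarrow> g x = 0" and g: "\<And>m. C_on m UNIV g"
    using assms by (auto simp: compactly_smooth_def)
  have "C_on m UNIV (partial g i)" for m
    using g[of "Suc m"] by (simp add: partial_def[abs_def])
  moreover have "partial g i x = 0" if "x \<notin> K" for x
  proof -
    have "open (- K)" using K(1) by (simp add: compact_imp_closed open_Compl)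
    then have "(g has_derivative (\<lambda>_. 0)) (at x)"
      using has_derivative_transform_within_open[OF has_derivative_const[of 0], of "- K" x g UNIV] K(2) that by simp
    then show ?thesis using frechet_derivative_at by (metis partial_def)
  qed
  ultimately show ?thesis using K(1) by (auto simp: compactly_smooth_def)
qed

lemma compactly_smooth_sum:
  assumes "finite I" "\<And>i. i \<in> I \<Longrightarrow> compactly_smooth (f i)"
  shows "compactly_smooth (\<lambda>x. \<Sum>i\<in>I. f i x)"
proof -
  have "\<forall>i\<in>I. \<exists>K. compact K \<and> (\<forall>x. x \<notin> K \<longrightarrow> f i x = 0)" using assms(2) by (simp add: compactly_smooth_def)
  then obtain K where K: "\<And>i. i \<in> I \<Longrightarrow> compact (K i) \<and> (\<forall>x. x \<notin> K i \<longrightarrow> f i x = 0)" by metis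
  have "compact (\<Union>i\<in>I. K i)" using K assms(1) by (intro compact_UN) auto
  moreover have "(\<Sum>i\<in>I. f i x) = 0" if "x \<notin> (\<Union>i\<in>I. K i)" for x
    using K that by (intro sum.neutral) auto
  moreover have "C_on m UNIV (\<lambda>x. \<Sum>i\<in>I. f i x)" for m
    using assms(2) by (intro C_on_sum) (simp add: compactly_smooth_def)
  ultimately show ?thesis by (auto simp: compactly_smooth_def)
qed

lemma compactly_smooth_laplacian: "compactly_smooth g \<Longrightarrow> compactly_smooth (laplacian g)"
  unfolding laplacian_def[abs_def]
  by (rule compactly_smooth_sum) (auto intro!: compactly_smooth_partial)

lemma compactly_smooth_test_function: "compactly_smooth g \<Longrightarrow> g \<in> test_functions UNIV"
  by (auto simp: compactly_smooth_def test_functions_def smooth_on_def)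

section \<open>Pairing curves in L2 with continuous compactly supported functions\<close>

definition C_c :: "('a::euclidean_space \<Rightarrow> real) \<Rightarrow> bool" where
  "C_c g \<longleftrightarrow> continuous_on UNIV g \<and> (\<exists>K. compact K \<and> (\<forall>x. x \<notin> K \<longrightarrow> g x = 0))"

lemma compactly_smooth_C_c: "compactly_smooth g \<Longrightarrow> C_c g"
  using compactly_smooth_continuous by (auto simp: compactly_smooth_def C_c_def)

lemma C_c_borel: "C_c g \<Longrightarrow> g \<in> borel_measurable borel"
  by (simp add: C_c_def borel_measurable_continuous_onI)

lemma borel_imp_lebesgue_measurable:
  "f \<in> borel_measurable borel \<Longrightarrow> f \<in> borel_measurable lebesgue"
  by (rule measurable_completion) simp

lemma C_c_integrable:
  assumes "C_c g"
  shows "integrable lborel g"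
proof -
  obtain K where K: "compact K" "\<And>x. x \<notin> K \<Longrightarrow> g x = 0" using assms by (auto simp: C_c_def)
  have "integrable lborel (\<lambda>x. indicator K x *\<^sub>R g x)"
    using assms by (intro borel_integrable_compact[OF K(1)]) (auto simp: C_c_def intro: continuous_on_subset)
  moreover have "(\<lambda>x. indicator K x *\<^sub>R g x) = g" using K(2) by (auto simp: fun_eq_iff indicator_def)
  ultimately show ?thesis by simp
qed

lemma in_L2_real: "in_L2 (f :: 'a::euclidean_space \<Rightarrow> real) \<longleftrightarrow>
    f \<in> borel_measurable lebesgue \<and> integrable lebesgue (\<lambda>x. (f x)\<^sup>2)"
  by (simp add: in_L2_def)

lemma L2_norm_real: "L2_norm (f :: 'a::euclidean_space \<Rightarrow> real) = sqrt (LINT x|lebesgue. (f x)\<^sup>2)"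
  by (simp add: L2_norm_def)

lemma L2_C_c:
  fixes f :: "'a::euclidean_space \<Rightarrow> real"
  assumes f: "in_L2 f" and g: "C_c g"
  shows "integrable lebesgue (\<lambda>x. f x * g x)"
    and "\<bar>LINT x|lebesgue. f x * g x\<bar> \<le> L2_norm f * L2_norm g"
proof -
  have [measurable]: "f \<in> borel_measurable lebesgue" "g \<in> borel_measurable lebesgue"
    using f C_c_borel[OF g] by (auto simp: in_L2_real intro: measurable_completion)
  have "C_c (\<lambda>x. (g x)\<^sup>2)" using g unfolding C_c_def by (auto intro!: continuous_intros)
  then have g2: "integrable lebesgue (\<lambda>x. (g x)\<^sup>2)"
    using C_c_integrable C_c_borel by (subst integrable_completion) auto
  have e: "\<bar>y\<bar> powr 2 = y\<^sup>2" for y :: real by (cases "y = 0") auto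
  have i: "integrable lebesgue (\<lambda>x. \<bar>f x\<bar> powr 2)" "integrable lebesgue (\<lambda>x. \<bar>g x\<bar> powr (2 / (2 - 1)))"
    using f g2 by (simp_all add: e in_L2_real)
  show int: "integrable lebesgue (\<lambda>x. f x * g x)"
    by (rule Holder_inequality(1)[of 2]) (use i in auto)
  have "\<bar>LINT x|lebesgue. f x * g x\<bar> \<le> (LINT x|lebesgue. \<bar>f x * g x\<bar>)"
    by (rule integral_abs_bound)
  also have "\<dots> \<le> (LINT x|lebesgue. \<bar>f x\<bar> powr 2) powr (1 / 2) * (LINT x|lebesgue. \<bar>g x\<bar> powr (2 / (2 - 1))) powr (1 - 1 / 2)"
    by (rule Holder_inequality(2)) (use i in auto)
  finally show "\<bar>LINT x|lebesgue. f x * g x\<bar> \<le> L2_norm f * L2_norm g"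
    by (simp add: e L2_norm_real powr_half_sqrt)
qed

lemma in_L2_lincomb:
  fixes f h :: "'a::euclidean_space \<Rightarrow> real"
  assumes "in_L2 f" "in_L2 h"
  shows "in_L2 (\<lambda>x. a * f x + b * h x)"
  unfolding in_L2_real
proof
  have [measurable]: "f \<in> borel_measurable lebesgue" "h \<in> borel_measurable lebesgue"
    using assms by (auto simp: in_L2_real)
  show "(\<lambda>x. a * f x + b * h x) \<in> borel_measurable lebesgue" by measurable
  show "integrable lebesgue (\<lambda>x. (a * f x + b * h x)\<^sup>2)"
  proof (rule Bochner_Integration.integrable_bound)
    show "integrable lebesgue (\<lambda>x. 2 * a\<^sup>2 * (f x)\<^sup>2 + 2 * b\<^sup>2 * (h x)\<^sup>2)"
      using assms by (auto simp: in_L2_real)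
    have "(v + w)\<^sup>2 \<le> 2 * v\<^sup>2 + 2 * w\<^sup>2" for v w :: real
      using sum_squares_bound[of v w] by (simp add: power2_sum)
    from this[of "a * f _" "b * h _"]
    show "AE x in lebesgue. norm ((a * f x + b * h x)\<^sup>2) \<le> norm (2 * a\<^sup>2 * (f x)\<^sup>2 + 2 * b\<^sup>2 * (h x)\<^sup>2)"
      by (auto simp: power_mult_distrib mult.assoc)
  qed simp
qed

lemma C_L2_pairing_continuous:
  assumes u: "C_L2 I u" and g: "C_c g"
  shows "continuous_on I (\<lambda>t. LINT x|lebesgue. u t x * g x)"
proof (unfold continuous_on_def, intro ballI)
  fix t assume t: "t \<in> I"
  let ?U = "\<lambda>t. LINT x|lebesgue. u t x * g x"
  have L2: "in_L2 (u s)" if "s \<in> I" for s using u that by (simp add: C_L2_def)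
  have "((\<lambda>s. ?U s - ?U t) \<longlongrightarrow> 0) (at t within I)"
  proof (rule Lim_null_comparison)
    have "((\<lambda>s. L2_norm (\<lambda>x. u s x - u t x)) \<longlongrightarrow> 0) (at t within I)" using u t by (simp add: C_L2_def)
    then show "((\<lambda>s. L2_norm (\<lambda>x. u s x - u t x) * L2_norm g) \<longlongrightarrow> 0) (at t within I)"
      by (rule tendsto_mult_left_zero)
    have "norm (?U s - ?U t) \<le> L2_norm (\<lambda>x. u s x - u t x) * L2_norm g" if s: "s \<in> I" for s
    proof -
      have "in_L2 (\<lambda>x. u s x - u t x)"
        using in_L2_lincomb[OF L2[OF s] L2[OF t], of 1 "-1"] by simp
      from L2_C_c(2)[OF this g]
      show ?thesis using L2_C_c(1)[OF L2[OF s] g] L2_C_c(1)[OF L2[OF t] g] by (simp add: left_diff_distrib)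
    qed
    then show "\<forall>\<^sub>F s in at t within I. norm (?U s - ?U t) \<le> L2_norm (\<lambda>x. u s x - u t x) * L2_norm g"
      unfolding eventually_at by (intro exI[of _ 1]) auto
  qed
  then show "(?U \<longlongrightarrow> ?U t) (at t within I)" by (simp add: LIM_zero_iff)
qed

lemma C1_L2_pairing_deriv:
  assumes u: "C1_L2 I u v" and g: "C_c g" and t: "t \<in> I"
  shows "((\<lambda>t. LINT x|lebesgue. u t x * g x) has_real_derivative (LINT x|lebesgue. v t x * g x)) (at t within I)"
proof -
  let ?U = "\<lambda>t. LINT x|lebesgue. u t x * g x" and ?V = "LINT x|lebesgue. v t x * g x"
  let ?w = "\<lambda>s x. (u s x - u t x) / (s - t) - v t x"
  have L2: "in_L2 (u s)" "in_L2 (v s)" if "s \<in> I" for s using u that by (simp_all add: C1_L2_def C_L2_def)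
  have "((\<lambda>s. (?U s - ?U t) / (s - t) - ?V) \<longlongrightarrow> 0) (at t within I)"
  proof (rule Lim_null_comparison)
    have "((\<lambda>s. L2_norm (?w s)) \<longlongrightarrow> 0) (at t within I)" using u t by (simp add: C1_L2_def)
    then show "((\<lambda>s. L2_norm (?w s) * L2_norm g) \<longlongrightarrow> 0) (at t within I)"
      by (rule tendsto_mult_left_zero)
    have "norm ((?U s - ?U t) / (s - t) - ?V) \<le> L2_norm (?w s) * L2_norm g" if s: "s \<in> I" for s
    proof -
      have "in_L2 (\<lambda>x. (1 / (s - t)) * (1 * u s x + (-1) * u t x) + (-1) * v t x)"
        by (intro in_L2_lincomb L2 s t)
      then have "in_L2 (?w s)" by simp
      from L2_C_c(2)[OF this g]
      have "\<bar>LINT x|lebesgue. ?w s x * g x\<bar> \<le> L2_norm (?w s) * L2_norm g" .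
      also have "(LINT x|lebesgue. ?w s x * g x) = (LINT x|lebesgue. (u s x * g x - u t x * g x) / (s - t) - v t x * g x)"
        by (intro Bochner_Integration.integral_cong) (auto simp: left_diff_distrib)
      also have "\<dots> = (?U s - ?U t) / (s - t) - ?V"
        using L2_C_c(1)[OF L2(1)[OF s] g] L2_C_c(1)[OF L2(1)[OF t] g] L2_C_c(1)[OF L2(2)[OF t] g] by simp
      finally show ?thesis by simp
    qed
    then show "\<forall>\<^sub>F s in at t within I. norm ((?U s - ?U t) / (s - t) - ?V) \<le> L2_norm (?w s) * L2_norm g"
      unfolding eventually_at by (intro exI[of _ 1]) auto
  qed
  then show ?thesis by (simp add: has_field_derivative_iff LIM_zero_iff)
qed

section \<open>Weak gradients and product test functions\<close>

lemma in_L2_norm: "in_L2 G \<Longrightarrow> in_L2 (\<lambda>x. norm (G x))"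
  by (auto simp: in_L2_def)

text \<open>The defining identity of the weak gradient is applied to each partial derivative of g,
  and its i-th component is taken. Both derivatives land on g, so the gradient term of the equation
  becomes an L2 pairing, continuous in time.\<close>

lemma weak_grad_laplacian:
  fixes f :: "real ^ 'n \<Rightarrow> real"
  assumes f: "in_H1 f" and g: "compactly_smooth g"
  shows "(LINT x|lebesgue. weak_grad f x \<bullet> grad g x) = - (LINT x|lebesgue. f x * laplacian g x)"
proof -
  define G where "G = weak_grad f"
  have G: "in_L2 G" "has_weak_grad f G"
    using someI_ex[of "\<lambda>g. in_L2 g \<and> has_weak_grad f g"] f unfolding G_def weak_grad_def in_H1_def by blast+
  have fL: "in_L2 f" using f by (simp add: in_H1_def)
  have [measurable]: "f \<in> borel_measurable lebesgue" "G \<in> borel_measurable lebesgue"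
    using fL G by (auto simp: in_L2_def)
  let ?p = "partial g"
  have ps: "compactly_smooth (?p i)" "compactly_smooth (partial (?p i) j)" for i j
    using g by (auto intro!: compactly_smooth_partial)
  have i1: "integrable lebesgue (\<lambda>x. ?p i x *\<^sub>R G x)" for i
  proof (rule Bochner_Integration.integrable_bound)
    show "integrable lebesgue (\<lambda>x. norm (G x) * ?p i x)"
      by (rule L2_C_c(1)[OF in_L2_norm[OF G(1)] compactly_smooth_C_c[OF ps(1)]])
    have "?p i \<in> borel_measurable lebesgue"
      using C_c_borel[OF compactly_smooth_C_c[OF ps(1)]] by (rule borel_imp_lebesgue_measurable)
    then show "(\<lambda>x. ?p i x *\<^sub>R G x) \<in> borel_measurable lebesgue" by measurable
  qed (auto simp: abs_mult)
  have gc: "continuous_on UNIV (grad (?p i))" for i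
    unfolding grad_def partial_def[symmetric]
    using compactly_smooth_continuous[OF ps(2)] by (auto intro!: continuous_on_vec_lambda)
  have i2: "integrable lebesgue (\<lambda>x. f x *\<^sub>R grad (?p i) x)" for i
  proof (rule Bochner_Integration.integrable_bound)
    have "\<exists>K. compact K \<and> (\<forall>x. x \<notin> K \<longrightarrow> norm (grad (?p i) x) = 0)"
    proof -
      have "\<forall>j. \<exists>K. compact K \<and> (\<forall>x. x \<notin> K \<longrightarrow> partial (?p i) j x = 0)"
        using ps(2) by (simp add: compactly_smooth_def)
      then obtain K where K: "\<And>j. compact (K j) \<and> (\<forall>x. x \<notin> K j \<longrightarrow> partial (?p i) j x = 0)" by metis
      have "compact (\<Union>j. K j)" using K by (intro compact_UN) auto
      moreover have "norm (grad (?p i) x) = 0" if "x \<notin> (\<Union>j. K j)" for x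
        using K that by (auto simp: grad_def partial_def[symmetric] vec_eq_iff)
      ultimately show ?thesis by blast
    qed
    then have "C_c (\<lambda>x. norm (grad (?p i) x))"
      using gc by (auto simp: C_c_def intro!: continuous_intros)
    from L2_C_c(1)[OF fL this]
    show "integrable lebesgue (\<lambda>x. f x * norm (grad (?p i) x))" .
    have "grad (?p i) \<in> borel_measurable lebesgue"
      using borel_measurable_continuous_onI[OF gc] by (rule borel_imp_lebesgue_measurable)
    then show "(\<lambda>x. f x *\<^sub>R grad (?p i) x) \<in> borel_measurable lebesgue" by measurable
  qed (auto simp: abs_mult)
  have comp: "(LINT x|lebesgue. f x * partial (?p i) i x) = - (LINT x|lebesgue. ?p i x * (G x $ i))" for i
  proof -
    have "(LINT x|lebesgue. f x *\<^sub>R grad (?p i) x) = - (LINT x|lebesgue. ?p i x *\<^sub>R G x)"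
      using G(2) compactly_smooth_test_function[OF ps(1)] by (simp add: has_weak_grad_def)
    then have "(LINT x|lebesgue. f x *\<^sub>R grad (?p i) x) $ i = - ((LINT x|lebesgue. ?p i x *\<^sub>R G x) $ i)" by simp
    moreover have "(LINT x|lebesgue. f x *\<^sub>R grad (?p i) x) $ i = (LINT x|lebesgue. (f x *\<^sub>R grad (?p i) x) $ i)"
      by (rule integral_bounded_linear[OF bounded_linear_vec_nth i2, symmetric])
    moreover have "(LINT x|lebesgue. ?p i x *\<^sub>R G x) $ i = (LINT x|lebesgue. (?p i x *\<^sub>R G x) $ i)"
      by (rule integral_bounded_linear[OF bounded_linear_vec_nth i1, symmetric])
    ultimately show ?thesis by (simp add: grad_def partial_def)
  qed
  have j1: "integrable lebesgue (\<lambda>x. ?p i x * (G x $ i))" for i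
    using integrable_bounded_linear[OF bounded_linear_vec_nth i1[of i], of i] by simp
  have j2: "integrable lebesgue (\<lambda>x. f x * partial (?p i) i x)" for i
    by (rule L2_C_c(1)[OF fL compactly_smooth_C_c[OF ps(2)]])
  have "(LINT x|lebesgue. G x \<bullet> grad g x) = (LINT x|lebesgue. (\<Sum>i\<in>UNIV. ?p i x * (G x $ i)))"
    by (simp add: inner_vec_def grad_def partial_def mult.commute)
  also have "\<dots> = (\<Sum>i\<in>UNIV. LINT x|lebesgue. ?p i x * (G x $ i))"
    using j1 by (intro Bochner_Integration.integral_sum) auto
  also have "\<dots> = - (\<Sum>i\<in>UNIV. LINT x|lebesgue. f x * partial (?p i) i x)"
    by (simp add: comp sum_negf)
  also have "(\<Sum>i\<in>UNIV. LINT x|lebesgue. f x * partial (?p i) i x) = (LINT x|lebesgue. (\<Sum>i\<in>UNIV. f x * partial (?p i) i x))"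
    using j2 by (intro Bochner_Integration.integral_sum[symmetric]) auto
  also have "\<dots> = (LINT x|lebesgue. f x * laplacian g x)" by (simp add: laplacian_def sum_distrib_left)
  finally show ?thesis by (simp add: G_def)
qed

text \<open>Inserting a spatial profile requires a test function with compact support before T whose
  time derivative vanishes on \<open>{1..t}\<close>. The margin \<delta> makes the derivative vanish
  at t itself as well; the step then falls from 1 to 0 before a time t2 < T.\<close>

lemma product_test_function:
  fixes g :: "real ^ 'n \<Rightarrow> real"
  assumes g: "compactly_smooth g" and t: "1 < t" "ereal t < T"
  obtains \<psi> \<delta> where "\<psi> \<in> test_functions (time_interval T \<times> UNIV)" "\<delta> > 0"
    "\<And>s x. s < t + \<delta> \<Longrightarrow> \<psi> (s, x) = g x"
proof -
  obtain t2 where t2: "t < t2" "ereal t2 < T"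
    using t(2) by (metis ereal_dense2 ereal_less_eq(3) less_ereal.simps(1) ereal_dense3)
  define \<delta> where "\<delta> = (t2 - t) / 2"
  have \<delta>: "\<delta> > 0" using t2 by (simp add: \<delta>_def)
  obtain K where K: "compact K" "\<And>x. x \<notin> K \<Longrightarrow> g x = 0" and gs: "\<And>m. C_on m UNIV g"
    using g by (auto simp: compactly_smooth_def)
  define \<psi> where "\<psi> z = smooth_step ((1 / \<delta>) * fst z + (- (t + \<delta>) / \<delta>)) * g (snd z)" for z :: "real \<times> (real ^ 'n)"
  have "C_on m UNIV \<psi>" for m
    unfolding \<psi>_def[abs_def]
    by (intro C_on_mult C_on_compose_linear[OF bounded_linear_snd] gs
        C_on_compose_real[OF C_on_smooth_step] C_on_add C_on_const C_on_bounded_linear bounded_linear_fst)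
  then have sm: "smooth_on UNIV \<psi>" by (simp add: smooth_on_def)
  have "\<exists>K. compact K \<and> K \<subseteq> time_interval T \<times> UNIV \<and> (\<forall>x\<in>time_interval T \<times> UNIV - K. \<psi> x = 0)"
  proof (intro exI[of _ "{1..t2} \<times> K"] conjI ballI)
    show "compact ({1..t2} \<times> K)" by (intro compact_Times K(1) compact_Icc)
    show "{1..t2} \<times> K \<subseteq> time_interval T \<times> UNIV"
      using t2 by (auto simp: time_interval_def intro: le_less_trans[of "ereal _" "ereal t2"])
    fix z assume z: "z \<in> time_interval T \<times> UNIV - {1..t2} \<times> K"
    show "\<psi> z = 0"
    proof (cases "snd z \<in> K")
      case True
      then have "fst z > t2" using z by (cases z) (auto simp: time_interval_def)
      then have "(1 / \<delta>) * fst z + (- (t + \<delta>) / \<delta>) \<ge> 1"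
      proof -
        have "t2 = t + \<delta> + \<delta>" by (simp add: \<delta>_def)
        then have "1 \<le> (fst z - (t + \<delta>)) / \<delta>" using \<open>fst z > t2\<close> \<delta> by (simp add: le_divide_eq)
        moreover have "(1 / \<delta>) * fst z + (- (t + \<delta>) / \<delta>) = (fst z - (t + \<delta>)) / \<delta>"
          unfolding diff_conv_add_uminus add_divide_distrib by simp
        ultimately show ?thesis by simp
      qed
      then show ?thesis by (simp add: \<psi>_def smooth_step_eq_0)
    qed (simp add: \<psi>_def K(2))
  qed
  then have "\<psi> \<in> test_functions (time_interval T \<times> UNIV)"
    using sm by (auto simp: test_functions_def)
  moreover have "\<psi> (s, x) = g x" if "s < t + \<delta>" for s x
  proof -
    have "(1 / \<delta>) * s + (- (t + \<delta>) / \<delta>) \<le> 0" using that \<delta> by (simp add: field_simps)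
    then show ?thesis by (simp add: \<psi>_def smooth_step_eq_1)
  qed
  ultimately show ?thesis using that \<delta> by blast
qed

lemma set_LINT_lebesgue_lborel:
  fixes f :: "real \<Rightarrow> real"
  assumes "set_integrable lborel A f"
  shows "(LINT x:A|lebesgue. f x) = (LINT x:A|lborel. f x)"
  using assms unfolding set_lebesgue_integral_def set_integrable_def
  by (intro integral_completion) auto

text \<open>With a profile constant in time the term containing the time derivative of the test
  function disappears, and what remains is a scalar equation already integrated once in
  time.\<close>

lemma energy_solution_tested:
  fixes u0 u1 g :: "real ^ 'n \<Rightarrow> real"
  assumes es: "energy_solution k \<mu> p \<epsilon> u0 u1 T u" and g: "compactly_smooth g"
  defines "U \<equiv> \<lambda>t. LINT x|lebesgue. u t x * g x"
    and "W \<equiv> \<lambda>t. LINT x|lebesgue. u t x * laplacian g x"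
  obtains V where "continuous_on (time_interval T) V" "continuous_on (time_interval T) W"
    "\<And>t. t \<in> time_interval T \<Longrightarrow> (U has_real_derivative V t) (at t within time_interval T)"
    "\<And>t. 1 < t \<Longrightarrow> ereal t < T \<Longrightarrow>
       V t = \<epsilon> * (LINT x|lebesgue. u1 x * g x) + (LINT s:{1..t}|lborel. s powr (-2 * k) * W s - \<mu> / s * V s)
         + (LINT s:{1..t}|lebesgue. LINT x|lebesgue. \<bar>u s x\<bar> powr p * g x)"
proof -
  let ?I = "time_interval T"
  obtain ut where ut: "C1_L2 ?I u ut"
    and weak: "\<And>\<psi> t. \<psi> \<in> test_functions (?I \<times> UNIV) \<Longrightarrow> 1 < t \<Longrightarrow> ereal t < T \<Longrightarrow>
          (LINT x|lebesgue. ut t x * \<psi> (t, x))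
          - \<epsilon> * (LINT x|lebesgue. u1 x * \<psi> (1, x))
          - (LINT s:{1..t}|lebesgue. LINT x|lebesgue. ut s x * deriv (\<lambda>r. \<psi> (r, x)) s)
          + (LINT s:{1..t}|lebesgue. LINT x|lebesgue.
               s powr (-2 * k) * (weak_grad (u s) x \<bullet> grad (\<lambda>y. \<psi> (s, y)) x))
          + (LINT s:{1..t}|lebesgue. LINT x|lebesgue. \<mu> * inverse s * ut s x * \<psi> (s, x))
          = (LINT s:{1..t}|lebesgue. LINT x|lebesgue. \<bar>u s x\<bar> powr p * \<psi> (s, x))"
    using es unfolding energy_solution_def by blast
  define V where "V t = (LINT x|lebesgue. ut t x * g x)" for t
  have cg: "C_c g" "C_c (laplacian g)" using g by (auto intro: compactly_smooth_C_c compactly_smooth_laplacian)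
  have CL: "C_L2 ?I u" "C_L2 ?I ut" using ut by (auto simp: C1_L2_def)
  have H1: "in_H1 (u s)" if "s \<in> ?I" for s using es that by (simp add: energy_solution_def C_H1_def)
  have cV: "continuous_on ?I V" unfolding V_def by (rule C_L2_pairing_continuous[OF CL(2) cg(1)])
  have cW: "continuous_on ?I W" unfolding W_def by (rule C_L2_pairing_continuous[OF CL(1) cg(2)])
  have eq: "V t = \<epsilon> * (LINT x|lebesgue. u1 x * g x) + (LINT s:{1..t}|lborel. s powr (-2 * k) * W s - \<mu> / s * V s)
         + (LINT s:{1..t}|lebesgue. LINT x|lebesgue. \<bar>u s x\<bar> powr p * g x)" if t: "1 < t" "ereal t < T" for t
  proof -
    obtain \<psi> \<delta> where \<psi>: "\<psi> \<in> test_functions (?I \<times> UNIV)" "\<delta> > 0" "\<And>s x. s < t + \<delta> \<Longrightarrow> \<psi> (s, x) = g x"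
      using product_test_function[OF g t] by blast
    have sub: "{1..t} \<subseteq> ?I" using t by (auto simp: time_interval_def intro: le_less_trans[of "ereal _" "ereal t"])
    have A: "s \<le> t \<Longrightarrow> \<psi> (s, x) = g x" for s x using \<psi>(2,3) by simp
    have B: "deriv (\<lambda>r. \<psi> (r, x)) s = 0" if "s \<le> t" for s x
    proof (rule DERIV_imp_deriv)
      show "((\<lambda>r. \<psi> (r, x)) has_real_derivative 0) (at s)"
        by (rule has_field_derivative_transform_within_open[OF DERIV_const[of "g x"], where S="{..<t + \<delta>}"])
          (use \<psi>(2,3) that in auto)
    qed
    have Z: "{1..t} \<in> sets lebesgue" by simp
    have t3: "(LINT s:{1..t}|lebesgue. LINT x|lebesgue. ut s x * deriv (\<lambda>r. \<psi> (r, x)) s) = (LINT s:{1..t}|lebesgue. 0)"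
      by (rule set_lebesgue_integral_cong[OF Z]) (auto simp: B)
    have c4: "continuous_on {1..t} (\<lambda>s. s powr (-2 * k) * W s)"
      by (intro continuous_intros continuous_on_subset[OF cW sub]) auto
    have c5: "continuous_on {1..t} (\<lambda>s. \<mu> / s * V s)"
      by (intro continuous_intros continuous_on_subset[OF cV sub]) auto
    have t4: "(LINT s:{1..t}|lebesgue. LINT x|lebesgue. s powr (-2 * k) * (weak_grad (u s) x \<bullet> grad (\<lambda>y. \<psi> (s, y)) x))
       = (LINT s:{1..t}|lebesgue. - (s powr (-2 * k) * W s))"
    proof (rule set_lebesgue_integral_cong[OF Z], intro allI impI)
      fix s assume s: "s \<in> {1..t}"
      have "(\<lambda>y. \<psi> (s, y)) = g" using A s by auto
      then show "(LINT x|lebesgue. s powr (-2 * k) * (weak_grad (u s) x \<bullet> grad (\<lambda>y. \<psi> (s, y)) x)) = - (s powr (-2 * k) * W s)"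
        using weak_grad_laplacian[OF H1 g, of s] s sub by (auto simp: W_def)
    qed
    have t5: "(LINT s:{1..t}|lebesgue. LINT x|lebesgue. \<mu> * inverse s * ut s x * \<psi> (s, x)) = (LINT s:{1..t}|lebesgue. \<mu> / s * V s)"
    proof (rule set_lebesgue_integral_cong[OF Z], intro allI impI)
      fix s assume s: "s \<in> {1..t}"
      have "(LINT x|lebesgue. \<mu> * inverse s * ut s x * \<psi> (s, x)) = (LINT x|lebesgue. \<mu> / s * (ut s x * g x))"
        using A s by (intro Bochner_Integration.integral_cong) (auto simp: divide_inverse)
      then show "(LINT x|lebesgue. \<mu> * inverse s * ut s x * \<psi> (s, x)) = \<mu> / s * V s" by (simp add: V_def)
    qed
    have t6: "(LINT s:{1..t}|lebesgue. LINT x|lebesgue. \<bar>u s x\<bar> powr p * \<psi> (s, x))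
       = (LINT s:{1..t}|lebesgue. LINT x|lebesgue. \<bar>u s x\<bar> powr p * g x)"
      by (rule set_lebesgue_integral_cong[OF Z]) (auto simp: A)
    have i4: "set_integrable lborel {1..t} (\<lambda>s. s powr (-2 * k) * W s)"
      unfolding set_integrable_def by (rule borel_integrable_compact[OF compact_Icc c4])
    have i4': "set_integrable lborel {1..t} (\<lambda>s. - (s powr (-2 * k) * W s))"
      unfolding set_integrable_def by (rule borel_integrable_compact[OF compact_Icc continuous_on_minus[OF c4]])
    have i5: "set_integrable lborel {1..t} (\<lambda>s. \<mu> / s * V s)"
      unfolding set_integrable_def by (rule borel_integrable_compact[OF compact_Icc c5])
    have d: "(LINT s:{1..t}|lborel. s powr (-2 * k) * W s - \<mu> / s * V s)
      = (LINT s:{1..t}|lborel. s powr (-2 * k) * W s) - (LINT s:{1..t}|lborel. \<mu> / s * V s)"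
      by (rule set_integral_diff(2)[OF i4 i5])
    have m: "(LINT s:{1..t}|lborel. - (s powr (-2 * k) * W s)) = - (LINT s:{1..t}|lborel. s powr (-2 * k) * W s)"
      using set_integral_mult_right[of lborel "{1..t}" "-1" "\<lambda>s. s powr (-2 * k) * W s"] by simp
    have "V t = (LINT x|lebesgue. ut t x * \<psi> (t, x))" "(LINT x|lebesgue. u1 x * g x) = (LINT x|lebesgue. u1 x * \<psi> (1, x))"
      using A t by (simp_all add: V_def)
    then show ?thesis
      using weak[OF \<psi>(1) t] unfolding t3 t4 t5 t6 set_LINT_lebesgue_lborel[OF i4'] set_LINT_lebesgue_lborel[OF i5] d m
      by simp
  qed
  show ?thesis
  proof (rule that[OF cV cW _ eq])
    show "(U has_real_derivative V t) (at t within ?I)" if "t \<in> ?I" for t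
      unfolding U_def V_def by (rule C1_L2_pairing_deriv[OF ut cg(1) that])
  qed auto
qed

section \<open>Reduction to scalar equations\<close>

lemma partialI:
  fixes f h :: "real ^ 'n \<Rightarrow> real"
  assumes "(h has_derivative D) (at x)" "open S" "x \<in> S" "\<And>y. y \<in> S \<Longrightarrow> h y = f y"
  shows "partial f i x = D (axis i 1)"
proof -
  have "(f has_derivative D) (at x)"
    using has_derivative_transform_within_open[OF assms(1,2,3)] assms(4) by blast
  then show ?thesis using frechet_derivative_at by (metis partial_def)
qed

definition eig :: "real \<Rightarrow> real ^ 'n \<Rightarrow> real" where
  "eig \<omega> x = radial_series CARD('n) (\<omega>\<^sup>2 * (norm x)\<^sup>2)"

text \<open>The cutoff acts on the squared norm, which keeps it smooth at the origin. It starts only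
  beyond radius r; with r outside the support of the solution, pairings with \<open>u\<close> do not
  see it.\<close>

definition eig_cut :: "real \<Rightarrow> real \<Rightarrow> real ^ 'n \<Rightarrow> real" where
  "eig_cut \<omega> r x = eig \<omega> x * smooth_step ((norm x)\<^sup>2 + (- r\<^sup>2))"

lemma card_ge_1: "CARD('n::finite) \<ge> 1"
  by (simp add: Suc_leI)

lemma eig_ge_1: "eig \<omega> (x :: real ^ 'n) \<ge> 1"
  unfolding eig_def by (rule radial_series_ge_1[OF card_ge_1]) simp

lemma C_on_eig: "C_on m UNIV (eig \<omega> :: real ^ 'n \<Rightarrow> real)"
  unfolding eig_def[abs_def]
  by (rule C_on_compose_real[OF C_on_radial_series[OF card_ge_1] C_on_mult[OF C_on_const C_on_norm_sq]])

lemma continuous_on_eig: "continuous_on UNIV (eig \<omega> :: real ^ 'n \<Rightarrow> real)"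
  by (rule C_on_imp_continuous[OF C_on_eig[of 0]])

lemma eig_cut_nonneg: "eig_cut \<omega> r x \<ge> 0"
  unfolding eig_cut_def using eig_ge_1[of \<omega> x] smooth_step_nonneg by (intro mult_nonneg_nonneg) auto

lemma eig_cut_eq: "norm x \<le> r \<Longrightarrow> eig_cut \<omega> r x = eig \<omega> x"
proof -
  assume "norm x \<le> r"
  then have "(norm x)\<^sup>2 \<le> r\<^sup>2" by (intro power_mono) auto
  then show ?thesis by (simp add: eig_cut_def smooth_step_eq_1)
qed

lemma compactly_smooth_eig_cut: "compactly_smooth (eig_cut \<omega> r :: real ^ 'n \<Rightarrow> real)"
  unfolding compactly_smooth_def
proof (intro conjI allI exI[of _ "cball 0 (sqrt (r\<^sup>2 + 1))"] impI)
  show "C_on m UNIV (eig_cut \<omega> r :: real ^ 'n \<Rightarrow> real)" for m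
    unfolding eig_cut_def[abs_def]
    by (rule C_on_mult[OF C_on_eig C_on_compose_real[OF C_on_smooth_step C_on_add[OF C_on_norm_sq C_on_const]]])
  fix x :: "real ^ 'n" assume "x \<notin> cball 0 (sqrt (r\<^sup>2 + 1))"
  then have "sqrt (r\<^sup>2 + 1) < norm x" by simp
  then have "r\<^sup>2 + 1 < (norm x)\<^sup>2" using power_strict_mono[of "sqrt (r\<^sup>2 + 1)" "norm x" 2] by simp
  then show "eig_cut \<omega> r x = 0" by (simp add: eig_cut_def smooth_step_eq_0)
qed simp

text \<open>On the open ball the cutoff is identically 1, so both derivatives are those of the
  series and its differential equation closes the computation.\<close>

lemma laplacian_eig_cut:
  fixes x :: "real ^ 'n"
  assumes "norm x < r"
  shows "laplacian (eig_cut \<omega> r) x = \<omega>\<^sup>2 * eig \<omega> x"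
proof -
  let ?n = "CARD('n)"
  let ?q = "\<lambda>x::real ^ 'n. \<omega>\<^sup>2 * (norm x)\<^sup>2"
  let ?S = "ball (0::real ^ 'n) r"
  have dq: "(?q has_derivative (\<lambda>h. \<omega>\<^sup>2 * (2 * (y \<bullet> h)))) (at y)" for y
    unfolding power2_norm_eq_inner by (auto intro!: derivative_eq_intros simp: inner_commute)
  have p1: "partial (eig_cut \<omega> r) i y = 2 * \<omega>\<^sup>2 * ((y $ i) * radial_series' ?n (?q y))" if "y \<in> ?S" for y i
  proof -
    have "((\<lambda>x. radial_series ?n (?q x)) has_derivative (\<lambda>h. \<omega>\<^sup>2 * (2 * (y \<bullet> h)) * radial_series' ?n (?q y))) (at y)"
      by (rule DERIV_compose_FDERIV[OF radial_series_deriv[OF card_ge_1] dq])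
    then have "partial (eig_cut \<omega> r) i y = \<omega>\<^sup>2 * (2 * (y \<bullet> axis i 1)) * radial_series' ?n (?q y)"
      using that by (rule partialI[where S = ?S, OF _ open_ball]) (simp add: eig_cut_eq eig_def)
    then show ?thesis by (simp add: inner_axis)
  qed
  have p2: "partial (partial (eig_cut \<omega> r) i) i x =
      2 * \<omega>\<^sup>2 * (radial_series' ?n (?q x) + 2 * \<omega>\<^sup>2 * (x $ i)\<^sup>2 * radial_series'' ?n (?q x))" for i
  proof -
    have "((\<lambda>y. radial_series' ?n (?q y)) has_derivative (\<lambda>h. \<omega>\<^sup>2 * (2 * (x \<bullet> h)) * radial_series'' ?n (?q x))) (at x)"
      by (rule DERIV_compose_FDERIV[OF radial_series'_deriv[OF card_ge_1] dq])
    moreover have "((\<lambda>y::real ^ 'n. y $ i) has_derivative (\<lambda>h. h $ i)) (at x)"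
      by (rule bounded_linear_imp_has_derivative[OF bounded_linear_vec_nth])
    ultimately have "((\<lambda>y. (y $ i) * radial_series' ?n (?q y)) has_derivative
       (\<lambda>h. (x $ i) * (\<omega>\<^sup>2 * (2 * (x \<bullet> h)) * radial_series'' ?n (?q x)) + (h $ i) * radial_series' ?n (?q x))) (at x)"
      by (rule has_derivative_mult[rotated])
    then have "((\<lambda>y. 2 * \<omega>\<^sup>2 * ((y $ i) * radial_series' ?n (?q y))) has_derivative
       (\<lambda>h. 2 * \<omega>\<^sup>2 * ((x $ i) * (\<omega>\<^sup>2 * (2 * (x \<bullet> h)) * radial_series'' ?n (?q x)) + (h $ i) * radial_series' ?n (?q x)))) (at x)"
      by (rule has_derivative_mult_right)
    then have "partial (partial (eig_cut \<omega> r) i) i x =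
      2 * \<omega>\<^sup>2 * ((x $ i) * (\<omega>\<^sup>2 * (2 * (x \<bullet> axis i 1)) * radial_series'' ?n (?q x)) + ((axis i 1 :: real ^ 'n) $ i) * radial_series' ?n (?q x))"
      by (rule partialI[where S = ?S, OF _ open_ball]) (use assms p1 in auto)
    then show ?thesis by (simp add: inner_axis power2_eq_square algebra_simps)
  qed
  have "(\<Sum>i\<in>UNIV. (x $ i)\<^sup>2) = (norm x)\<^sup>2"
    unfolding power2_norm_eq_inner inner_vec_def by (simp add: power2_eq_square)
  then have "laplacian (eig_cut \<omega> r) x = 2 * \<omega>\<^sup>2 * (real ?n * radial_series' ?n (?q x) + 2 * \<omega>\<^sup>2 * (norm x)\<^sup>2 * radial_series'' ?n (?q x))"
    unfolding laplacian_def p2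
    by (simp add: sum.distrib sum_distrib_left[symmetric] sum_distrib_right[symmetric])
  also have "\<dots> = \<omega>\<^sup>2 * (4 * ?q x * radial_series'' ?n (?q x) + 2 * real ?n * radial_series' ?n (?q x))"
    by (simp add: algebra_simps)
  also have "\<dots> = \<omega>\<^sup>2 * eig \<omega> x" by (simp only: radial_series_ode[OF card_ge_1] eig_def)
  finally show ?thesis .
qed

text \<open>The complement of the support is a union of balls on which f vanishes almost everywhere;
  by the Lindelof property countably many of them suffice.\<close>

lemma ess_support_AE: "AE x in lebesgue. x \<notin> ess_support f \<longrightarrow> f x = 0"
proof -
  define F where "F = {ball x r | x r. r > 0 \<and> (AE y in lebesgue. y \<in> ball x r \<longrightarrow> f y = 0)}"
  obtain F' where F': "F' \<subseteq> F" "countable F'" "\<Union>F' = \<Union>F"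
    using Lindelof[of F] by (auto simp: F_def)
  have "AE y in lebesgue. \<forall>S\<in>F'. y \<in> S \<longrightarrow> f y = 0"
    using F'(1,2) by (intro AE_ball_countable[THEN iffD2]) (auto simp: F_def)
  then show ?thesis
  proof eventually_elim
    case (elim x)
    show ?case
    proof
      assume "x \<notin> ess_support f"
      then obtain r where "r > 0" "AE y in lebesgue. y \<in> ball x r \<longrightarrow> f y = 0"
        by (auto simp: ess_support_def)
      then have "x \<in> \<Union>F" by (auto simp: F_def intro!: exI[of _ "ball x r"] centre_in_ball[THEN iffD2])
      then show "f x = 0" using elim F'(3) by auto
    qed
  qed
qed

text \<open>Every eigenfunction is at least 1, the value of the one with \<omega> = 0. Comparison
  with that one gives the mass of \<open>u1\<close> as a bound, uniform in the frequency and in the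
  cutoff radius.\<close>

lemma data_pairing_lower:
  fixes u1 :: "real ^ 'n \<Rightarrow> real"
  assumes u1: "in_L2 u1" "AE x in lebesgue. u1 x \<ge> 0" "\<not> (AE x in lebesgue. u1 x = 0)" "ess_support u1 \<subseteq> cball 0 R"
  obtains c where "c > 0" "\<And>\<omega> r. r \<ge> R \<Longrightarrow> (LINT x|lebesgue. u1 x * eig_cut \<omega> r x) \<ge> c"
proof -
  have supp: "AE x in lebesgue. u1 x \<noteq> 0 \<longrightarrow> norm x \<le> R"
    using ess_support_AE[of u1] by eventually_elim (use u1(4) in \<open>auto simp: subset_iff\<close>)
  have I: "integrable lebesgue (\<lambda>x. u1 x * eig_cut \<omega> r x)" for \<omega> r
    by (rule L2_C_c(1)[OF u1(1) compactly_smooth_C_c[OF compactly_smooth_eig_cut]])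
  have one: "eig 0 x = 1" for x :: "real ^ 'n"
    using suminf_finite[of "{0}" "\<lambda>j. radial_coeff CARD('n) j * 0 ^ j"]
    by (simp add: eig_def radial_series_def)
  define c where "c = (LINT x|lebesgue. u1 x * eig_cut 0 R x)"
  have nn: "AE x in lebesgue. 0 \<le> u1 x * eig_cut 0 R x"
    using u1(2) by eventually_elim (simp add: eig_cut_nonneg)
  have "c \<noteq> 0"
  proof
    assume "c = 0"
    then have "AE x in lebesgue. u1 x * eig_cut 0 R x = 0"
      using integral_nonneg_eq_0_iff_AE[OF I nn] by (simp add: c_def)
    then have "AE x in lebesgue. u1 x = 0"
      using supp by eventually_elim (auto simp: eig_cut_eq one)
    then show False using u1(3) by simp
  qed
  moreover have "c \<ge> 0" unfolding c_def by (rule integral_nonneg_AE[OF nn])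
  ultimately have "c > 0" by simp
  moreover have "(LINT x|lebesgue. u1 x * eig_cut \<omega> r x) \<ge> c" if "r \<ge> R" for \<omega> r
    unfolding c_def
  proof (rule integral_mono_AE[OF I I])
    show "AE x in lebesgue. u1 x * eig_cut 0 R x \<le> u1 x * eig_cut \<omega> r x"
      using u1(2) supp
    proof eventually_elim
      case (elim x)
      show ?case
      proof (cases "u1 x = 0")
        case False
        then have "norm x \<le> R" "norm x \<le> r" using elim that by auto
        then show ?thesis using elim mult_left_mono[OF eig_ge_1[of \<omega> x], of "u1 x"] by (auto simp: eig_cut_eq one)
      qed simp
    qed
  qed
  ultimately show ?thesis using that by blast
qed

text \<open>The solution is only Lebesgue measurable, while Fubini is used on a product of two
  copies of \<open>lborel\<close>; this passes from a Borel representative to the Lebesgue integrals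
  of the weak formulation.\<close>

lemma integrable_lebesgue_cong_AE:
  fixes f g :: "'a::euclidean_space \<Rightarrow> real"
  assumes f: "integrable lborel f" and ae: "AE x in lborel. g x = f x"
  shows "integrable lebesgue g" "(LINT x|lebesgue. g x) = (LINT x|lborel. f x)"
proof -
  have fm: "f \<in> borel_measurable lborel" using f by (rule borel_measurable_integrable)
  have fl: "f \<in> borel_measurable lebesgue" using measurable_completion[OF fm] .
  have ae': "AE x in lebesgue. f x = g x" using AE_completion[OF ae] by eventually_elim simp
  have gl: "g \<in> borel_measurable lebesgue" by (rule borel_measurable_AE[OF fl ae'])
  have fi: "integrable lebesgue f" using f fm by (simp add: integrable_completion)
  show "integrable lebesgue g" by (rule integrable_cong_AE_imp[OF fi gl ae'])
  have "(LINT x|lebesgue. g x) = (LINT x|lebesgue. f x)"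
    using ae' by (intro integral_cong_AE gl fl) (auto elim: eventually_mono)
  then show "(LINT x|lebesgue. g x) = (LINT x|lborel. f x)" using integral_completion[OF fm] by simp
qed

lemma A_speed_mono: "1 \<le> s \<Longrightarrow> s \<le> t \<Longrightarrow> A_speed k s \<le> A_speed k t"
  unfolding A_speed_def
  by (intro integral_subset_le integrable_continuous_real continuous_intros) auto

text \<open>\<open>U\<close> and \<open>F\<close> are the pairings of \<open>u\<close> and of the nonlinearity with the eigenfunction of frequency \<open>\<omega>\<close>;
  \<open>n\<close> is the mass of the nonlinearity, and \<open>e0\<close> bounds the contribution of the data from below.\<close>

definition scalar_solution ::
  "real \<Rightarrow> real \<Rightarrow> real \<Rightarrow> (real \<Rightarrow> real ^ 'n \<Rightarrow> real) \<Rightarrow> real \<Rightarrow> real \<Rightarrow> real \<Rightarrow>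
   (real \<Rightarrow> real) \<Rightarrow> (real \<Rightarrow> real) \<Rightarrow> (real \<Rightarrow> real) \<Rightarrow> real \<Rightarrow> bool" where
  "scalar_solution k \<mu> p u t1 e0 \<omega> U V F V0 \<longleftrightarrow>
    (\<forall>t\<in>{1..t1}. (U has_real_derivative V t) (at t within {1..t1})) \<and> continuous_on {1..t1} V
        \<and> set_integrable lborel {1..t1} F
        \<and> (\<forall>t\<in>{1..t1}. V t = V0 + (LINT s:{1..t}|lborel. (\<omega>\<^sup>2 * s powr (-2 * k)) * U s - \<mu> / s * V s) + (LINT s:{1..t}|lborel. F s))
        \<and> V0 \<ge> e0 \<and> U 1 \<ge> 0
        \<and> (AE s in lborel. s \<in> {1..t1} \<longrightarrow> integrable lebesgue (\<lambda>x. \<bar>u s x\<bar> powr p * eig \<omega> x)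
             \<and> F s = (LINT x|lebesgue. \<bar>u s x\<bar> powr p * eig \<omega> x)
             \<and> integrable lebesgue (\<lambda>x. u s x * eig \<omega> x) \<and> U s = (LINT x|lebesgue. u s x * eig \<omega> x))"

text \<open>The interface between the equation and the estimates: on a closed interval inside the
  lifespan it records the spatial mass of |u|^p, finite propagation, and a scalar equation for every
  frequency. Statements about slices hold for almost every time only, since u is locally L^p jointly
  in space and time.\<close>

definition reduced_solution :: "real \<Rightarrow> real \<Rightarrow> real \<Rightarrow> real \<Rightarrow> (real \<Rightarrow> real ^ 'n \<Rightarrow> real) \<Rightarrow> (real \<Rightarrow> real) \<Rightarrow> real \<Rightarrow> real \<Rightarrow> bool" where
  "reduced_solution k \<mu> p R u n t1 e0 \<longleftrightarrow> (\<forall>s. n s \<ge> 0) \<and> set_integrable lborel {1..t1} n \<and>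
    (AE s in lborel. s \<in> {1..t1} \<longrightarrow> u s \<in> borel_measurable lebesgue \<and> integrable lebesgue (\<lambda>x. \<bar>u s x\<bar> powr p)
        \<and> n s = (LINT x|lebesgue. \<bar>u s x\<bar> powr p)
        \<and> (AE x in lebesgue. u s x \<noteq> 0 \<longrightarrow> norm x \<le> A_speed k s + R)) \<and>
    (\<forall>\<omega>. \<exists>U V F V0. scalar_solution k \<mu> p u t1 e0 \<omega> U V F V0)"

text \<open>Joint measurability and integrability pass to slices only almost everywhere. |u|^p is
  therefore replaced by a Borel function \<open>h\<close> supported on a compact cylinder, to which
  Fubini applies. Finite propagation then allows the truncated eigenfunction to be exchanged for the
  full one.\<close>

lemma energy_solution_reduction:
  fixes u0 u1 :: "real ^ 'n \<Rightarrow> real"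
  assumes es: "energy_solution k \<mu> p \<epsilon> u0 u1 T u" and \<epsilon>: "\<epsilon> > 0"
    and supp: "\<And>t. 1 < t \<Longrightarrow> ereal t < T \<Longrightarrow> ess_support (u t) \<subseteq> cball 0 (A_speed k t + R)"
    and t1: "1 < t1" "ereal t1 < T"
    and u0: "in_L2 u0" "AE x in lebesgue. u0 x \<ge> 0"
    and c1: "\<And>\<omega> r. r \<ge> R \<Longrightarrow> (LINT x|lebesgue. u1 x * eig_cut \<omega> r x) \<ge> c1"
  obtains n where "reduced_solution k \<mu> p R u n t1 (\<epsilon> * c1)"
proof -
  let ?I = "time_interval T"
  have sub: "{1..t1} \<subseteq> ?I" using t1 by (auto simp: time_interval_def intro: le_less_trans[of "ereal _" "ereal t1"])
  \<comment> \<open>The extra 1 puts all supports strictly inside the ball of radius r, where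
    \<open>laplacian_eig_cut\<close> holds.\<close>
  define r where "r = A_speed k t1 + R + 1"
  have A1: "A_speed k 1 = 0" by (simp add: A_speed_def)
  have rR: "r \<ge> R" using A_speed_mono[of 1 t1 k] t1 A1 by (simp add: r_def)
  define K where "K = cball (0::real ^ 'n) r"
  define C where "C = {1..t1} \<times> K"
  have uL2: "in_L2 (u s)" if "s \<in> {1..t1}" for s
    using es that sub by (auto simp: energy_solution_def C_H1_def in_H1_def)
  have usupp: "AE x in lebesgue. u s x \<noteq> 0 \<longrightarrow> norm x \<le> A_speed k s + R" if s: "s \<in> {1<..t1}" for s
  proof -
    have "ereal s < T" using s t1 by (auto intro: le_less_trans[of "ereal s" "ereal t1"])
    then have "ess_support (u s) \<subseteq> cball 0 (A_speed k s + R)" using supp[of s] s by auto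
    then show ?thesis using ess_support_AE[of "u s"] by (elim eventually_mono) (auto simp: subset_iff)
  qed
  have rho: "A_speed k s + R < r" if "s \<in> {1..t1}" for s
    using A_speed_mono[of s t1 k] that by (simp add: r_def)
  have Lp: "in_Lp_loc p (?I \<times> UNIV) (\<lambda>(t, x). u t x)" using es by (simp add: energy_solution_def)
  define f where "f = (\<lambda>(t, x). u t x)"
  have "(\<lambda>z. indicator (?I \<times> UNIV) z * f z) \<in> borel_measurable lebesgue"
    using Lp by (simp add: in_Lp_loc_def set_borel_measurable_def f_def)
  then obtain v where v: "v \<in> borel_measurable lborel" "AE z in lborel. indicator (?I \<times> UNIV) z * f z = v z"
    using completion_ex_borel_measurable_real by blast
  have Cc: "compact C" "C \<subseteq> ?I \<times> UNIV" using sub by (auto simp: C_def K_def intro!: compact_Times)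
  have Cm: "C \<in> sets borel" by (intro borel_closed compact_imp_closed Cc)
  define h where "h z = indicator C z * \<bar>v z\<bar> powr p" for z
  have hm: "h \<in> borel_measurable lborel" unfolding h_def[abs_def] using v(1) Cm by measurable
  have hi: "integrable lborel h"
  proof -
    have "set_integrable lebesgue C (\<lambda>z. \<bar>f z\<bar> powr p)" using Lp Cc by (simp add: in_Lp_loc_def f_def)
    then have i: "integrable lebesgue (\<lambda>z. indicator C z * \<bar>f z\<bar> powr p)" by (simp add: set_integrable_def)
    have "AE z in lebesgue. indicator C z * \<bar>f z\<bar> powr p = h z"
      using AE_completion[OF v(2)]
    proof eventually_elim
      case (elim z)
      show ?case
      proof (cases "z \<in> C")
        case True
        then have "z \<in> ?I \<times> UNIV" using Cc(2) by blast
        then have "f z = v z" using elim by simp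
        then show ?thesis by (simp add: h_def)
      qed (simp add: h_def)
    qed
    then have "integrable lebesgue h" using integrable_cong_AE_imp[OF i measurable_completion[OF hm]] by blast
    then show ?thesis using hm by (simp add: integrable_completion)
  qed
  have hi2: "integrable (lborel \<Otimes>\<^sub>M lborel) (h :: real \<times> (real ^ 'n) \<Rightarrow> real)" using hi by (simp add: lborel_prod)
  define n where "n s = (LINT x|lborel. h (s, x))" for s
  have n0: "n s \<ge> 0" for s unfolding n_def by (rule Bochner_Integration.integral_nonneg) (simp add: h_def)
  have ni: "integrable lborel n" unfolding n_def[abs_def] by (rule lborel_pair.integrable_fst'[OF hi2])
  have good1: "AE s in lborel. integrable lborel (\<lambda>x. h (s, x))" by (rule lborel_pair.AE_integrable_fst'[OF hi2])
  have "AE z in lborel \<Otimes>\<^sub>M lborel. indicator (?I \<times> UNIV) z * f z = v z"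
    unfolding lborel_prod by (rule v(2))
  from lborel_pair.AE_pair[OF this]
  have good2: "AE s in lborel. AE x in lborel. indicator (?I \<times> UNIV) (s, x) * u s x = v (s, x)"
    by (simp add: f_def)
  \<comment> \<open>The support condition concerns times after 1, so the initial time is discarded
    as a null set.\<close>
  have good3: "AE s in lborel. s \<noteq> (1::real)" by (rule AE_lborel_singleton)
  have hae: "AE x in lborel. \<bar>u s x\<bar> powr p = h (s, x)"
    if s: "s \<in> {1..t1}" "s \<noteq> 1" and g2: "AE x in lborel. indicator (?I \<times> UNIV) (s, x) * u s x = v (s, x)" for s
  proof -
    have sI: "s \<in> ?I" using s sub by blast
    have "AE x in lborel. u s x \<noteq> 0 \<longrightarrow> norm x \<le> A_speed k s + R"
      using usupp[of s] s by (simp add: AE_completion_iff)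
    with g2 show ?thesis
    proof eventually_elim
      case (elim x)
      have uv: "u s x = v (s, x)" using elim(1) sI by simp
      show ?case
      proof (cases "u s x = 0")
        case True
        then show ?thesis using uv by (simp add: h_def)
      next
        case False
        then have "(s, x) \<in> C" using elim(2) rho[OF s(1)] s by (auto simp: C_def K_def)
        then show ?thesis using uv by (simp add: h_def)
      qed
    qed
  qed
  show ?thesis
  proof (rule that[of n], unfold reduced_solution_def, intro conjI allI)
    show "n s \<ge> 0" for s by (rule n0)
    show "set_integrable lborel {1..t1} n"
      unfolding set_integrable_def using ni by (intro integrable_mult_indicator) auto
    show "AE s in lborel. s \<in> {1..t1} \<longrightarrow> u s \<in> borel_measurable lebesgue \<and> integrable lebesgue (\<lambda>x. \<bar>u s x\<bar> powr p)
        \<and> n s = (LINT x|lebesgue. \<bar>u s x\<bar> powr p)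
        \<and> (AE x in lebesgue. u s x \<noteq> 0 \<longrightarrow> norm x \<le> A_speed k s + R)"
      using good1 good2 good3
    proof eventually_elim
      case (elim s)
      show ?case
      proof
        assume s: "s \<in> {1..t1}"
        note H = integrable_lebesgue_cong_AE[OF elim(1) hae[OF s elim(3,2)]]
        show "u s \<in> borel_measurable lebesgue \<and> integrable lebesgue (\<lambda>x. \<bar>u s x\<bar> powr p)
          \<and> n s = (LINT x|lebesgue. \<bar>u s x\<bar> powr p)
          \<and> (AE x in lebesgue. u s x \<noteq> 0 \<longrightarrow> norm x \<le> A_speed k s + R)"
          using H usupp[of s] s elim(3) uL2[OF s] by (auto simp: n_def in_L2_real)
      qed
    qed
    fix \<omega>
    define g where "g = (eig_cut \<omega> r :: real ^ 'n \<Rightarrow> real)"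
    have gs: "compactly_smooth g" unfolding g_def by (rule compactly_smooth_eig_cut)
    have gc: "continuous_on UNIV g" using compactly_smooth_continuous[OF gs] .
    have gm: "g \<in> borel_measurable borel" using borel_measurable_continuous_onI[OF gc] .
    define U where "U t = (LINT x|lebesgue. u t x * g x)" for t
    define W where "W t = (LINT x|lebesgue. u t x * laplacian g x)" for t
    obtain V where cV: "continuous_on ?I V" and cW: "continuous_on ?I W"
      and dU: "\<And>t. t \<in> ?I \<Longrightarrow> (U has_real_derivative V t) (at t within ?I)"
      and Veq: "\<And>t. 1 < t \<Longrightarrow> ereal t < T \<Longrightarrow>
       V t = \<epsilon> * (LINT x|lebesgue. u1 x * g x) + (LINT s:{1..t}|lborel. s powr (-2 * k) * W s - \<mu> / s * V s)
         + (LINT s:{1..t}|lebesgue. LINT x|lebesgue. \<bar>u s x\<bar> powr p * g x)"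
      using energy_solution_tested[OF es gs] unfolding U_def[abs_def] W_def[abs_def] by blast
    define V0 where "V0 = \<epsilon> * (LINT x|lebesgue. u1 x * g x)"
    \<comment> \<open>\<open>h\<close> vanishes off the cylinder, and on it the truncated and the
      full eigenfunction agree.\<close>
    have hgz: "h (s, x) * g x = h (s, x) * eig \<omega> x" for s x
      by (cases "x \<in> K") (auto simp: h_def C_def g_def K_def eig_cut_eq)
    obtain B where B: "\<And>x. x \<in> K \<Longrightarrow> \<bar>g x\<bar> \<le> B"
    proof -
      have "compact (g ` K)" by (intro compact_continuous_image continuous_on_subset[OF gc]) (auto simp: K_def)
      then have "bounded (g ` K)" by (rule compact_imp_bounded)
      then show ?thesis using that by (auto simp: bounded_iff)
    qed
    have hB: "norm (h (s, x) * g x) \<le> norm (B * h (s, x))" for s x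
    proof (cases "x \<in> K")
      case True
      have "\<bar>g x\<bar> \<le> \<bar>B\<bar>" using B[OF True] by linarith
      then have "\<bar>h (s, x)\<bar> * \<bar>g x\<bar> \<le> \<bar>h (s, x)\<bar> * \<bar>B\<bar>" by (rule mult_left_mono) simp
      then show ?thesis by (simp add: abs_mult mult.commute)
    qed (simp add: h_def C_def)
    define F where "F s = (LINT x|lborel. h (s, x) * g x)" for s
    have Fi: "integrable lborel F"
    proof -
      have "integrable (lborel \<Otimes>\<^sub>M lborel) (\<lambda>z. h z * g (snd z))"
      proof (rule Bochner_Integration.integrable_bound)
        show "integrable (lborel \<Otimes>\<^sub>M lborel) (\<lambda>z. B * h z)" using hi2 by simp
        have "h \<in> borel_measurable (lborel \<Otimes>\<^sub>M lborel)" using hi2 by (rule borel_measurable_integrable)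
        then show "(\<lambda>z. h z * g (snd z)) \<in> borel_measurable (lborel \<Otimes>\<^sub>M lborel)" using gm by measurable
        show "AE z in lborel \<Otimes>\<^sub>M lborel. norm (h z * g (snd z)) \<le> norm (B * h z)"
          by (rule AE_I2) (use hB in \<open>auto simp: split_paired_all\<close>)
      qed
      from lborel_pair.integrable_fst'[OF this] show ?thesis by (simp add: F_def[abs_def])
    qed
    have Fset: "set_integrable lborel {1..t} F" for t
      unfolding set_integrable_def using Fi by (intro integrable_mult_indicator) auto
    have good: "AE s in lborel. s \<in> {1..t1} \<longrightarrow> integrable lebesgue (\<lambda>x. \<bar>u s x\<bar> powr p * g x)
             \<and> F s = (LINT x|lebesgue. \<bar>u s x\<bar> powr p * g x)
             \<and> integrable lebesgue (\<lambda>x. \<bar>u s x\<bar> powr p * eig \<omega> x)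
             \<and> F s = (LINT x|lebesgue. \<bar>u s x\<bar> powr p * eig \<omega> x)"
      using good1 good2 good3
    proof eventually_elim
      case (elim s)
      show ?case
      proof
        assume s: "s \<in> {1..t1}"
        have hgi: "integrable lborel (\<lambda>x. h (s, x) * g x)"
        proof (rule Bochner_Integration.integrable_bound)
          show "integrable lborel (\<lambda>x. B * h (s, x))" using elim(1) by simp
          show "(\<lambda>x. h (s, x) * g x) \<in> borel_measurable lborel"
            using borel_measurable_integrable[OF elim(1)] gm by measurable
        qed (use hB in auto)
        have ae1: "AE x in lborel. \<bar>u s x\<bar> powr p * g x = h (s, x) * g x"
          using hae[OF s elim(3,2)] by eventually_elim simp
        have ae2: "AE x in lborel. \<bar>u s x\<bar> powr p * eig \<omega> x = h (s, x) * g x"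
          using hae[OF s elim(3,2)] by eventually_elim (simp add: hgz)
        show "integrable lebesgue (\<lambda>x. \<bar>u s x\<bar> powr p * g x)
             \<and> F s = (LINT x|lebesgue. \<bar>u s x\<bar> powr p * g x)
             \<and> integrable lebesgue (\<lambda>x. \<bar>u s x\<bar> powr p * eig \<omega> x)
             \<and> F s = (LINT x|lebesgue. \<bar>u s x\<bar> powr p * eig \<omega> x)"
          using integrable_lebesgue_cong_AE[OF hgi ae1] integrable_lebesgue_cong_AE[OF hgi ae2] by (simp add: F_def)
      qed
    qed
    have source: "(LINT s:{1..t}|lebesgue. LINT x|lebesgue. \<bar>u s x\<bar> powr p * g x) = (LINT s:{1..t}|lborel. F s)"
      if "t \<le> t1" for t
      unfolding set_lebesgue_integral_def
    proof (rule integrable_lebesgue_cong_AE(2))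
      show "integrable lborel (\<lambda>s. indicator {1..t} s *\<^sub>R F s)" using Fset[of t] by (simp add: set_integrable_def)
      show "AE s in lborel. indicator {1..t} s *\<^sub>R (LINT x|lebesgue. \<bar>u s x\<bar> powr p * g x) = indicator {1..t} s *\<^sub>R F s"
        using good by eventually_elim (use that in \<open>auto simp: indicator_def\<close>)
    qed
    have Ueig: "integrable lebesgue (\<lambda>x. u s x * eig \<omega> x) \<and> U s = (LINT x|lebesgue. u s x * eig \<omega> x) \<and> W s = \<omega>\<^sup>2 * U s"
      if s: "s \<in> {1<..t1}" for s
    proof -
      have s': "s \<in> {1..t1}" using s by auto
      have i: "integrable lebesgue (\<lambda>x. u s x * g x)"
        by (rule L2_C_c(1)[OF uL2[OF s'] compactly_smooth_C_c[OF gs]])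
      have um: "u s \<in> borel_measurable lebesgue" using uL2[OF s'] by (simp add: in_L2_real)
      have em: "(eig \<omega> :: real ^ 'n \<Rightarrow> real) \<in> borel_measurable lebesgue"
        by (intro borel_imp_lebesgue_measurable borel_measurable_continuous_onI continuous_on_eig)
      have lm: "laplacian g \<in> borel_measurable lebesgue"
        by (intro borel_imp_lebesgue_measurable C_c_borel compactly_smooth_C_c compactly_smooth_laplacian gs)
      have gm': "g \<in> borel_measurable lebesgue" using borel_imp_lebesgue_measurable[OF gm] .
      have ae: "AE x in lebesgue. u s x * g x = u s x * eig \<omega> x"
        using usupp[OF s] by eventually_elim (use rho[OF s'] in \<open>auto simp: g_def eig_cut_eq\<close>)
      have aeW: "AE x in lebesgue. u s x * laplacian g x = \<omega>\<^sup>2 * (u s x * g x)"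
        using usupp[OF s] by eventually_elim (use rho[OF s'] in \<open>auto simp: g_def eig_cut_eq laplacian_eig_cut\<close>)
      have "U s = (LINT x|lebesgue. u s x * eig \<omega> x)"
        unfolding U_def using um em gm' by (intro integral_cong_AE ae) auto
      moreover have "W s = (LINT x|lebesgue. \<omega>\<^sup>2 * (u s x * g x))"
        unfolding W_def using um lm gm' by (intro integral_cong_AE aeW) auto
      moreover have "integrable lebesgue (\<lambda>x. u s x * eig \<omega> x)"
        using um em by (intro integrable_cong_AE_imp[OF i _ ae]) auto
      ultimately show ?thesis by (simp add: U_def)
    qed
    have cU: "continuous_on ?I U" using dU by (meson DERIV_continuous continuous_on_eq_continuous_within)
    have cg: "continuous_on {1..t1} (\<lambda>s. (\<omega>\<^sup>2 * s powr (-2 * k)) * U s - \<mu> / s * V s)"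
      by (intro continuous_intros continuous_on_subset[OF cU sub] continuous_on_subset[OF cV sub]) auto
    define RHS where "RHS t = V0 + (LINT s:{1..t}|lborel. (\<omega>\<^sup>2 * s powr (-2 * k)) * U s - \<mu> / s * V s) + (LINT s:{1..t}|lborel. F s)" for t
    have e1: "V t = RHS t" if t: "t \<in> {1<..t1}" for t
    proof -
      have tT: "ereal t < T" using t t1 by (auto intro: le_less_trans[of "ereal t" "ereal t1"])
      have "(LINT s:{1..t}|lborel. s powr (-2 * k) * W s - \<mu> / s * V s)
         = (LINT s:{1..t}|lborel. (\<omega>\<^sup>2 * s powr (-2 * k)) * U s - \<mu> / s * V s)"
      proof -
        have "continuous_on {1..t} (\<lambda>s. s powr (-2 * k) * W s - \<mu> / s * V s)"
          using sub t by (intro continuous_intros continuous_on_subset[OF cW] continuous_on_subset[OF cV]) auto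
        moreover have "continuous_on {1..t} (\<lambda>s. (\<omega>\<^sup>2 * s powr (-2 * k)) * U s - \<mu> / s * V s)"
          using t by (intro continuous_on_subset[OF cg]) auto
        moreover have "AE s in lborel. s \<noteq> (1::real)" by (rule AE_lborel_singleton)
        ultimately show ?thesis
          unfolding set_lebesgue_integral_def
          using set_integrable_continuous_interval(1)[unfolded set_integrable_def] borel_measurable_integrable t Ueig
          by (intro integral_cong_AE) (blast, blast, elim eventually_mono, auto simp: indicator_def)
      qed
      then show ?thesis using Veq[of t] tT t source[of t] by (simp add: RHS_def V0_def)
    qed
    have cR: "continuous_on {1..t1} RHS"
    proof -
      have "continuous_on {1..t1} (\<lambda>t. V0 + integral {1..t} (\<lambda>s. (\<omega>\<^sup>2 * s powr (-2 * k)) * U s - \<mu> / s * V s) + integral {1..t} F)"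
        by (rule continuous_on_add[OF continuous_on_add[OF continuous_on_const
              indefinite_integral_continuous_1[OF integrable_continuous_real[OF cg]]]
              indefinite_integral_continuous_1[OF set_borel_integral_eq_integral(1)[OF Fset[of t1]]]])
      then show ?thesis
      proof (rule continuous_on_eq)
        fix t assume t: "t \<in> {1..t1}"
        have "continuous_on {1..t} (\<lambda>s. (\<omega>\<^sup>2 * s powr (-2 * k)) * U s - \<mu> / s * V s)"
          using t by (intro continuous_on_subset[OF cg]) auto
        then show "V0 + integral {1..t} (\<lambda>s. (\<omega>\<^sup>2 * s powr (-2 * k)) * U s - \<mu> / s * V s) + integral {1..t} F = RHS t"
          unfolding RHS_def using set_integrable_continuous_interval(2) set_borel_integral_eq_integral(2)[OF Fset[of t]] by simp
      qed
    qed
    \<comment> \<open>The weak formulation gives the equation for t > 1; both sides are continuous,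
      so it extends to the initial time.\<close>
    have e2: "V 1 = RHS 1"
    proof -
      have nb: "at 1 within {1<..t1} \<noteq> bot"
        using t1 by (simp add: trivial_limit_within)
      have "(V \<longlongrightarrow> V 1) (at 1 within {1<..t1})"
        by (rule tendsto_within_subset[OF continuous_on_subset[OF cV sub, unfolded continuous_on_def, rule_format]])
          (use t1 in \<open>auto simp only: atLeastAtMost_iff greaterThanAtMost_iff less_imp_le order_refl subset_iff\<close>)
      have "(RHS \<longlongrightarrow> RHS 1) (at 1 within {1<..t1})"
        by (rule tendsto_within_subset[OF cR[unfolded continuous_on_def, rule_format]])
          (use t1 in \<open>auto simp only: atLeastAtMost_iff greaterThanAtMost_iff less_imp_le order_refl subset_iff\<close>)
      moreover have "\<forall>\<^sub>F t in at 1 within {1<..t1}. RHS t = V t"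
        using e1 by (auto simp: eventually_at_filter)
      ultimately have "(V \<longlongrightarrow> RHS 1) (at 1 within {1<..t1})" by (rule Lim_transform_eventually)
      with \<open>(V \<longlongrightarrow> V 1) (at 1 within {1<..t1})\<close> show ?thesis using tendsto_unique[OF nb] by blast
    qed
    have Veq': "V t = RHS t" if "t \<in> {1..t1}" for t
      using e1[of t] e2 that by (cases "t = 1") auto
    have V0: "V0 \<ge> \<epsilon> * c1"
      unfolding V0_def g_def using c1[OF rR] \<epsilon> by (intro mult_left_mono) auto
    have U1: "U 1 \<ge> 0"
    proof -
      have "AE x in lebesgue. u 1 x = \<epsilon> * u0 x" using es by (simp add: energy_solution_def)
      then have "AE x in lebesgue. 0 \<le> u 1 x * g x"
        using u0(2) by eventually_elim (use \<epsilon> in \<open>auto simp: g_def eig_cut_nonneg\<close>)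
      then show ?thesis unfolding U_def by (rule integral_nonneg_AE)
    qed
    have goodU: "AE s in lborel. s \<in> {1..t1} \<longrightarrow> integrable lebesgue (\<lambda>x. u s x * eig \<omega> x) \<and> U s = (LINT x|lebesgue. u s x * eig \<omega> x)"
      using good3 by eventually_elim (use Ueig in auto)
    show "\<exists>U V F V0. scalar_solution k \<mu> p u t1 (\<epsilon> * c1) \<omega> U V F V0"
    proof (rule exI[of _ U], rule exI[of _ V], rule exI[of _ F], rule exI[of _ V0], unfold scalar_solution_def, intro conjI ballI)
      show "(U has_real_derivative V t) (at t within {1..t1})" if "t \<in> {1..t1}" for t
        using dU[of t] that sub by (blast intro: DERIV_subset)
      show "continuous_on {1..t1} V" by (rule continuous_on_subset[OF cV sub])
      show "V t = V0 + (LINT s:{1..t}|lborel. (\<omega>\<^sup>2 * s powr (-2 * k)) * U s - \<mu> / s * V s) + (LINT s:{1..t}|lborel. F s)"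
        if "t \<in> {1..t1}" for t using Veq'[OF that] by (simp add: RHS_def)
      show "AE s in lborel. s \<in> {1..t1} \<longrightarrow> integrable lebesgue (\<lambda>x. \<bar>u s x\<bar> powr p * eig \<omega> x)
             \<and> F s = (LINT x|lebesgue. \<bar>u s x\<bar> powr p * eig \<omega> x)
             \<and> integrable lebesgue (\<lambda>x. u s x * eig \<omega> x) \<and> U s = (LINT x|lebesgue. u s x * eig \<omega> x)"
        using good goodU by eventually_elim auto
    qed (use Fset V0 U1 in auto)
  qed
qed

section \<open>Test functions concentrated on the light cone\<close>

lemma DERIV_max_power:
  fixes f :: "real \<Rightarrow> real"
  assumes f: "(f has_real_derivative f') (at x)" and m: "m \<ge> 2"
  shows "((\<lambda>x. (max 0 (f x)) ^ m) has_real_derivative real m * (max 0 (f x)) ^ (m - 1) * f') (at x)"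
proof -
  have "((\<lambda>y::real. (max 0 y) ^ m) has_real_derivative real m * (max 0 y) ^ (m - 1)) (at y)" for y :: real
  proof (cases y "0::real" rule: linorder_cases)
    case less
    have "((\<lambda>_. 0) has_real_derivative 0) (at y)" by simp
    moreover have "\<forall>\<^sub>F z in nhds y. (max 0 z) ^ m = 0"
      using eventually_nhds_in_open[of "{..<0}" y] less m by (auto elim!: eventually_mono)
    ultimately have "((\<lambda>y::real. (max 0 y) ^ m) has_real_derivative 0) (at y)"
      using DERIV_cong_ev[OF refl, of "\<lambda>y. (max 0 y) ^ m" "\<lambda>_. 0" y] by simp
    then show ?thesis using less m by (simp add: zero_power)
  next
    case equal
    have "((\<lambda>h::real. (max 0 h) ^ m / h) \<longlongrightarrow> 0) (at 0)"
    proof (rule Lim_null_comparison)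
      have "norm ((max 0 h) ^ m / h) \<le> \<bar>h\<bar>" if "\<bar>h\<bar> < 1" "h \<noteq> 0" for h :: real
      proof (cases "h > 0")
        case True
        have "h ^ m \<le> h ^ 2" using True that m by (intro power_decreasing) auto
        then have "h ^ m / h \<le> h" using True by (simp add: divide_le_eq power2_eq_square)
        then show ?thesis using True by simp
      next
        case False
        then show ?thesis using m by (simp add: max_def zero_power)
      qed
      then show "\<forall>\<^sub>F h in at 0. norm ((max 0 h) ^ m / h) \<le> \<bar>h::real\<bar>"
        unfolding eventually_at by (intro exI[of _ 1]) auto
      show "((\<lambda>h. \<bar>h::real\<bar>) \<longlongrightarrow> 0) (at 0)" by (auto intro!: tendsto_eq_intros)
    qed
    then show ?thesis using equal m by (simp add: DERIV_def zero_power)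
  next
    case greater
    have "((\<lambda>y. y ^ m) has_real_derivative real m * y ^ (m - 1)) (at y)"
      by (auto intro!: derivative_eq_intros)
    moreover have "\<forall>\<^sub>F z in nhds y. (max 0 z) ^ m = z ^ m"
      using eventually_nhds_in_open[of "{0<..}" y] greater by (auto elim!: eventually_mono)
    ultimately have "((\<lambda>y::real. (max 0 y) ^ m) has_real_derivative real m * y ^ (m - 1)) (at y)"
      using DERIV_cong_ev[OF refl, of "\<lambda>y. (max 0 y) ^ m" "\<lambda>y. y ^ m" y] by simp
    then show ?thesis using greater by simp
  qed
  from DERIV_chain2[OF this f] show ?thesis .
qed

text \<open>\<open>Q y = 1 - (1 - y ^ m) ^ m\<close> on \<open>[0, 1]\<close>; for large \<open>m\<close> the second derivative vanishes at both ends
  to an order that makes it dominated by a power of the first.\<close>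

lemma cutoff_exists:
  fixes p :: real
  assumes p: "p > 1"
  obtains Q Q1 Q2 :: "real \<Rightarrow> real" and C :: real where
    "\<And>y. (Q has_real_derivative Q1 y) (at y)" "\<And>y. (Q1 has_real_derivative Q2 y) (at y)"
    "continuous_on UNIV Q2" "\<And>y. 0 \<le> Q y" "\<And>y. y \<le> 0 \<Longrightarrow> Q y = 0" "\<And>y. y \<ge> 1 \<Longrightarrow> Q y = 1"
    "\<And>y. 0 \<le> Q1 y" "\<And>y. y \<le> 0 \<or> y \<ge> 1 \<Longrightarrow> Q1 y = 0"
    "C > 0" "\<And>y. Q1 y \<le> C * Q1 y powr (1 / p)" "\<And>y. \<bar>Q2 y\<bar> \<le> C * Q1 y powr (1 / p)"
    "\<And>y. \<bar>Q2 y\<bar> \<le> C"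
proof -
  \<comment> \<open>Chosen so that \<open>(real m - 1) / p \<le> real m - 2\<close>: for w \<le> 1
    the second derivative, of order w^(m - 2), is then dominated by the p-th root of the first, of
    order w^(m - 1). The summand 3 also leaves room for two derivatives.\<close>
  define m where "m = nat \<lceil>p / (p - 1)\<rceil> + 3"
  have m3: "m \<ge> 3" by (simp add: m_def)
  have mp: "real m - 2 \<ge> p / (p - 1)" unfolding m_def by linarith
  have mp': "(real m - 1) / p \<le> real m - 2"
  proof -
    have "p \<le> (real m - 2) * (p - 1)" using mp p by (simp add: divide_le_eq)
    then have "real m - 1 \<le> (real m - 2) * p" using p by (simp add: algebra_simps)
    then show ?thesis using p by (simp add: divide_le_eq)
  qed
  define a where "a y = max 0 y" for y :: real
  define b where "b y = max 0 (1 - a y ^ m)" for y :: real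
  define Q where "Q y = 1 - b y ^ m" for y
  define Q1 where "Q1 y = (real m)\<^sup>2 * (a y ^ (m - 1) * b y ^ (m - 1))" for y
  define Q2 where "Q2 y = (real m)\<^sup>2 * (real (m - 1) * a y ^ (m - 2) * b y ^ (m - 1)
      + a y ^ (m - 1) * (real (m - 1) * b y ^ (m - 2) * (- (real m * a y ^ (m - 1)))))" for y
  have da: "((\<lambda>y. a y ^ j) has_real_derivative real j * a y ^ (j - 1)) (at y)" if "j \<ge> 2" for j y
    using DERIV_max_power[OF DERIV_ident that, of y] by (simp add: a_def)
  have db: "((\<lambda>y. b y ^ j) has_real_derivative real j * b y ^ (j - 1) * (- (real m * a y ^ (m - 1)))) (at y)" if "j \<ge> 2" for j y
  proof -
    have "((\<lambda>y. 1 - a y ^ m) has_real_derivative (0 - real m * a y ^ (m - 1))) (at y)"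
      using m3 by (intro DERIV_diff DERIV_const da) auto
    from DERIV_max_power[OF this that] show ?thesis by (simp add: b_def)
  qed
  have dQ: "(Q has_real_derivative Q1 y) (at y)" for y
    using DERIV_diff[OF DERIV_const[of 1] db[of m y]] m3 unfolding Q_def[abs_def] Q1_def
    by (simp add: power2_eq_square mult_ac)
  have dQ1: "(Q1 has_real_derivative Q2 y) (at y)" for y
  proof -
    have "((\<lambda>y. a y ^ (m - 1) * b y ^ (m - 1)) has_real_derivative
       (real (m - 1) * a y ^ (m - 1 - 1)) * b y ^ (m - 1)
       + (real (m - 1) * b y ^ (m - 1 - 1) * (- (real m * a y ^ (m - 1)))) * a y ^ (m - 1)) (at y)"
      using m3 by (intro DERIV_mult da db) auto
    from DERIV_cmult[OF this, of "(real m)\<^sup>2"]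
    have "(Q1 has_real_derivative (real m)\<^sup>2 * ((real (m - 1) * a y ^ (m - 1 - 1)) * b y ^ (m - 1)
       + (real (m - 1) * b y ^ (m - 1 - 1) * (- (real m * a y ^ (m - 1)))) * a y ^ (m - 1))) (at y)"
      by (simp add: Q1_def[abs_def])
    then show ?thesis
      by (rule DERIV_cong) (use m3 in \<open>simp add: Q2_def diff_diff_left numeral_2_eq_2 mult.commute\<close>)
  qed
  have ab0: "a y \<ge> 0" "b y \<ge> 0" "b y \<le> 1" for y by (auto simp: a_def b_def)
  have a1: "a y \<le> 1" if "b y \<noteq> 0" for y
  proof (rule ccontr)
    assume "\<not> a y \<le> 1"
    then have "a y ^ m \<ge> 1" by (intro one_le_power) auto
    then show False using that by (simp add: b_def)
  qed
  have end0: "a y * b y = 0" if "y \<le> 0 \<or> y \<ge> 1" for y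
    using that
  proof
    assume "y \<ge> 1"
    then have "a y ^ m \<ge> 1" by (intro one_le_power) (auto simp: a_def)
    then show ?thesis by (simp add: b_def)
  qed (simp add: a_def)
  \<comment> \<open>In terms of w, which lies between 0 and 1, the first derivative is a multiple of
    w^(m - 1) and the second is bounded by a multiple of w^(m - 2).\<close>
  define w where "w y = a y * b y" for y
  have w: "0 \<le> w y" "w y \<le> 1" for y
  proof -
    show "0 \<le> w y" using ab0 by (simp add: w_def)
    show "w y \<le> 1" using ab0[of y] a1[of y] by (cases "b y = 0") (auto simp: w_def intro!: mult_le_one)
  qed
  have Q1w: "Q1 y = (real m)\<^sup>2 * w y ^ (m - 1)" for y by (simp add: Q1_def w_def power_mult_distrib)
  have wp: "w y ^ (m - 2) \<le> Q1 y powr (1 / p)" for y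
  proof (cases "w y = 0")
    case True
    then show ?thesis using m3 by (simp add: zero_power)
  next
    case False
    then have w0: "w y > 0" using w(1)[of y] by simp
    have "w y ^ (m - 2) = w y powr (real m - 2)" using w0 m3 by (simp add: powr_realpow[symmetric] of_nat_diff)
    also have "\<dots> \<le> w y powr ((real m - 1) / p)" using w0 w(2)[of y] mp' by (intro powr_mono') auto
    also have "\<dots> = (w y ^ (m - 1)) powr (1 / p)"
      using w0 m3 by (simp add: powr_realpow[symmetric] of_nat_diff powr_powr)
    also have "\<dots> \<le> Q1 y powr (1 / p)"
    proof (rule powr_mono2)
      have "1 * w y ^ (m - 1) \<le> (real m)\<^sup>2 * w y ^ (m - 1)" using m3 w0 by (intro mult_right_mono) auto
      then show "w y ^ (m - 1) \<le> Q1 y" by (simp add: Q1w)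
    qed (use p w0 in auto)
    finally show ?thesis .
  qed
  define C where "C = (real m)\<^sup>2 * (real (m - 1) * (1 + real m))"
  have m2: "(real m)\<^sup>2 \<le> C"
  proof -
    have "(real m)\<^sup>2 * 1 \<le> (real m)\<^sup>2 * (real (m - 1) * (1 + real m))"
      using m3 by (intro mult_left_mono mult_ge1_I) auto
    then show ?thesis by (simp add: C_def)
  qed
  have C0: "C > 0" using m2 m3 by (auto intro: less_le_trans[rotated])
  have Q1le: "Q1 y \<le> C * w y ^ (m - 2)" for y
  proof -
    have "w y ^ (m - 1) \<le> w y ^ (m - 2)" using w[of y] by (intro power_decreasing) auto
    then show ?thesis unfolding Q1w using m2 w[of y] C0 by (intro mult_mono) auto
  qed
  have Q2le: "\<bar>Q2 y\<bar> \<le> C * w y ^ (m - 2)" for y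
  proof (cases "b y = 0")
    case True
    then show ?thesis using m3 by (simp add: Q2_def w_def zero_power)
  next
    case False
    note a1 = a1[OF False]
    have e: "b y ^ (m - 1) = b y ^ (m - 2) * b y" "a y ^ (m - 1) = a y ^ (m - 2) * a y"
      using m3 by (simp_all add: power_Suc[symmetric] mult.commute Suc_diff_Suc numeral_2_eq_2 del: power_Suc)
    have "Q2 y = (real m)\<^sup>2 * (real (m - 1) * w y ^ (m - 2) * (b y - real m * (a y * a y ^ (m - 1))))"
      unfolding Q2_def w_def power_mult_distrib e(1) by (subst e(2)) (simp add: algebra_simps)
    then have "\<bar>Q2 y\<bar> = (real m)\<^sup>2 * (real (m - 1) * w y ^ (m - 2) * \<bar>b y - real m * (a y * a y ^ (m - 1))\<bar>)"
      using w[of y] by (simp add: abs_mult)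
    also have "\<dots> \<le> (real m)\<^sup>2 * (real (m - 1) * w y ^ (m - 2) * (1 + real m))"
    proof (intro mult_left_mono)
      have "0 \<le> a y * a y ^ (m - 1)" "a y * a y ^ (m - 1) \<le> 1"
        using ab0[of y] a1 by (auto intro!: mult_le_one power_le_one)
      then have "0 \<le> real m * (a y * a y ^ (m - 1))" "real m * (a y * a y ^ (m - 1)) \<le> real m * 1"
        by (auto intro!: mult_left_mono simp del: mult_1_right)
      then show "\<bar>b y - real m * (a y * a y ^ (m - 1))\<bar> \<le> 1 + real m" using ab0[of y] by linarith
    qed (use w[of y] in auto)
    finally show ?thesis by (simp add: C_def mult_ac)
  qed
  have Cwp: "C * w y ^ (m - 2) \<le> C * Q1 y powr (1 / p)" for y using wp[of y] C0 by (intro mult_left_mono) auto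
  have "w y ^ (m - 2) \<le> 1" for y using w[of y] by (intro power_le_one) auto
  then have Cw1: "C * w y ^ (m - 2) \<le> C" for y using C0 by (simp add: mult_le_cancel_left1)
  show ?thesis
  proof (rule that[of Q Q1 Q2 C, OF dQ dQ1])
    have "continuous_on UNIV a" unfolding a_def by (intro continuous_intros)
    moreover then have "continuous_on UNIV b" unfolding b_def by (intro continuous_intros)
    ultimately show "continuous_on UNIV Q2" unfolding Q2_def by (intro continuous_intros)
    show "0 \<le> Q y" for y using ab0[of y] by (auto simp: Q_def power_le_one)
    show "Q y = 0" if "y \<le> 0" for y using that m3 by (simp add: Q_def b_def a_def max_def zero_power)
    show "Q y = 1" if "y \<ge> 1" for y
      using end0[of y] that m3 by (simp add: Q_def a_def zero_power)
    show "0 \<le> Q1 y" for y using w[of y] by (simp add: Q1w)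
    show "Q1 y = 0" if "y \<le> 0 \<or> y \<ge> 1" for y using end0[OF that] m3 by (simp add: Q1w w_def zero_power)
    show "C > 0" by (rule C0)
    show "Q1 y \<le> C * Q1 y powr (1 / p)" for y
      using Q1le[of y] Cwp[of y] by linarith
    show "\<bar>Q2 y\<bar> \<le> C * Q1 y powr (1 / p)" for y
      using Q2le[of y] Cwp[of y] by linarith
    show "\<bar>Q2 y\<bar> \<le> C" for y using Q2le[of y] Cw1[of y] by linarith
  qed
qed

section \<open>Dyadic scales, conformal time and the exponents\<close>

lemma dyadic_exists:
  fixes X :: real
  assumes "X \<ge> 1"
  obtains j where "2 ^ j \<le> X" "X < 2 ^ Suc j"
proof -
  obtain n where "X < 2 ^ n" using real_arch_pow[of 2 X] by auto
  define m where "m = (LEAST n. X < 2 ^ n)"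
  have m: "X < 2 ^ m" unfolding m_def by (rule LeastI[of "\<lambda>n. X < 2 ^ n", OF \<open>X < 2 ^ n\<close>])
  have "m \<noteq> 0" using m assms by (intro notI) simp
  then obtain j where j: "m = Suc j" by (cases m) auto
  have "\<not> X < 2 ^ j" using not_less_Least[of j "\<lambda>n. X < 2 ^ n"] j by (simp add: m_def)
  then show ?thesis using that[of j] m j by simp
qed

lemma A_speed_eq:
  assumes "0 \<le> k" "k < 1" "1 \<le> t"
  shows "A_speed k t = (t powr (1 - k) - 1) / (1 - k)"
proof -
  have "((\<lambda>s. s powr (- k)) has_integral (t powr (1 - k) / (1 - k) - 1 powr (1 - k) / (1 - k))) {1..t}"
  proof (rule fundamental_theorem_of_calculus[OF assms(3)])
    fix s assume s: "s \<in> {1..t}"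
    have "((\<lambda>s. s powr (1 - k)) has_real_derivative (1 - k) * s powr (1 - k - 1)) (at s)"
      using s by (intro has_real_derivative_powr) auto
    then have "((\<lambda>s. s powr (1 - k) / (1 - k)) has_real_derivative ((1 - k) * s powr (1 - k - 1)) / (1 - k)) (at s)"
      by (rule DERIV_cdivide)
    then have "((\<lambda>s. s powr (1 - k) / (1 - k)) has_real_derivative s powr (- k)) (at s)" using assms by simp
    then show "((\<lambda>s. s powr (1 - k) / (1 - k)) has_vector_derivative s powr (- k)) (at s within {1..t})"
      by (simp add: has_real_derivative_iff_has_vector_derivative has_vector_derivative_at_within)
  qed
  then show ?thesis by (simp add: A_speed_def integral_unique diff_divide_distrib)
qed

text \<open>\<open>crit\<close> is the quadratic equation for the critical exponent, divided by p
  and arranged so that p - 1 times the decay rate stands alone.\<close>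

locale critical_exponents =
  fixes k \<mu> p R :: real and N :: nat
  assumes k: "0 \<le> k" "k < 1" and p: "p > 1" and R: "R > 0" and N: "N \<ge> 1"
    and crit: "(p - 1) * ((real N - 1 + (\<mu> - k) / (1 - k)) / 2) = 1 + 2 * k / (1 - k) + 1 / p"
begin

text \<open>\<open>sig\<close> is the conformal time, in which the wave operator has speed 1 and damping \<open>nu / sig\<close>; \<open>hh\<close> is the
  decay rate of free waves, and \<open>bet\<close> the homogeneity of the self-similar test functions.\<close>

definition "kap = 1 - k"
definition "nu = (\<mu> - k) / kap"
definition "hh = (real N - 1 + nu) / 2"
definition "bet = hh - 1 / p"
text \<open>\<mu> is the exponent of the integrating factor of the damping, and
  \<open>- kap * bet\<close> that of the lower bound for the summed test function; their product
  weights the source in \<open>X\<close>.\<close>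

definition "wt = \<mu> - kap * bet"
definition "sig t = t powr kap / kap"
definition "rho t = A_speed k t + R"

lemma kap: "kap > 0" "kap \<le> 1" using k by (auto simp: kap_def)

lemma crit': "kap * hh * (p - 1) = 1 + k + kap / p"
proof -
  have "(p - 1) * hh = 1 + 2 * k / kap + 1 / p" using crit by (simp add: hh_def nu_def kap_def)
  then have "kap * ((p - 1) * hh) = kap * (1 + 2 * k / kap + 1 / p)" by simp
  also have "\<dots> = kap + 2 * k + kap / p" using kap by (simp add: algebra_simps)
  also have "\<dots> = 1 + k + kap / p" by (simp add: kap_def)
  finally show ?thesis by (simp add: mult_ac)
qed

text \<open>Criticality gives \<open>(p - 1) * bet = 2 * k / kap + 2 / p\<close>. Positivity makes
  \<open>l powr bet\<close> increasing in l, which \<open>test_function_lower\<close>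
  exploits.\<close>

lemma bet_pos: "bet > 0"
proof -
  have "(p - 1) * bet = (p - 1) * hh - (p - 1) / p" by (simp add: bet_def right_diff_distrib)
  also have "(p - 1) * hh = 1 + 2 * k / kap + 1 / p" using crit by (simp add: hh_def nu_def kap_def)
  also have "1 + 2 * k / kap + 1 / p - (p - 1) / p = 2 * k / kap + 2 / p"
    using p by (simp add: diff_divide_distrib)
  finally have "(p - 1) * bet > 0" using k kap p by (simp add: add_nonneg_pos)
  then show ?thesis using p by (simp add: zero_less_mult_iff)
qed

text \<open>Here criticality is spent. On the left stand the exponents of t from the residual,
  \<open>\<mu> - 1\<close>, from the kernel, \<open>- k - kap * hh\<close>, and from the shell
  volume raised to the power 1 - 1 / p. On the right, \<open>wt / p\<close> belongs to the source,
  and the rest becomes \<open>t powr (- 1)\<close> when raised to the conjugate power.\<close>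

lemma exponent_balance:
  "\<mu> - 1 - k - kap * hh + kap * (real N - 1) * (1 - 1 / p) = wt / p - (1 - 1 / p)"
proof -
  have mu: "\<mu> = kap * (2 * hh - real N + 1) + k" using kap by (simp add: hh_def nu_def field_simps)
  have "kap * hh * p = kap * hh + 1 + k + kap / p" using crit' by (simp add: algebra_simps)
  then have kh: "kap * hh = kap * hh / p + (1 + k) / p + kap / p / p" using p by (simp add: field_simps)
  define q where "q = 1 / p"
  have kh': "kap * hh = kap * hh * q + (1 + k) * q + kap * q * q" using kh by (simp add: q_def)
  have wt: "wt / p = (\<mu> - kap * (hh - q)) * q" by (simp add: wt_def bet_def q_def)
  \<comment> \<open>Stated for free variables, with q in place of 1 / p, so that the identity is
    polynomial.\<close>
  have "M - 1 - c - K * H + K * (n - 1) * (1 - q) = (M - K * (H - q)) * q - (1 - q)"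
    if "M = K * (2 * H - n + 1) + c" "K * H = K * H * q + (1 + c) * q + K * q * q" for M K H n c :: real
  proof -
    have "M - 1 - c - K * H + K * (n - 1) * (1 - q) = K * H - 1 - K * (n - 1) * q"
      unfolding that(1) by (simp add: algebra_simps)
    moreover have "(M - K * (H - q)) * q - (1 - q) = (K * H * q + (1 + c) * q + K * q * q) - K * (n - 1) * q - 1"
      unfolding that(1) by (simp add: algebra_simps)
    ultimately show ?thesis using that(2) by linarith
  qed
  from this[OF mu kh'] show ?thesis by (simp only: wt q_def[symmetric])
qed

lemma rho_eq: "1 \<le> t \<Longrightarrow> rho t = sig t - 1 / kap + R"
  using A_speed_eq[OF k, of t] by (simp add: rho_def sig_def kap_def diff_divide_distrib)

lemma powr_kap_ge_1: "1 \<le> t \<Longrightarrow> 1 \<le> t powr kap"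
  using kap by (intro ge_one_powr_ge_zero) auto

lemma rho_pos: "1 \<le> t \<Longrightarrow> rho t > 0"
  using powr_kap_ge_1[of t] kap R by (simp add: rho_eq sig_def) (smt (verit) divide_right_mono)

lemma rho_le: "1 \<le> t \<Longrightarrow> rho t \<le> (1 / kap + R) * t powr kap"
proof -
  assume t: "1 \<le> t"
  have "R * 1 \<le> R * t powr kap" using powr_kap_ge_1[OF t] R by (intro mult_left_mono) auto
  moreover have "1 / kap \<ge> 0" using kap by simp
  moreover have "(1 / kap + R) * t powr kap = sig t + R * t powr kap" by (simp add: sig_def distrib_right)
  ultimately show ?thesis unfolding rho_eq[OF t] by linarith
qed

lemma sig_deriv: "t > 0 \<Longrightarrow> (sig has_real_derivative t powr (- k)) (at t)"
proof -
  assume t: "t > 0"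
  have "((\<lambda>s. s powr kap) has_real_derivative kap * t powr (kap - 1)) (at t)"
    using t by (intro has_real_derivative_powr)
  from DERIV_cdivide[OF this, of kap] show ?thesis using kap by (simp add: sig_def[abs_def] kap_def)
qed

end

text \<open>One decaying profile \<open>y\<close> and one cutoff \<open>Q\<close> are fixed before
  any solution is considered, so that the later constants depend neither on u nor on
  \<epsilon>.\<close>

locale critical_problem = critical_exponents +
  fixes y y' Q Q1 Q2 :: "real \<Rightarrow> real" and Cq :: real
  assumes y: "\<And>z. z > 0 \<Longrightarrow> y z > 0"
    "\<And>z. z > 0 \<Longrightarrow> (y has_real_derivative y' z) (at z)"
    "\<And>z. z > 0 \<Longrightarrow> (y' has_real_derivative y z - nu / z * y' z) (at z)"
    "\<And>z. z > 0 \<Longrightarrow> y' z \<le> 0"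
    "\<And>z0. z0 > 0 \<Longrightarrow> \<exists>C>0. \<forall>z\<ge>z0. y z + \<bar>y' z\<bar> \<le> C * z powr (- nu / 2) * exp (- z)"
    and Q: "\<And>y. (Q has_real_derivative Q1 y) (at y)" "\<And>y. (Q1 has_real_derivative Q2 y) (at y)"
    "continuous_on UNIV Q2" "\<And>y. 0 \<le> Q y" "\<And>y. y \<le> 0 \<Longrightarrow> Q y = 0" "\<And>y. y \<ge> 1 \<Longrightarrow> Q y = 1"
    "\<And>y. 0 \<le> Q1 y" "\<And>y. y \<le> 0 \<or> y \<ge> 1 \<Longrightarrow> Q1 y = 0"
    "Cq > 0" "\<And>y. Q1 y \<le> Cq * Q1 y powr (1 / p)" "\<And>y. \<bar>Q2 y\<bar> \<le> Cq * Q1 y powr (1 / p)"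
    "\<And>y. \<bar>Q2 y\<bar> \<le> Cq"
begin

definition "Y l t = y (l * sig t)"
definition "Y' l t = l * t powr (- k) * y' (l * sig t)"

lemma sig_pos: "t > 0 \<Longrightarrow> sig t > 0" using kap by (simp add: sig_def)

lemma Y_pos: "l > 0 \<Longrightarrow> t > 0 \<Longrightarrow> Y l t > 0"
  unfolding Y_def by (intro y mult_pos_pos sig_pos)

lemma Y'_nonpos: "l > 0 \<Longrightarrow> t > 0 \<Longrightarrow> Y' l t \<le> 0"
  unfolding Y'_def using y(4)[of "l * sig t"] sig_pos[of t] by (intro mult_nonneg_nonpos) auto

lemma Y_deriv:
  assumes "l > 0" "t > 0"
  shows "(Y l has_real_derivative Y' l t) (at t)"
proof -
  have "((\<lambda>t. l * sig t) has_real_derivative l * t powr (- k)) (at t)"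
    by (intro DERIV_cmult sig_deriv assms)
  from DERIV_chain2[OF y(2)[of "l * sig t"] this]
  show ?thesis using assms sig_pos[of t] by (simp add: Y_def[abs_def] Y'_def mult.commute)
qed

text \<open>The damping \<mu> / t arises as k / t, from differentiating \<open>t powr (- k)\<close>,
  plus (\<mu> - k) / t, which is \<open>nu / z\<close> times the speed of
  \<open>z = l * sig t\<close>. This is what fixes \<open>nu\<close>.\<close>

lemma Y'_deriv:
  assumes l: "l > 0" and t: "t > 0"
  shows "(Y' l has_real_derivative (l\<^sup>2 * t powr (- 2 * k)) * Y l t - \<mu> / t * Y' l t) (at t)"
proof -
  let ?z = "l * sig t"
  have z: "?z > 0" using l sig_pos[OF t] by simp
  have d1: "((\<lambda>t. l * sig t) has_real_derivative l * t powr (- k)) (at t)"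
    by (intro DERIV_cmult sig_deriv t)
  have d2: "((\<lambda>t. l * t powr (- k)) has_real_derivative l * (- k * t powr (- k - 1))) (at t)"
    using t by (intro DERIV_cmult has_real_derivative_powr)
  have "(Y' l has_real_derivative (l * (- k * t powr (- k - 1))) * y' ?z
     + ((y ?z - nu / ?z * y' ?z) * (l * t powr (- k))) * (l * t powr (- k))) (at t)"
    unfolding Y'_def[abs_def] by (intro DERIV_mult d2 DERIV_chain2[OF y(3)[OF z] d1])
  then show ?thesis
  proof (rule DERIV_cong)
    define P where "P = t powr (- k)"
    have e1: "t powr (- k - 1) = P / t" using t by (simp add: P_def powr_diff)
    have e2: "t powr (- 2 * k) = P * P" using t by (simp add: P_def powr_add[symmetric])
    have "t powr kap = P * t" using t powr_add[of t 1 "- k"] by (simp add: P_def kap_def)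
    then have e3: "sig t = P * t / kap" by (simp add: sig_def)
    have P: "P > 0" using t by (simp add: P_def)
    have "nu / ?z * (l * P) = nu * kap / t" unfolding e3 using l P t kap by (simp add: field_simps)
    also have "\<dots> = (\<mu> - k) / t" using kap by (simp add: nu_def)
    finally have e4: "nu / ?z * (l * P) = (\<mu> - k) / t" .
    have "(l * (- k * t powr (- k - 1))) * y' ?z + ((y ?z - nu / ?z * y' ?z) * (l * t powr (- k))) * (l * t powr (- k))
      = - k / t * (l * P) * y' ?z + (l * P) * (l * P) * y ?z - (nu / ?z * (l * P)) * y' ?z * (l * P)"
      unfolding e1 P_def[symmetric] by (simp add: algebra_simps)
    also have "\<dots> = (l\<^sup>2 * t powr (- 2 * k)) * Y l t - \<mu> / t * Y' l t"
      unfolding e4 e2 Y_def Y'_def P_def[symmetric] by (simp add: power2_eq_square diff_divide_distrib algebra_simps)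
    finally show "(l * (- k * t powr (- k - 1))) * y' ?z + ((y ?z - nu / ?z * y' ?z) * (l * t powr (- k))) * (l * t powr (- k))
      = (l\<^sup>2 * t powr (- 2 * k)) * Y l t - \<mu> / t * Y' l t" .
  qed
qed

lemma y_antimono: "0 < z1 \<Longrightarrow> z1 \<le> z2 \<Longrightarrow> y z2 \<le> y z1"
proof (rule DERIV_nonpos_imp_nonincreasing[of z1 z2 y])
  fix z assume "0 < z1" "z1 \<le> z"
  then show "\<exists>d. (y has_real_derivative d) (at z) \<and> d \<le> 0"
    using y(2,4)[of z] by (intro exI[of _ "y' z"]) auto
qed

text \<open>The decay exp(- l sig t) against the growth exp(l |x|) leaves exp(- l w), up to a
  constant, where w is the distance to the cone plus 1. Half of it is given up to trade the spatial
  power (1 + l |x|)^(- h) for z^(- h), so that all powers combine to z^(- hh). The value of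
  \<open>bet\<close> then leaves l^(1 - 1/p).\<close>

lemma kernel_bound:
  assumes NN: "N = CARD('n)"
  obtains C where "C > 0" "\<And>t l (x :: real ^ 'n::finite). 1 \<le> t \<Longrightarrow> 0 < l \<Longrightarrow> l \<le> 1 \<Longrightarrow> l * t powr kap \<ge> exp (- kap) \<Longrightarrow>
     norm x \<le> rho t \<Longrightarrow> l powr bet * (\<bar>Y' l t\<bar> + Y l t / t) * eig l x
        \<le> C * t powr (- k - kap * hh) * (l powr (1 - 1 / p) * exp (- (l * (rho t + 1 - norm x) / 2)))"
proof -
  define h where "h = (real N - 1) / 2"
  have h: "h \<ge> 0" using N by (simp add: h_def)
  define z0 where "z0 = exp (- kap) / kap"
  have z0: "z0 > 0" using kap by (simp add: z0_def)
  obtain C1 where C1: "C1 > 0" "\<And>z. z \<ge> z0 \<Longrightarrow> y z + \<bar>y' z\<bar> \<le> C1 * z powr (- nu / 2) * exp (- z)"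
    using y(5)[OF z0] by blast
  obtain C2 where C2: "C2 > 0" "\<And>r. r \<ge> 0 \<Longrightarrow> radial_series N (r\<^sup>2) \<le> C2 * (1 + r) powr (- (real N - 1) / 2) * exp r"
    using radial_series_le[OF N] by blast
  obtain C4 where C4: "C4 > 0" "\<And>x. x \<ge> 0 \<Longrightarrow> (1 + x) powr h \<le> C4 * exp (1 / 2 * x)"
    using powr_le_exp[of "1/2" h] by auto
  define C5 where "C5 = (1 + 1 / kap) powr h * C4"
  have "1 + 1 / kap > 0" using kap by (simp add: add_pos_pos)
  then have C5: "C5 > 0" using C4 unfolding C5_def by (intro mult_pos_pos) auto
  define C where "C = exp kap * C1 * C2 * C5 * exp (1 + R) * kap powr hh"
  have C: "C > 0" using C1 C2 C5 kap by (simp add: C_def)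
  have main: "l powr bet * (\<bar>Y' l t\<bar> + Y l t / t) * eig l x
        \<le> C * t powr (- k - kap * hh) * (l powr (1 - 1 / p) * exp (- (l * (rho t + 1 - norm x) / 2)))"
    if t: "1 \<le> t" and l: "0 < l" "l \<le> 1" and lt: "l * t powr kap \<ge> exp (- kap)" and nx: "norm x \<le> rho t"
    for t l and x :: "real ^ 'n"
  proof -
    define z where "z = l * sig t"
    define w where "w = rho t + 1 - norm x"
    have w: "w \<ge> 1" using nx by (simp add: w_def)
    have zz: "z \<ge> z0" unfolding z_def z0_def sig_def using lt kap by (simp add: divide_right_mono)
    have zpos: "z > 0" using zz z0 by simp
    \<comment> \<open>The lower bound on \<open>l * t powr kap\<close> bounds 1 / t by a multiple of
      the factor \<open>l * t powr (- k)\<close> of \<open>Y'\<close>, so that both terms obey one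
      estimate.\<close>
    have tk: "1 / t \<le> exp kap * (l * t powr (- k))"
    proof -
      have "t powr kap = t powr (- k) * t" using t powr_add[of t 1 "- k"] by (simp add: kap_def)
      then have "exp (- kap) \<le> l * t powr (- k) * t" using lt by (simp add: mult_ac)
      then have "exp kap * exp (- kap) \<le> exp kap * (l * t powr (- k) * t)" by (intro mult_left_mono) auto
      then have "1 \<le> exp kap * (l * t powr (- k)) * t" by (simp add: exp_add[symmetric] mult_ac)
      then show ?thesis using t by (simp add: divide_le_eq)
    qed
    have b1: "\<bar>Y' l t\<bar> + Y l t / t \<le> exp kap * (l * t powr (- k)) * (C1 * z powr (- nu / 2) * exp (- z))"
    proof -
      have ypos: "y z > 0" using y(1)[OF zpos] .
      have "Y l t / t \<le> (exp kap * (l * t powr (- k))) * y z"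
        using mult_right_mono[OF tk, of "y z"] ypos by (simp add: Y_def z_def)
      moreover have "\<bar>Y' l t\<bar> \<le> (exp kap * (l * t powr (- k))) * \<bar>y' z\<bar>"
      proof -
        have "\<bar>Y' l t\<bar> = 1 * (l * t powr (- k) * \<bar>y' z\<bar>)" using l by (simp add: Y'_def z_def abs_mult)
        also have "\<dots> \<le> exp kap * (l * t powr (- k) * \<bar>y' z\<bar>)" using kap l by (intro mult_right_mono) auto
        finally show ?thesis by (simp add: mult_ac)
      qed
      ultimately have "\<bar>Y' l t\<bar> + Y l t / t \<le> (exp kap * (l * t powr (- k))) * (y z + \<bar>y' z\<bar>)"
        by (simp add: distrib_left)
      also have "\<dots> \<le> (exp kap * (l * t powr (- k))) * (C1 * z powr (- nu / 2) * exp (- z))"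
        using l C1(2)[OF zz] by (intro mult_left_mono) auto
      finally show ?thesis .
    qed
    have zw: "z = l * norm x + l * (w - 1 + 1 / kap - R)"
      unfolding z_def w_def rho_eq[OF t] by (simp add: algebra_simps)
    have b2: "exp (- z) * exp (l * norm x) \<le> exp (1 + R) * exp (- (l * w))"
    proof -
      have "l * (1 + R) \<le> 1 * (1 + R)" using l R by (intro mult_right_mono) auto
      moreover have "l * (1 / kap) \<ge> 0" using l kap by simp
      ultimately have "- z + l * norm x \<le> 1 + R - l * w" unfolding zw by (simp add: algebra_simps)
      then have "exp (- z + l * norm x) \<le> exp (1 + R + - (l * w))" by simp
      then show ?thesis by (simp only: exp_add)
    qed
    \<comment> \<open>Since z is at most a constant times (1 + l |x|) (1 + l w), the only loss is a
      power of 1 + l w, which is absorbed into exp(l w / 2).\<close>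
    have b3: "(1 + l * norm x) powr (- h) \<le> C5 * z powr (- h) * exp (1 / 2 * (l * w))"
    proof -
      have lw: "l * w \<ge> 0" "l * norm x \<ge> 0" using l w by auto
      have "l * (1 / kap) \<le> 1 * (1 / kap)" using l kap by (intro mult_right_mono) auto
      moreover have "l * (1 + R) \<ge> 0" using l R by simp
      ultimately have "z \<le> l * norm x + l * w + 1 / kap" unfolding zw by (simp add: algebra_simps)
      also have "\<dots> \<le> (1 + 1 / kap) * ((1 + l * norm x) * (1 + l * w))"
      proof -
        have gen: "a + b + c \<le> (1 + c) * ((1 + a) * (1 + b))" if "a \<ge> 0" "b \<ge> 0" "c \<ge> 0" for a b c :: real
        proof -
          have "(1 + c) * ((1 + a) * (1 + b)) = a + b + c + (1 + a * b + c * a + c * b + c * (a * b))"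
            by (simp add: algebra_simps)
          moreover have "0 \<le> 1 + a * b + c * a + c * b + c * (a * b)" using that by (intro add_nonneg_nonneg mult_nonneg_nonneg) auto
          ultimately show ?thesis by linarith
        qed
        show ?thesis by (rule gen) (use lw kap in auto)
      qed
      finally have "z powr h \<le> ((1 + 1 / kap) * ((1 + l * norm x) * (1 + l * w))) powr h"
        using zpos h by (intro powr_mono2) auto
      also have "\<dots> = (1 + 1 / kap) powr h * (1 + l * norm x) powr h * (1 + l * w) powr h"
        by (simp add: powr_mult)
      also have "\<dots> \<le> (1 + 1 / kap) powr h * (1 + l * norm x) powr h * (C4 * exp (1 / 2 * (l * w)))"
        using C4(2)[OF lw(1)] by (intro mult_left_mono) auto
      also have "\<dots> = C5 * (1 + l * norm x) powr h * exp (1 / 2 * (l * w))" by (simp add: C5_def mult_ac)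
      finally have zh: "z powr h \<le> C5 * (1 + l * norm x) powr h * exp (1 / 2 * (l * w))" .
      have p1: "(1 + l * norm x) powr h > 0" "z powr h > 0" using lw zpos by auto
      have gen: "inverse a \<le> c * inverse b * e" if "b \<le> c * a * e" "a > 0" "b > 0" for a b c e :: real
        using that by (simp add: field_simps)
      show ?thesis unfolding powr_minus by (rule gen[OF zh p1])
    qed
    have e: "eig l x \<le> C2 * (C5 * z powr (- h) * exp (1 / 2 * (l * w))) * exp (l * norm x)"
    proof -
      have "eig l x = radial_series N ((l * norm x)\<^sup>2)" by (simp add: eig_def NN power_mult_distrib)
      also have "\<dots> \<le> C2 * (1 + l * norm x) powr (- h) * exp (l * norm x)"
        using C2(2)[of "l * norm x"] l by (simp add: h_def minus_divide_left)
      also have "\<dots> \<le> C2 * (C5 * z powr (- h) * exp (1 / 2 * (l * w))) * exp (l * norm x)"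
        using b3 C2(1) by (intro mult_right_mono mult_left_mono) auto
      finally show ?thesis .
    qed
    have "l powr bet * (\<bar>Y' l t\<bar> + Y l t / t) * eig l x \<le>
      l powr bet * (exp kap * (l * t powr (- k)) * (C1 * z powr (- nu / 2) * exp (- z)))
        * (C2 * (C5 * z powr (- h) * exp (1 / 2 * (l * w))) * exp (l * norm x))"
    proof (intro mult_mono mult_left_mono b1 e)
      show "0 \<le> eig l x" using eig_ge_1[of l x] by simp
      have "Y l t > 0" using t l by (intro Y_pos) auto
      then show "0 \<le> \<bar>Y' l t\<bar> + Y l t / t" using t by simp
    qed (use l C1 in auto)
    also have "\<dots> = (exp kap * C1 * C2 * C5) * (l powr bet * l) * t powr (- k) * (z powr (- nu / 2) * z powr (- h))
        * exp (1 / 2 * (l * w)) * (exp (- z) * exp (l * norm x))" by (simp add: mult_ac)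
    also have "\<dots> \<le> (exp kap * C1 * C2 * C5) * (l powr bet * l) * t powr (- k) * (z powr (- nu / 2) * z powr (- h))
        * exp (1 / 2 * (l * w)) * (exp (1 + R) * exp (- (l * w)))"
      using b2 C1 C2 C5 l by (intro mult_left_mono) auto
    also have "z powr (- nu / 2) * z powr (- h) = z powr (- hh)"
    proof -
      have "- nu / 2 + - h = - hh" unfolding h_def hh_def by (simp add: field_simps)
      then show ?thesis unfolding powr_add[symmetric] by simp
    qed
    also have "z powr (- hh) = l powr (- hh) * (t powr (- kap * hh) * kap powr hh)"
    proof -
      have "(1 / kap) powr (- hh) = kap powr hh" using kap by (simp add: powr_divide powr_minus)
      moreover have "(t powr kap) powr (- hh) = t powr (- kap * hh)" by (simp add: powr_powr)
      moreover have "z = l * (t powr kap * (1 / kap))" by (simp add: z_def sig_def)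
      ultimately show ?thesis by (simp only: powr_mult)
    qed
    also have "l powr bet * l = l powr (bet + 1)" using l by (simp add: powr_add)
    also have "(exp kap * C1 * C2 * C5) * l powr (bet + 1) * t powr (- k) * (l powr (- hh) * (t powr (- kap * hh) * kap powr hh))
        * exp (1 / 2 * (l * w)) * (exp (1 + R) * exp (- (l * w)))
      = C * (t powr (- k) * t powr (- kap * hh)) * ((l powr (bet + 1) * l powr (- hh)) * (exp (1 / 2 * (l * w)) * exp (- (l * w))))"
      by (simp add: C_def mult_ac)
    also have "t powr (- k) * t powr (- kap * hh) = t powr (- k - kap * hh)" by (simp add: powr_add[symmetric])
    also have "l powr (bet + 1) * l powr (- hh) = l powr (1 - 1 / p)" by (simp add: powr_add[symmetric] bet_def)
    also have "exp (1 / 2 * (l * w)) * exp (- (l * w)) = exp (- (l * w / 2))" by (simp add: exp_add[symmetric])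
    finally show ?thesis by (simp add: w_def)
  qed
  show ?thesis by (rule that[OF C]) (rule main)
qed

text \<open>All terms are nonnegative, so a single one is kept: the frequency whose inverse 2^j is
  of the size of \<open>t powr kap\<close>. For it \<open>l * sig t \<le> 2 / kap\<close>, which
  bounds \<open>Y l t\<close> from below by a constant.\<close>

lemma test_function_lower:
  fixes x :: "real ^ 'n"
  assumes t: "1 \<le> t" and J: "t powr kap < 2 ^ Suc J"
  shows "y (2 / kap) * t powr (- kap * bet) \<le> (\<Sum>j\<le>J. ((1/2) ^ j) powr bet * (Y ((1/2) ^ j) t * eig ((1/2) ^ j) x))"
proof -
  obtain j where j: "2 ^ j \<le> t powr kap" "t powr kap < 2 ^ Suc j"
    using dyadic_exists[OF powr_kap_ge_1[OF t]] by blast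
  have "(2::real) ^ j < 2 ^ Suc J" using j(1) J by linarith
  then have jJ: "j \<le> J" by (subst (asm) power_strict_increasing_iff) auto
  define l :: real where "l = (1/2) ^ j"
  have l: "l > 0" by (simp add: l_def)
  have lt: "l * t powr kap \<le> 2" "l \<ge> t powr (- kap)"
    using j t by (simp_all add: l_def power_one_over powr_minus divide_simps)
  have "y (2 / kap) \<le> Y l t"
    unfolding Y_def sig_def using l t lt kap by (intro y_antimono) (auto simp: divide_right_mono)
  also have "\<dots> \<le> Y l t * eig l x"
    using mult_left_mono[OF eig_ge_1[of l x], of "Y l t"] Y_pos[OF l, of t] t by simp
  finally have a: "y (2 / kap) \<le> Y l t * eig l x" .
  have b: "t powr (- kap * bet) \<le> l powr bet"
    using powr_mono2[of bet "t powr (- kap)" l] lt(2) bet_pos by (simp add: powr_powr)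
  have "y (2 / kap) * t powr (- kap * bet) \<le> (Y l t * eig l x) * l powr bet"
    using a b y(1)[of "2 / kap"] kap by (intro mult_mono) (auto intro: order_trans[OF less_imp_le])
  also have "\<dots> \<le> (\<Sum>j\<le>J. ((1/2) ^ j) powr bet * (Y ((1/2) ^ j) t * eig ((1/2) ^ j) x))"
  proof -
    have "((1/2) ^ j) powr bet * (Y ((1/2) ^ j) t * eig ((1/2) ^ j) x)
        \<le> (\<Sum>j\<le>J. ((1/2) ^ j) powr bet * (Y ((1/2) ^ j) t * eig ((1/2) ^ j) x))"
    proof (rule member_le_sum)
      fix i
      have "Y ((1/2) ^ i) t > 0" using t by (intro Y_pos) auto
      then show "0 \<le> ((1/2) ^ i) powr bet * (Y ((1/2) ^ i) t * eig ((1/2) ^ i) x)"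
        using eig_ge_1[of "(1/2) ^ i" x] by (intro mult_nonneg_nonneg) auto
    qed (use jJ in auto)
    then show ?thesis by (simp add: l_def mult_ac)
  qed
  finally show ?thesis .
qed

end

section \<open>The tested equations\<close>

lemma set_integrable_mult_continuous:
  fixes f c :: "real \<Rightarrow> real"
  assumes f: "set_integrable lborel {a..b} f" and c: "continuous_on {a..b} c"
  shows "set_integrable lborel {a..b} (\<lambda>t. c t * f t)"
proof -
  have "bounded (c ` {a..b})" by (intro compact_imp_bounded compact_continuous_image c compact_Icc)
  then obtain B where B: "\<And>t. t \<in> {a..b} \<Longrightarrow> \<bar>c t\<bar> \<le> B" by (fastforce simp: bounded_iff)
  have fm: "(\<lambda>t. indicator {a..b} t * f t) \<in> borel_measurable lborel"
    using f by (simp add: set_integrable_def borel_measurable_integrable)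
  have cm: "(\<lambda>t. indicator {a..b} t * c t) \<in> borel_measurable lborel"
    using set_integrable_continuous_interval(1)[OF c] by (simp add: set_integrable_def borel_measurable_integrable)
  have e: "indicator {a..b} t *\<^sub>R (c t * f t) = (indicator {a..b} t * c t) * (indicator {a..b} t * f t)" for t
    by (simp add: indicator_def)
  have i: "set_integrable lborel {a..b} (\<lambda>t. B * f t)" using f by simp
  show ?thesis
  proof (rule set_integrable_bound[OF i])
    show "set_borel_measurable lborel {a..b} (\<lambda>t. c t * f t)"
      unfolding set_borel_measurable_def e using fm cm by (rule borel_measurable_times[rotated])
    have "norm (c t * f t) \<le> norm (B * f t)" if "t \<in> {a..b}" for t
    proof -
      have "\<bar>c t\<bar> * \<bar>f t\<bar> \<le> \<bar>B\<bar> * \<bar>f t\<bar>" using B[OF that] by (intro mult_right_mono) auto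
      then show ?thesis by (simp add: abs_mult)
    qed
    then show "AE t in lborel. t \<in> {a..b} \<longrightarrow> norm (c t * f t) \<le> norm (B * f t)" by simp
  qed
qed

lemma second_order_remainder_le:
  fixes f f1 f2 :: "real \<Rightarrow> real"
  assumes f: "\<And>x. (f has_real_derivative f1 x) (at x)" "\<And>x. (f1 has_real_derivative f2 x) (at x)"
    and C: "\<And>x. \<bar>f2 x\<bar> \<le> C"
  shows "\<bar>f (x + h) - f x - h * f1 x\<bar> \<le> C * h\<^sup>2"
proof -
  have mvt: "\<exists>z. \<bar>z - a\<bar> \<le> \<bar>d\<bar> \<and> g (a + d) - g a = d * g' z"
    if g: "\<And>x. (g has_real_derivative g' x) (at x)" for g g' :: "real \<Rightarrow> real" and a d
  proof (cases d "0::real" rule: linorder_cases)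
    case less
    obtain z where "a + d < z" "z < a" "g a - g (a + d) = (a - (a + d)) * g' z"
      using MVT2[of "a + d" a g g'] g less by auto
    then show ?thesis by (intro exI[of _ z]) (auto simp: algebra_simps)
  next
    case greater
    obtain z where "a < z" "z < a + d" "g (a + d) - g a = ((a + d) - a) * g' z"
      using MVT2[of a "a + d" g g'] g greater by auto
    then show ?thesis by (intro exI[of _ z]) auto
  qed auto
  obtain z where z: "\<bar>z - x\<bar> \<le> \<bar>h\<bar>" "f (x + h) - f x = h * f1 z" using mvt[of f f1 x h] f(1) by blast
  obtain w where w: "f1 (x + (z - x)) - f1 x = (z - x) * f2 w" using mvt[of f1 f2 x "z - x"] f(2) by blast
  have "f1 z - f1 x = (z - x) * f2 w" using w by simp
  then have "f (x + h) - f x - h * f1 x = h * ((z - x) * f2 w)" using z(2) by (simp add: right_diff_distrib[symmetric])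
  also have "\<bar>\<dots>\<bar> = \<bar>h\<bar> * (\<bar>z - x\<bar> * \<bar>f2 w\<bar>)" by (simp add: abs_mult)
  also have "\<dots> \<le> \<bar>h\<bar> * (\<bar>h\<bar> * C)" by (intro mult_left_mono mult_mono z C) auto
  finally show ?thesis by (simp add: power2_eq_square mult_ac)
qed

lemma harmonic_sum_le: "(\<Sum>j\<le>M. 1 / (1 + real j)) \<le> 1 + ln (1 + real M)"
proof (induction M)
  case (Suc M)
  have "ln ((1 + real M) / (2 + real M)) \<le> (1 + real M) / (2 + real M) - 1"
    by (intro ln_le_minus_one divide_pos_pos) auto
  also have "\<dots> = - (1 / (2 + real M))" by (simp add: field_simps)
  finally have "ln (1 + real M) - ln (2 + real M) \<le> - (1 / (2 + real M))" by (simp add: ln_div)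
  then show ?case using Suc by (simp add: add.commute)
qed simp

lemma powr_lower_bound:
  fixes a K D p :: real
  assumes "p > 1" "K > 0" "a \<ge> 0" "D \<ge> 0" "a \<le> K * D powr (1 / p)"
  shows "(a / K) powr p \<le> D"
proof -
  have "a / K \<le> D powr (1 / p)" using assms by (simp add: divide_le_eq mult.commute)
  then have "(a / K) powr p \<le> (D powr (1 / p)) powr p" using assms by (intro powr_mono2) auto
  also have "\<dots> = D" using assms by (simp add: powr_powr)
  finally show ?thesis .
qed

context critical_problem
begin

text \<open>\<open>t powr \<mu> * Y l t\<close> solves the adjoint equation, the power of t being
  the integrating factor of the damping. Hence \<open>resid\<close> consists exactly of the terms in
  which a derivative has hit the cutoff.\<close>

definition "zeta l x t = Q (x - ln t) * (t powr \<mu> * Y l t)"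
definition "zeta1 l x t = t powr \<mu> * (Q (x - ln t) * Y' l t - Q1 (x - ln t) / t * Y l t)"
definition "resid l x t = t powr \<mu> * (- 2 * (Q1 (x - ln t) / t) * Y' l t
   + (Q2 (x - ln t) + Q1 (x - ln t)) / t\<^sup>2 * Y l t - \<mu> * Q1 (x - ln t) / t\<^sup>2 * Y l t)"

lemma cutoff_derivs:
  assumes "t > 0"
  shows "((\<lambda>t. Q (x - ln t)) has_real_derivative - (Q1 (x - ln t) / t)) (at t)"
    and "((\<lambda>t. Q1 (x - ln t) / t) has_real_derivative - ((Q2 (x - ln t) + Q1 (x - ln t)) / t\<^sup>2)) (at t)"
proof -
  have d: "((\<lambda>t. x - ln t) has_real_derivative - (1 / t)) (at t)"
    using assms by (auto intro!: derivative_eq_intros)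
  show "((\<lambda>t. Q (x - ln t)) has_real_derivative - (Q1 (x - ln t) / t)) (at t)"
    using DERIV_chain2[OF Q(1) d] by simp
  have "((\<lambda>t. Q1 (x - ln t)) has_real_derivative - (Q2 (x - ln t) / t)) (at t)"
    using DERIV_chain2[OF Q(2) d] by simp
  from DERIV_divide[OF this DERIV_ident]
  have d2: "((\<lambda>t. Q1 (x - ln t) / t) has_real_derivative (- (Q2 (x - ln t) / t) * t - Q1 (x - ln t) * 1) / (t * t)) (at t)"
    using assms by simp
  obtain a c where ac: "Q2 (x - ln t) = a" "Q1 (x - ln t) = c" by blast
  show "((\<lambda>t. Q1 (x - ln t) / t) has_real_derivative - ((Q2 (x - ln t) + Q1 (x - ln t)) / t\<^sup>2)) (at t)"
    by (rule DERIV_cong[OF d2]) (unfold ac, use assms in \<open>simp add: power2_eq_square field_simps\<close>)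
qed

lemma zeta_deriv:
  assumes l: "l > 0" and t: "t > 0"
  shows "(zeta l x has_real_derivative zeta1 l x t + \<mu> / t * zeta l x t) (at t)"
proof -
  have p: "((\<lambda>t. t powr \<mu>) has_real_derivative \<mu> * t powr (\<mu> - 1)) (at t)"
    using t by (intro has_real_derivative_powr)
  have e: "t powr (\<mu> - 1) = t powr \<mu> / t" using t by (simp add: powr_diff)
  show ?thesis
    using DERIV_mult[OF cutoff_derivs(1)[OF t, of x] DERIV_mult[OF p Y_deriv[OF l t]]]
    unfolding zeta_def[abs_def]
    by (rule DERIV_cong) (simp add: zeta1_def e diff_divide_distrib algebra_simps)
qed

lemma zeta1_deriv:
  assumes l: "l > 0" and t: "t > 0"
  shows "(zeta1 l x has_real_derivative (l\<^sup>2 * t powr (- 2 * k)) * zeta l x t + resid l x t) (at t)"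
proof -
  have p: "((\<lambda>t. t powr \<mu>) has_real_derivative \<mu> * t powr (\<mu> - 1)) (at t)"
    using t by (intro has_real_derivative_powr)
  have e: "t powr (\<mu> - 1) = t powr \<mu> / t" using t by (simp add: powr_diff)
  note D = DERIV_mult[OF p DERIV_diff[OF DERIV_mult[OF cutoff_derivs(1)[OF t, of x] Y'_deriv[OF l t]]
     DERIV_mult[OF cutoff_derivs(2)[OF t, of x] Y_deriv[OF l t]]]]
  obtain c where c: "l\<^sup>2 * t powr (- 2 * k) = c" by blast
  show ?thesis
    using D unfolding zeta1_def[abs_def]
    by (rule DERIV_cong) (unfold zeta_def resid_def e c, use t in \<open>simp add: field_simps power2_eq_square\<close>)
qed

text \<open>Both derivatives of the cutoff are dominated by the p-th root of \<open>Q1\<close>.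
  After Hoelder this becomes \<open>Q1\<close> to the first power next to |u|^p, which is the
  integrand of X'.\<close>

lemma resid_le:
  assumes l: "l > 0" and t: "t \<ge> 1"
  shows "\<bar>resid l x t\<bar> \<le> Cq * (2 + \<bar>\<mu>\<bar>) * (t powr (\<mu> - 1) * Q1 (x - ln t) powr (1 / p) * (\<bar>Y' l t\<bar> + Y l t / t))"
proof -
  define q where "q = Q1 (x - ln t) powr (1 / p)"
  have Yp: "Y l t > 0" using l t by (intro Y_pos) auto
  have q1: "0 \<le> Q1 (x - ln t)" "Q1 (x - ln t) \<le> Cq * q" "\<bar>Q2 (x - ln t)\<bar> \<le> Cq * q"
    using Q by (auto simp: q_def)
  have e: "t powr (\<mu> - 1) = t powr \<mu> / t" using t by (simp add: powr_diff)
  have "resid l x t = t powr (\<mu> - 1) * (- 2 * Q1 (x - ln t) * Y' l t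
     + (Q2 (x - ln t) + Q1 (x - ln t) - \<mu> * Q1 (x - ln t)) * (Y l t / t))"
    unfolding resid_def e using t by (simp add: field_simps power2_eq_square)
  also have "\<bar>\<dots>\<bar> \<le> t powr (\<mu> - 1) * (2 * (Cq * q) * \<bar>Y' l t\<bar> + ((2 + \<bar>\<mu>\<bar>) * (Cq * q)) * (Y l t / t))"
  proof -
    have a: "\<bar>- 2 * Q1 (x - ln t) * Y' l t\<bar> \<le> 2 * (Cq * q) * \<bar>Y' l t\<bar>"
      using q1 by (simp add: abs_mult mult_right_mono)
    have "\<bar>\<mu> * Q1 (x - ln t)\<bar> \<le> \<bar>\<mu>\<bar> * (Cq * q)" using q1 by (simp add: abs_mult mult_left_mono)
    then have "\<bar>Q2 (x - ln t) + Q1 (x - ln t) - \<mu> * Q1 (x - ln t)\<bar> \<le> Cq * q + Cq * q + \<bar>\<mu>\<bar> * (Cq * q)"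
      using q1 by linarith
    also have "\<dots> = (2 + \<bar>\<mu>\<bar>) * (Cq * q)" by (simp add: algebra_simps)
    finally have b: "\<bar>(Q2 (x - ln t) + Q1 (x - ln t) - \<mu> * Q1 (x - ln t)) * (Y l t / t)\<bar>
        \<le> ((2 + \<bar>\<mu>\<bar>) * (Cq * q)) * (Y l t / t)"
      unfolding abs_mult using Yp t by (intro mult_mono) auto
    show ?thesis unfolding abs_mult[of "t powr (\<mu> - 1)"]
      by (intro mult_mono order_trans[OF abs_triangle_ineq add_mono[OF a b]]) (use q1 Q(9) in auto)
  qed
  also have "\<dots> \<le> t powr (\<mu> - 1) * (((2 + \<bar>\<mu>\<bar>) * (Cq * q)) * \<bar>Y' l t\<bar> + ((2 + \<bar>\<mu>\<bar>) * (Cq * q)) * (Y l t / t))"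
    using q1 by (intro mult_left_mono add_right_mono mult_right_mono) auto
  also have "\<dots> = Cq * (2 + \<bar>\<mu>\<bar>) * (t powr (\<mu> - 1) * q * (\<bar>Y' l t\<bar> + Y l t / t))"
    by (simp only: distrib_left mult_ac)
  finally show ?thesis by (simp add: q_def)
qed

lemma zeta_nonneg: "l > 0 \<Longrightarrow> t > 0 \<Longrightarrow> zeta l x t \<ge> 0"
  unfolding zeta_def using Y_pos[of l t] Q(4) by (intro mult_nonneg_nonneg) auto

lemma cutoff_continuous:
  "continuous_on {1..b} (\<lambda>t. Q (x - ln t))" "continuous_on {1..b} (\<lambda>t. Q1 (x - ln t))" "continuous_on {1..b} (\<lambda>t. Q2 (x - ln t))"
proof -
  have c: "continuous_on {1..b} (\<lambda>t. x - ln t)" by (intro continuous_intros) auto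
  have "continuous_on UNIV Q" "continuous_on UNIV Q1"
    using Q(1,2) by (auto intro!: continuous_at_imp_continuous_on DERIV_isCont)
  then show "continuous_on {1..b} (\<lambda>t. Q (x - ln t))" "continuous_on {1..b} (\<lambda>t. Q1 (x - ln t))" "continuous_on {1..b} (\<lambda>t. Q2 (x - ln t))"
    using Q(3) c by (auto intro: continuous_on_compose2)
qed

lemma Y_continuous: "l > 0 \<Longrightarrow> continuous_on {1..b} (Y l)" "l > 0 \<Longrightarrow> continuous_on {1..b} (Y' l)"
  by (rule continuous_at_imp_continuous_on, rule ballI, rule DERIV_isCont, rule Y_deriv, assumption, simp)
    (rule continuous_at_imp_continuous_on, rule ballI, rule DERIV_isCont, rule Y'_deriv, assumption, simp)

lemma zeta_continuous: "l > 0 \<Longrightarrow> continuous_on {1..b} (zeta l x)"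
  unfolding zeta_def[abs_def] by (intro continuous_intros cutoff_continuous Y_continuous) auto

lemma resid_continuous: "l > 0 \<Longrightarrow> continuous_on {1..b} (resid l x)"
  unfolding resid_def[abs_def] by (intro continuous_intros cutoff_continuous Y_continuous) auto

text \<open>At t = exp x the cutoff and its derivative vanish, so there are no terminal terms; at t
  = 1 the condition x \<ge> 1 gives Q = 1 and Q1 = 0, so the data meet the plain \<open>Y\<close>.
  The term with \<open>U 1\<close> has a favourable sign because \<open>Y'\<close> is nonpositive,
  and is dropped.\<close>

lemma tested_inequality:
  assumes l: "l > 0" and x: "x \<ge> 1" "exp x \<le> t1"
    and dU: "\<And>t. t \<in> {1..t1} \<Longrightarrow> (U has_real_derivative V t) (at t within {1..t1})"
    and cV: "continuous_on {1..t1} V" and F: "set_integrable lborel {1..t1} F"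
    and V: "\<And>t. t \<in> {1..t1} \<Longrightarrow>
      V t = V0 + (LINT s:{1..t}|lborel. (l\<^sup>2 * s powr (-2 * k)) * U s - \<mu> / s * V s) + (LINT s:{1..t}|lborel. F s)"
    and V0: "V0 \<ge> e0" and U1: "U 1 \<ge> 0"
  shows "(LINT s:{1..exp x}|lborel. F s * zeta l x s) + e0 * y (l / kap) \<le> (LINT s:{1..exp x}|lborel. U s * resid l x s)"
proof -
  let ?b = "exp x"
  have b: "1 \<le> ?b" using x by simp
  have sub: "{1..?b} \<subseteq> {1..t1}" using x by auto
  have "(LINT s:{1..?b}|lborel. F s * zeta l x s) + V0 * zeta l x 1 - U 1 * zeta1 l x 1 = (LINT s:{1..?b}|lborel. U s * resid l x s)"
  proof (rule weak_ode_tested[OF b])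
    show "(U has_real_derivative V t) (at t within {1..?b})" if "t \<in> {1..?b}" for t
      using DERIV_subset[OF dU sub] that sub by blast
    show "continuous_on {1..?b} V" by (rule continuous_on_subset[OF cV sub])
    show "continuous_on {1..?b} (\<lambda>t. l\<^sup>2 * t powr (-2 * k))" by (intro continuous_intros) auto
    show "set_integrable lborel {1..?b} F" by (rule set_integrable_subset[OF F _ sub]) simp
    show "V t = V0 + (LINT s:{1..t}|lborel. (l\<^sup>2 * s powr (-2 * k)) * U s - \<mu> / s * V s) + (LINT s:{1..t}|lborel. F s)"
      if "t \<in> {1..?b}" for t using V[of t] that sub by blast
    show "(zeta l x has_real_derivative zeta1 l x t + \<mu> / t * zeta l x t) (at t within {1..?b})" if "t \<in> {1..?b}" for t
      by (rule has_field_derivative_at_within[OF zeta_deriv[OF l]]) (use that in auto)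
    show "(zeta1 l x has_real_derivative (l\<^sup>2 * t powr (-2 * k)) * zeta l x t + resid l x t) (at t within {1..?b})" if "t \<in> {1..?b}" for t
      by (rule has_field_derivative_at_within[OF zeta1_deriv[OF l]]) (use that in auto)
    show "continuous_on {1..?b} (resid l x)" by (rule resid_continuous[OF l])
    show "zeta l x ?b = 0" "zeta1 l x ?b = 0" using Q(5)[of 0] Q(8)[of 0] by (simp_all add: zeta_def zeta1_def)
  qed
  moreover have "zeta l x 1 = y (l / kap)" "zeta1 l x 1 = Y' l 1"
    using Q(6)[of x] Q(8)[of x] x by (simp_all add: zeta_def zeta1_def Y_def sig_def)
  moreover have "U 1 * Y' l 1 \<le> 0" using U1 Y'_nonpos[of l 1] l by (simp add: mult_nonneg_nonpos)
  moreover have "e0 * y (l / kap) \<le> V0 * y (l / kap)"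
    using V0 y(1)[of "l / kap"] l kap by (intro mult_right_mono) (auto intro: less_imp_le)
  ultimately show ?thesis by simp
qed

end

context critical_problem
begin

text \<open>Summing the tested equations over a finite set of frequencies \<open>L\<close> and applying Hoelder in space and
  in time. The source is measured against the weight \<open>t powr wt\<close> for which all powers of \<open>t\<close> cancel.\<close>

definition key_estimate :: "'n::finite itself \<Rightarrow> real \<Rightarrow> bool" where
  "key_estimate _ C \<longleftrightarrow> (\<forall>(u :: real \<Rightarrow> real ^ 'n \<Rightarrow> real) n t1 e0 x L h B.
      reduced_solution k \<mu> p R u n t1 e0 \<longrightarrow> 1 \<le> x \<longrightarrow> exp x \<le> t1 \<longrightarrow> finite L \<longrightarrow>
      (\<forall>l. l \<in> L \<longrightarrow> 0 < l \<and> l \<le> 1 \<and> 1 \<le> l * exp x powr kap) \<longrightarrow>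
      h \<in> borel_measurable borel \<longrightarrow> (\<forall>v w. 1 \<le> v \<longrightarrow> v \<le> w \<longrightarrow> h w \<le> h v) \<longrightarrow> (\<forall>w. 1 \<le> w \<longrightarrow> 0 \<le> h w) \<longrightarrow>
      (\<forall>w. 1 \<le> w \<longrightarrow> (\<Sum>l\<in>L. l powr (1 - 1 / p) * exp (- (l * w / 2))) \<le> h w) \<longrightarrow>
      (\<Sum>j\<le>nat \<lfloor>rho (exp x)\<rfloor>. h (1 + real j) powr (p / (p - 1))) \<le> B \<longrightarrow>
      (\<exists>F. (\<forall>l\<in>L. set_integrable lborel {1..exp x} (F l) \<and>
            (AE s in lborel. s \<in> {1..exp x} \<longrightarrow> integrable lebesgue (\<lambda>x. \<bar>u s x\<bar> powr p * eig l x)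
                \<and> F l s = (LINT x|lebesgue. \<bar>u s x\<bar> powr p * eig l x)))
        \<and> (\<Sum>l\<in>L. l powr bet * ((LINT t:{1..exp x}|lborel. F l t * zeta l x t) + e0 * y (l / kap)))
          \<le> C * B powr (1 - 1 / p) * (LINT t:{1..exp x}|lborel. Q1 (x - ln t) * (t powr wt * n t)) powr (1 / p)))"

text \<open>The sum over frequencies enters only through a decreasing majorant h of the distance to
  the cone, so one argument serves a single frequency as well as the dyadic family, with a constant
  independent of \<open>L\<close>, \<open>h\<close> and \<open>B\<close>. The dual factor in space
  is the integral of h^(p / (p - 1)) over shells, which \<open>B\<close> controls.\<close>

lemma key_inequality:
  assumes NN: "N = CARD('n::finite)"
  obtains C where "C > 0" "key_estimate TYPE('n) C"
proof -
  obtain Ck where Ck: "Ck > 0" "\<And>t l (x :: real ^ 'n). 1 \<le> t \<Longrightarrow> 0 < l \<Longrightarrow> l \<le> 1 \<Longrightarrow> l * t powr kap \<ge> exp (- kap) \<Longrightarrow>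
     norm x \<le> rho t \<Longrightarrow> l powr bet * (\<bar>Y' l t\<bar> + Y l t / t) * eig l x
        \<le> Ck * t powr (- k - kap * hh) * (l powr (1 - 1 / p) * exp (- (l * (rho t + 1 - norm x) / 2)))"
    using kernel_bound[OF NN] by blast
  define q where "q = p / (p - 1)"
  have q: "q > 1" using p by (simp add: q_def)
  define e where "e = 1 - 1 / p"
  have e: "0 < e" "e < 1" using p by (auto simp: e_def)
  define K where "K = Cq * (2 + \<bar>\<mu>\<bar>) * Ck"
  have K: "K > 0" using Ck(1) Q(9) by (simp add: K_def add_pos_nonneg)
  define VN where "VN = unit_ball_vol (real N) * real N * (1 / kap + R) ^ (N - 1)"
  have VN: "VN > 0" unfolding VN_def using N kap R by (intro mult_pos_pos zero_less_power add_pos_pos) auto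
  define C where "C = K * VN powr e"
  have C: "C > 0" using K VN by (simp add: C_def)
  have main: "\<exists>F. (\<forall>l\<in>L. set_integrable lborel {1..exp x} (F l) \<and>
            (AE s in lborel. s \<in> {1..exp x} \<longrightarrow> integrable lebesgue (\<lambda>x. \<bar>u s x\<bar> powr p * eig l x)
                \<and> F l s = (LINT x|lebesgue. \<bar>u s x\<bar> powr p * eig l x)))
        \<and> (\<Sum>l\<in>L. l powr bet * ((LINT t:{1..exp x}|lborel. F l t * zeta l x t) + e0 * y (l / kap)))
          \<le> C * B powr (1 - 1 / p) * (LINT t:{1..exp x}|lborel. Q1 (x - ln t) * (t powr wt * n t)) powr (1 / p)"
    if red: "reduced_solution k \<mu> p R u n t1 e0" and x: "1 \<le> x" "exp x \<le> t1" and L: "finite L"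
      and Ll: "\<And>l. l \<in> L \<Longrightarrow> 0 < l \<and> l \<le> 1 \<and> 1 \<le> l * exp x powr kap"
      and hm: "h \<in> borel_measurable borel" and hd: "\<And>v w. 1 \<le> v \<Longrightarrow> v \<le> w \<Longrightarrow> h w \<le> h v"
      and h0: "\<And>w. 1 \<le> w \<Longrightarrow> 0 \<le> h w"
      and hs: "\<And>w. 1 \<le> w \<Longrightarrow> (\<Sum>l\<in>L. l powr (1 - 1 / p) * exp (- (l * w / 2))) \<le> h w"
      and hB: "(\<Sum>j\<le>nat \<lfloor>rho (exp x)\<rfloor>. h (1 + real j) powr (p / (p - 1))) \<le> B"
    for u :: "real \<Rightarrow> real ^ 'n \<Rightarrow> real" and n t1 e0 x L h B
  proof -
    let ?b = "exp x"
    have sub: "{1..?b} \<subseteq> {1..t1}" using x by auto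
    have n0: "n s \<ge> 0" for s using red by (simp add: reduced_solution_def)
    have ni: "set_integrable lborel {1..?b} n"
      using red by (intro set_integrable_subset[OF _ _ sub]) (auto simp: reduced_solution_def)
    have nae: "AE s in lborel. s \<in> {1..t1} \<longrightarrow> u s \<in> borel_measurable lebesgue \<and> integrable lebesgue (\<lambda>x. \<bar>u s x\<bar> powr p)
        \<and> n s = (LINT x|lebesgue. \<bar>u s x\<bar> powr p)
        \<and> (AE x in lebesgue. u s x \<noteq> 0 \<longrightarrow> norm x \<le> A_speed k s + R)"
      using red by (simp add: reduced_solution_def)
    have "\<forall>\<omega>. \<exists>U V F V0. scalar_solution k \<mu> p u t1 e0 \<omega> U V F V0" using red by (simp add: reduced_solution_def)
    then obtain U V F V0 where Pr: "\<And>\<omega>. scalar_solution k \<mu> p u t1 e0 \<omega> (U \<omega>) (V \<omega>) (F \<omega>) (V0 \<omega>)" by metis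
    have UV: "\<And>\<omega> t. t \<in> {1..t1} \<Longrightarrow> (U \<omega> has_real_derivative V \<omega> t) (at t within {1..t1})" "\<And>\<omega>. continuous_on {1..t1} (V \<omega>)"
      and F: "\<And>\<omega>. set_integrable lborel {1..t1} (F \<omega>)"
      and Veq: "\<And>\<omega> t. t \<in> {1..t1} \<Longrightarrow> V \<omega> t = V0 \<omega> + (LINT s:{1..t}|lborel. (\<omega>\<^sup>2 * s powr (-2 * k)) * U \<omega> s - \<mu> / s * V \<omega> s) + (LINT s:{1..t}|lborel. F \<omega> s)"
      and V0: "\<And>\<omega>. V0 \<omega> \<ge> e0" "\<And>\<omega>. U \<omega> 1 \<ge> 0"
      and UF: "\<And>\<omega>. AE s in lborel. s \<in> {1..t1} \<longrightarrow> integrable lebesgue (\<lambda>x. \<bar>u s x\<bar> powr p * eig \<omega> x)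
             \<and> F \<omega> s = (LINT x|lebesgue. \<bar>u s x\<bar> powr p * eig \<omega> x)
             \<and> integrable lebesgue (\<lambda>x. u s x * eig \<omega> x) \<and> U \<omega> s = (LINT x|lebesgue. u s x * eig \<omega> x)"
      using Pr unfolding scalar_solution_def by blast+
    have cU: "continuous_on {1..?b} (U \<omega>)" for \<omega>
    proof -
      have "continuous_on {1..t1} (U \<omega>)" using UV(1) by (meson DERIV_continuous continuous_on_eq_continuous_within)
      then show ?thesis by (rule continuous_on_subset[OF _ sub])
    qed
    define G where "G t = (\<Sum>l\<in>L. l powr bet * (U l t * resid l x t))" for t
    have cUr: "continuous_on {1..?b} (\<lambda>t. U l t * resid l x t)" if "l \<in> L" for l
      using Ll[OF that] by (intro continuous_intros cU resid_continuous) auto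
    have lhs: "(\<Sum>l\<in>L. l powr bet * ((LINT t:{1..?b}|lborel. F l t * zeta l x t) + e0 * y (l / kap)))
       \<le> (LINT t:{1..?b}|lborel. G t)"
    proof -
      have "(\<Sum>l\<in>L. l powr bet * ((LINT t:{1..?b}|lborel. F l t * zeta l x t) + e0 * y (l / kap)))
        \<le> (\<Sum>l\<in>L. l powr bet * (LINT t:{1..?b}|lborel. U l t * resid l x t))"
        using Ll tested_inequality[OF _ x UV(1) UV(2) F Veq V0] by (intro sum_mono mult_left_mono) auto
      also have "\<dots> = (\<Sum>l\<in>L. (LINT t:{1..?b}|lborel. l powr bet * (U l t * resid l x t)))" by simp
      also have "\<dots> = (LINT t:{1..?b}|lborel. G t)"
        unfolding G_def set_lebesgue_integral_def scaleR_sum_right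
        using set_integrable_continuous_interval(1)[OF continuous_on_mult_left[OF cUr]]
        by (intro Bochner_Integration.integral_sum[symmetric]) (auto simp: set_integrable_def)
      finally show ?thesis .
    qed
    define P where "P t = indicator {1..?b} t * (Q1 (x - ln t) * (t powr wt * n t))" for t
    have P0: "P t \<ge> 0" for t unfolding P_def using Q(7) n0 by (intro mult_nonneg_nonneg) auto
    have Pi: "integrable lborel P"
    proof -
      have "set_integrable lborel {1..?b} (\<lambda>t. (Q1 (x - ln t) * t powr wt) * n t)"
        by (intro set_integrable_mult_continuous ni continuous_intros cutoff_continuous) auto
      then show ?thesis by (simp add: set_integrable_def P_def[abs_def] mult.assoc)
    qed
    have Pint: "(LINT t|lborel. P t) = (LINT t:{1..?b}|lborel. Q1 (x - ln t) * (t powr wt * n t))"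
      by (simp add: P_def set_lebesgue_integral_def)
    \<comment> \<open>The layer in which the residual lives. Raised to the conjugate exponent,
      \<open>g\<close> becomes 1 / t there, with integral x - (x - 1) = 1.\<close>
    define g where "g t = indicator {exp (x - 1)..?b} t * t powr (- e)" for t :: real
    have b1: "1 \<le> exp (x - 1)" "exp (x - 1) \<le> ?b" using x by auto
    have allUF: "AE s in lborel. \<forall>l\<in>L. s \<in> {1..t1} \<longrightarrow> integrable lebesgue (\<lambda>x. u s x * eig l x) \<and> U l s = (LINT x|lebesgue. u s x * eig l x)"
      using L
    proof (rule AE_finite_allI)
      fix l
      show "AE s in lborel. s \<in> {1..t1} \<longrightarrow> integrable lebesgue (\<lambda>x. u s x * eig l x) \<and> U l s = (LINT x|lebesgue. u s x * eig l x)"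
        using UF[of l] by eventually_elim blast
    qed
    have Gle: "AE t in lborel. \<bar>indicator {1..?b} t * G t\<bar> \<le> C * B powr e * (P t powr (1 / p) * g t)"
      using nae allUF
    proof eventually_elim
      case (elim t)
      show ?case
      proof (cases "t \<in> {1..?b} \<and> Q1 (x - ln t) \<noteq> 0")
        case False
        have z0: "indicator {1..?b} t * G t = 0"
        proof (cases "t \<in> {1..?b}")
          case True
          then have z: "Q1 (x - ln t) = 0" using False by simp
          have "resid l x t = 0" if "l \<in> L" for l
            using resid_le[of l t x] Ll[OF that] True z p by simp
          then show ?thesis by (simp add: G_def)
        qed simp
        show ?thesis unfolding z0 abs_zero using C by (intro mult_nonneg_nonneg) (auto simp: g_def)
      next
        case True
        then have t: "1 \<le> t" "t \<le> ?b" and q1: "Q1 (x - ln t) \<noteq> 0" by auto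
        have tt: "t \<in> {1..t1}" using t x by auto
        have "x - ln t < 1" using q1 Q(8)[of "x - ln t"] by (cases "x - ln t < 1") auto
        then have "exp (x - 1) \<le> exp (ln t)" by simp
        then have te: "exp (x - 1) \<le> t" using t by simp
        define w where "w = (\<lambda>x::real ^ 'n. rho t + 1 - norm x)"
        define H where "H z = indicator (cball 0 (rho t)) z * h (w z)" for z :: "real ^ 'n"
        define A where "A = t powr (\<mu> - 1) * Q1 (x - ln t) powr (1 / p)"
        define A2 where "A2 = t powr (- k - kap * hh)"
        have A: "A \<ge> 0" "A2 \<ge> 0" by (auto simp: A_def A2_def)
        have um: "u t \<in> borel_measurable lebesgue" and up: "integrable lebesgue (\<lambda>z. \<bar>u t z\<bar> powr p)"
          and nt: "n t = (LINT z|lebesgue. \<bar>u t z\<bar> powr p)"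
          and us: "AE z in lebesgue. u t z \<noteq> 0 \<longrightarrow> norm z \<le> rho t"
          using elim(1) tt by (auto simp: rho_def)
        have Ui: "integrable lebesgue (\<lambda>z. u t z * eig l z)" "U l t = (LINT z|lebesgue. u t z * eig l z)" if "l \<in> L" for l
          using elim(2) tt that by auto
        have rp: "rho t \<ge> 0" using rho_pos[OF t(1)] by simp
        have hqm: "(\<lambda>v. h v powr q) \<in> borel_measurable borel" using hm by measurable
        have Hm: "H \<in> borel_measurable borel"
        proof -
          have "(\<lambda>z::real ^ 'n. h (w z)) \<in> borel_measurable borel"
            unfolding w_def by (rule measurable_compose[OF _ hm]) measurable
          moreover have "(indicator (cball 0 (rho t)) :: real ^ 'n \<Rightarrow> real) \<in> borel_measurable borel"
            by (intro borel_measurable_indicator borel_closed closed_cball)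
          ultimately show ?thesis unfolding H_def[abs_def] by (rule borel_measurable_times[rotated])
        qed
        have Hq: "\<bar>H z\<bar> powr q = indicator (cball 0 (rho t)) z * h (rho t + 1 - norm z) powr q" for z
          using h0[of "w z"] by (cases "z \<in> cball 0 (rho t)") (auto simp: H_def w_def)
        have hqd: "h w powr q \<le> h v powr q" if "1 \<le> v" "v \<le> w" for v w
          using hd[OF that] h0[of w] that q by (intro powr_mono2) auto
        have hq0: "0 \<le> h w powr q" for w by simp
        note bi = ball_integral_le[where 'a = "real ^ 'n", OF hqm hqd hq0 rp]
        have Hqi: "integrable lborel (\<lambda>z. \<bar>H z\<bar> powr q)"
          unfolding Hq by (rule bi(1))
        have Hqle: "(LINT z|lborel. \<bar>H z\<bar> powr q) \<le> VN * t powr (kap * (real N - 1)) * B"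
        proof -
          have "(LINT z|lborel. \<bar>H z\<bar> powr q) \<le> unit_ball_vol (real N) * real N * rho t ^ (N - 1) * (\<Sum>j\<le>nat \<lfloor>rho t\<rfloor>. h (1 + real j) powr q)"
            unfolding Hq using bi(2) by (simp add: NN)
          also have "\<dots> \<le> unit_ball_vol (real N) * real N * ((1 / kap + R) * t powr kap) ^ (N - 1) * B"
          proof (intro mult_mono power_mono rho_le t rp)
            have "rho t \<le> rho ?b" using A_speed_mono[of t ?b k] t by (simp add: rho_def)
            then have "(\<Sum>j\<le>nat \<lfloor>rho t\<rfloor>. h (1 + real j) powr q) \<le> (\<Sum>j\<le>nat \<lfloor>rho ?b\<rfloor>. h (1 + real j) powr q)"
              by (intro sum_mono2) (auto intro!: nat_mono floor_mono)
            then show "(\<Sum>j\<le>nat \<lfloor>rho t\<rfloor>. h (1 + real j) powr q) \<le> B" using hB by (simp add: q_def)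
          qed (use rp kap R in \<open>auto intro!: sum_nonneg mult_nonneg_nonneg\<close>)
          also have "((1 / kap + R) * t powr kap) ^ (N - 1) = (1 / kap + R) ^ (N - 1) * t powr (kap * (real N - 1))"
          proof -
            have "(t powr kap) ^ (N - 1) = (t powr kap) powr (real (N - 1))" using t by (subst powr_realpow) auto
            then show ?thesis using N by (simp add: power_mult_distrib powr_powr of_nat_diff)
          qed
          finally show ?thesis by (simp add: VN_def mult_ac)
        qed
        have Hml: "H \<in> borel_measurable lebesgue" by (rule borel_imp_lebesgue_measurable[OF Hm])
        have Hql: "integrable lebesgue (\<lambda>z. \<bar>H z\<bar> powr q)" "(LINT z|lebesgue. \<bar>H z\<bar> powr q) = (LINT z|lborel. \<bar>H z\<bar> powr q)"
          using Hqi borel_measurable_integrable[OF Hqi] by (simp_all add: integrable_completion integral_completion)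
        note Hol = Holder_inequality[OF p um Hml up Hql(1)[unfolded q_def]]
        \<comment> \<open>The frequencies are summed before Hoelder is applied. Hoelder for each
          frequency separately would cost their number, of order x, in place of the factor x^(1 -
          1/p) that the dyadic family needs.\<close>
        have point: "AE z in lebesgue. (\<Sum>l\<in>L. l powr bet * \<bar>resid l x t\<bar> * \<bar>u t z * eig l z\<bar>) \<le> (K * A * A2) * \<bar>u t z * H z\<bar>"
          using us
        proof eventually_elim
          case (elim z)
          show ?case
          proof (cases "u t z = 0")
            case False
            then have nz: "norm z \<le> rho t" using elim by simp
            have w1: "1 \<le> w z" using nz by (simp add: w_def)
            have each: "l powr bet * \<bar>resid l x t\<bar> * \<bar>u t z * eig l z\<bar> \<le> (K * A * A2) * \<bar>u t z\<bar> * (l powr (1 - 1 / p) * exp (- (l * w z / 2)))"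
              if "l \<in> L" for l
            proof -
              have l: "0 < l" "l \<le> 1" "1 \<le> l * ?b powr kap" using Ll[OF that] by auto
              \<comment> \<open>The frequencies are admissible at time exp x; going back to t by at
                most one e-fold costs the factor exp(- kap). This is the threshold assumed in
                \<open>kernel_bound\<close>.\<close>
              have "exp (- kap) * 1 \<le> exp (- kap) * (l * ?b powr kap)" using l by (intro mult_left_mono) auto
              also have "exp (- kap) * (l * ?b powr kap) = l * exp (x - 1) powr kap"
                by (simp add: powr_def exp_add[symmetric] algebra_simps)
              also have "\<dots> \<le> l * t powr kap" using te kap l by (intro mult_left_mono powr_mono2) auto
              finally have lt: "exp (- kap) \<le> l * t powr kap" by simp
              have ep: "eig l z \<ge> 0" using eig_ge_1[of l z] by simp
              have "l powr bet * \<bar>resid l x t\<bar> * \<bar>u t z * eig l z\<bar>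
                 \<le> l powr bet * (Cq * (2 + \<bar>\<mu>\<bar>) * (A * (\<bar>Y' l t\<bar> + Y l t / t))) * \<bar>u t z * eig l z\<bar>"
                using resid_le[OF l(1) t(1), of x] by (intro mult_right_mono mult_left_mono) (auto simp: A_def)
              also have "\<dots> = (Cq * (2 + \<bar>\<mu>\<bar>) * A * \<bar>u t z\<bar>) * (l powr bet * (\<bar>Y' l t\<bar> + Y l t / t) * eig l z)"
                using ep by (simp add: abs_mult mult_ac)
              also have "\<dots> \<le> (Cq * (2 + \<bar>\<mu>\<bar>) * A * \<bar>u t z\<bar>) * (Ck * A2 * (l powr (1 - 1 / p) * exp (- (l * (rho t + 1 - norm z) / 2))))"
                unfolding A2_def using Q(9) A(1) by (intro mult_left_mono Ck(2)[OF t(1) l(1,2) lt nz]) auto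
              finally show ?thesis by (simp add: K_def w_def mult_ac)
            qed
            have "(\<Sum>l\<in>L. l powr bet * \<bar>resid l x t\<bar> * \<bar>u t z * eig l z\<bar>)
               \<le> (K * A * A2) * \<bar>u t z\<bar> * (\<Sum>l\<in>L. l powr (1 - 1 / p) * exp (- (l * w z / 2)))"
              unfolding sum_distrib_left by (rule sum_mono[OF each])
            also have "\<dots> \<le> (K * A * A2) * \<bar>u t z\<bar> * h (w z)"
              using K A by (intro mult_left_mono hs[OF w1]) auto
            finally show ?thesis using nz h0[OF w1] by (simp add: H_def abs_mult)
          qed simp
        qed
        have "\<bar>G t\<bar> \<le> (\<Sum>l\<in>L. l powr bet * \<bar>resid l x t\<bar> * \<bar>U l t\<bar>)"
          unfolding G_def by (rule order_trans[OF sum_abs]) (simp add: abs_mult mult_ac)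
        also have "\<dots> \<le> (\<Sum>l\<in>L. l powr bet * \<bar>resid l x t\<bar> * (LINT z|lebesgue. \<bar>u t z * eig l z\<bar>))"
          using Ui(2) by (intro sum_mono mult_left_mono) (auto intro: integral_abs_bound)
        also have "\<dots> = (LINT z|lebesgue. (\<Sum>l\<in>L. l powr bet * \<bar>resid l x t\<bar> * \<bar>u t z * eig l z\<bar>))"
          using Ui(1) by (subst Bochner_Integration.integral_sum) auto
        also have "\<dots> \<le> (LINT z|lebesgue. (K * A * A2) * \<bar>u t z * H z\<bar>)"
          using Ui(1) Hol(1) by (intro integral_mono_AE point Bochner_Integration.integrable_sum integrable_mult_right) auto
        also have "\<dots> = (K * A * A2) * (LINT z|lebesgue. \<bar>u t z * H z\<bar>)" by simp
        also have "\<dots> \<le> (K * A * A2) * (n t powr (1 / p) * (VN * t powr (kap * (real N - 1)) * B) powr e)"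
        proof (intro mult_left_mono order_trans[OF Hol(2)] mult_mono)
          show "(LINT z|lebesgue. \<bar>H z\<bar> powr (p / (p - 1))) powr (1 - 1 / p) \<le> (VN * t powr (kap * (real N - 1)) * B) powr e"
            unfolding q_def[symmetric] e_def[symmetric] Hql(2) using Hqle e by (intro powr_mono2) auto
        qed (use nt K A in auto)
        also have "(VN * t powr (kap * (real N - 1)) * B) powr e = VN powr e * t powr (kap * (real N - 1) * e) * B powr e"
          by (simp add: powr_mult powr_powr)
        also have "(K * A * A2) * (n t powr (1 / p) * (VN powr e * t powr (kap * (real N - 1) * e) * B powr e))
          = C * B powr e * ((Q1 (x - ln t) powr (1 / p) * n t powr (1 / p)) * (t powr (\<mu> - 1) * t powr (- k - kap * hh) * t powr (kap * (real N - 1) * e)))"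
          by (simp add: A_def A2_def C_def mult_ac)
        also have "t powr (\<mu> - 1) * t powr (- k - kap * hh) * t powr (kap * (real N - 1) * e) = t powr (wt / p) * t powr (- e)"
        proof -
          have "\<mu> - 1 + (- k - kap * hh) + kap * (real N - 1) * e = wt / p + - e"
            using exponent_balance by (simp add: e_def algebra_simps)
          then show ?thesis unfolding powr_add[symmetric] by simp
        qed
        also have "(Q1 (x - ln t) powr (1 / p) * n t powr (1 / p)) * (t powr (wt / p) * t powr (- e)) = P t powr (1 / p) * g t"
          using t te True by (simp add: P_def g_def powr_mult powr_powr mult_ac)
        finally show ?thesis using True by simp
      qed
    qed
    define f where "f t = P t powr (1 / p)" for t
    have fm: "f \<in> borel_measurable lborel"
      using borel_measurable_integrable[OF Pi] unfolding f_def[abs_def] by measurable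
    have gm: "g \<in> borel_measurable lborel" unfolding g_def[abs_def] by measurable
    have fp: "\<bar>f t\<bar> powr p = P t" for t using P0[of t] p by (simp add: f_def powr_powr)
    have ginv: "\<bar>g t\<bar> powr q = indicator {exp (x - 1)..?b} t * (1 / t)" for t
    proof (cases "t \<in> {exp (x - 1)..?b}")
      case True
      then have "t > 0" using exp_gt_zero[of "x - 1"] by (simp only: atLeastAtMost_iff) linarith
      then have t1': "t powr (- 1) = 1 / t" by (simp add: powr_minus_divide)
      have "e * q = 1" using p by (simp add: e_def q_def field_simps)
      then have "(t powr (- e)) powr q = t powr (- 1)" by (simp only: powr_powr mult_minus_left)
      moreover have "\<bar>g t\<bar> = t powr (- e)" using True by (simp only: g_def indicator_simps mult_1 abs_of_nonneg powr_ge_zero)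
      ultimately show ?thesis using True t1' by simp
    qed (simp add: g_def)
    have ci: "continuous_on {exp (x - 1)..?b} (\<lambda>t::real. 1 / t)"
    proof (intro continuous_intros ballI)
      fix t assume "t \<in> {exp (x - 1)..exp x}"
      then have "exp (x - 1) \<le> t" by simp
      then show "t \<noteq> 0" using exp_gt_zero[of "x - 1"] by linarith
    qed
    have gq: "integrable lborel (\<lambda>t. \<bar>g t\<bar> powr q)"
      unfolding ginv using set_integrable_continuous_interval(1)[OF ci] by (simp add: set_integrable_def)
    have gq1: "(LINT t|lborel. \<bar>g t\<bar> powr q) = 1"
    proof -
      have "(LINT t:{exp (x - 1)..?b}|lborel. 1 / t) = ln ?b - ln (exp (x - 1))"
      proof (rule set_LINT_FTC[OF b1(2) _ ci])
        fix t assume "t \<in> {exp (x - 1)..?b}"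
        then have "t > 0" using exp_gt_zero[of "x - 1"] by (simp only: atLeastAtMost_iff) linarith
        then show "(ln has_real_derivative 1 / t) (at t within {exp (x - 1)..?b})"
          by (auto intro!: derivative_eq_intros simp: inverse_eq_divide)
      qed
      then show ?thesis unfolding ginv by (simp add: set_lebesgue_integral_def)
    qed
    have Hol: "integrable lborel (\<lambda>t. f t * g t)" "(LINT t|lborel. \<bar>f t * g t\<bar>) \<le> (LINT t|lborel. P t) powr (1 / p)"
      using Holder_inequality[OF p fm gm] Pi gq gq1 unfolding fp q_def by simp_all
    have cG: "continuous_on {1..?b} G"
      unfolding G_def[abs_def] by (intro continuous_on_sum continuous_on_mult_left cUr)
    have "(LINT t:{1..?b}|lborel. G t) \<le> (LINT t|lborel. C * B powr e * \<bar>f t * g t\<bar>)"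
      unfolding set_lebesgue_integral_def
    proof (rule integral_mono_AE)
      show "integrable lborel (\<lambda>t. indicator {1..?b} t *\<^sub>R G t)"
        using set_integrable_continuous_interval(1)[OF cG] by (simp add: set_integrable_def)
      show "integrable lborel (\<lambda>t. C * B powr e * \<bar>f t * g t\<bar>)" using Hol(1) by simp
      show "AE t in lborel. indicator {1..?b} t *\<^sub>R G t \<le> C * B powr e * \<bar>f t * g t\<bar>"
        using Gle
      proof eventually_elim
        case (elim t)
        have "f t * g t \<ge> 0" by (simp add: f_def g_def)
        then show ?case using elim by (simp add: f_def)
      qed
    qed
    also have "\<dots> \<le> C * B powr e * (LINT t|lborel. P t) powr (1 / p)"
      using Hol(2) C by (simp add: mult_left_mono)
    finally have "(\<Sum>l\<in>L. l powr bet * ((LINT t:{1..?b}|lborel. F l t * zeta l x t) + e0 * y (l / kap)))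
       \<le> C * B powr (1 - 1 / p) * (LINT t:{1..exp x}|lborel. Q1 (x - ln t) * (t powr wt * n t)) powr (1 / p)"
      using lhs unfolding Pint e_def by simp
    moreover have "set_integrable lborel {1..?b} (F l)" for l by (rule set_integrable_subset[OF F _ sub]) simp
    moreover have "AE s in lborel. s \<in> {1..?b} \<longrightarrow> integrable lebesgue (\<lambda>x. \<bar>u s x\<bar> powr p * eig l x)
                \<and> F l s = (LINT x|lebesgue. \<bar>u s x\<bar> powr p * eig l x)" for l
      using UF[of l] by eventually_elim (use sub in blast)
    ultimately show ?thesis by blast
  qed
  show ?thesis
    by (rule that[OF C], unfold key_estimate_def, intro allI impI, rule main) auto
qed

end

section \<open>Blow-up\<close>

context critical_problem
begin

text \<open>\<open>key_estimate\<close> is used twice. With the single frequency 1 the profile is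
  exponential, \<open>B\<close> is a constant, and the data term is kept while the source is
  dropped: this is \<open>D1\<close>. With the dyadic frequencies the profile is the power - (1 -
  1/p), \<open>B\<close> grows like x, and the source is kept while the data are dropped: this is
  \<open>D2\<close>.\<close>

lemma main_bound:
  assumes NN: "N = CARD('n::finite)" and c1: "c1 > 0"
  obtains C where "C > 0"
    "\<And>(u :: real \<Rightarrow> real ^ 'n \<Rightarrow> real) n t1 \<epsilon>. 0 < \<epsilon> \<Longrightarrow> \<epsilon> \<le> 1 \<Longrightarrow> 1 < t1 \<Longrightarrow> reduced_solution k \<mu> p R u n t1 (\<epsilon> * c1) \<Longrightarrow>
      ln t1 \<le> C * \<epsilon> powr (- (p * (p - 1)))"
proof -
  obtain Ck where Ck0: "Ck > 0" and key: "key_estimate TYPE('n) Ck"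
    using key_inequality[OF NN] by blast
  note Ck = Ck0 key[unfolded key_estimate_def, rule_format]
  define q where "q = p / (p - 1)"
  define e where "e = 1 - 1 / p"
  have e: "0 < e" "e < 1" "e * q = 1" "e * p = p - 1" "q \<ge> 1"
    using p by (auto simp: e_def q_def field_simps)
  \<comment> \<open>Ratio of the geometric series that dominates the shell sum for the exponential
    profile.\<close>
  define r :: real where "r = exp (- (1/2))"
  have r: "0 < r" "r < 1" by (auto simp: r_def)
  define B1 where "B1 = 1 / (1 - r)"
  have B1: "B1 > 0" using r by (simp add: B1_def)
  obtain Cd where Cd: "Cd > 0" "\<And>w M. w > 0 \<Longrightarrow> (\<Sum>j\<le>M. ((1/2) ^ j) powr e * exp (- ((1/2) ^ j * w / 2))) \<le> Cd * w powr (- e)"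
    using dyadic_sum_le[OF e(1)] by blast
  \<comment> \<open>The number of shells at time exp x is at most \<open>W * exp x powr kap\<close>;
    its logarithm, at most ln W + x, is what the harmonic sum produces.\<close>
  define W where "W = 1 + 1 / kap + R"
  have W: "W \<ge> 1" using kap R by (simp add: W_def)
  define CB where "CB = Cd powr q * (2 + ln W)"
  have CB: "CB > 0" unfolding CB_def using Cd(1) W by (intro mult_pos_pos) (auto simp: add_pos_nonneg)
  define c2 where "c2 = y (2 / kap)"
  have c2: "c2 > 0" unfolding c2_def using kap by (intro y) simp
  define KA where "KA = Ck * B1 powr e"
  define KB where "KB = Ck * CB powr e"
  have KAB: "KA > 0" "KB > 0" using Ck(1) B1 CB by (auto simp: KA_def KB_def)
  have y1: "y (1 / kap) > 0" using kap by (intro y) simp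
  define cA where "cA = (c1 * y (1 / kap) / KA) powr p"
  define cB where "cB = (c2 / KB) powr p"
  define c where "c = min cA cB"
  have cAB: "cA > 0" "cB > 0" using c1 y1 KAB c2 by (auto simp: cA_def cB_def)
  then have c: "c > 0" by (simp add: c_def)
  define C where "C = max 4 (2 / ((p - 1) * c) * (c / 4) powr (1 - p))"
  have C: "C > 0" by (simp add: C_def less_max_iff_disj)
  have main: "ln t1 \<le> C * \<epsilon> powr (- (p * (p - 1)))"
    if \<epsilon>: "0 < \<epsilon>" "\<epsilon> \<le> 1" and t10: "1 < t1" and red: "reduced_solution k \<mu> p R u n t1 (\<epsilon> * c1)"
    for u :: "real \<Rightarrow> real ^ 'n \<Rightarrow> real" and n t1 \<epsilon>
  proof -
    define m where "m t = t powr wt * n t" for t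
    have n0: "n s \<ge> 0" for s using red by (simp add: reduced_solution_def)
    have ni: "set_integrable lborel {1..t1} n" using red by (simp add: reduced_solution_def)
    have nae: "AE s in lborel. s \<in> {1..t1} \<longrightarrow> integrable lebesgue (\<lambda>x. \<bar>u s x\<bar> powr p) \<and> n s = (LINT x|lebesgue. \<bar>u s x\<bar> powr p)"
      using red by (auto simp: reduced_solution_def elim: eventually_mono)
    have m0: "m t \<ge> 0" for t using n0[of t] by (simp add: m_def)
    have mi: "set_integrable lborel {1..t1} m"
      unfolding m_def by (intro set_integrable_mult_continuous ni continuous_intros) auto
    have qmi: "set_integrable lborel {1..t1} (\<lambda>t. Q (x - ln t) * m t)" "set_integrable lborel {1..t1} (\<lambda>t. Q1 (x - ln t) * m t)" for x
      by (intro set_integrable_mult_continuous mi cutoff_continuous)+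
    define X where "X x = (LINT t:{1..t1}|lborel. Q (x - ln t) * m t)" for x
    define D where "D x = (LINT t:{1..t1}|lborel. Q1 (x - ln t) * m t)" for x
    \<comment> \<open>\<open>Q\<close> and \<open>Q1\<close> vanish at nonpositive arguments, that
      is for t \<ge> exp x. Integrals may thus be extended to the fixed endpoint \<open>t1\<close>,
      and the domain no longer varies when differentiating in x.\<close>
    have trunc: "(LINT t:{1..exp x}|lborel. f (x - ln t) * m t) = (LINT t:{1..t1}|lborel. f (x - ln t) * m t)"
      if "exp x \<le> t1" "\<And>z. z \<le> 0 \<Longrightarrow> f z = 0" for f :: "real \<Rightarrow> real" and x
      unfolding set_lebesgue_integral_def
    proof (rule Bochner_Integration.integral_cong[OF refl])
      fix t
      show "indicator {1..exp x} t *\<^sub>R (f (x - ln t) * m t) = indicator {1..t1} t *\<^sub>R (f (x - ln t) * m t)"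
      proof (cases "t \<in> {1..t1} \<and> t > exp x")
        case True
        then have "ln (exp x) < ln t" by (subst ln_less_cancel_iff) auto
        then have "f (x - ln t) = 0" using that(2) by simp
        then show ?thesis by simp
      next
        case False
        then have "t \<in> {1..exp x} \<longleftrightarrow> t \<in> {1..t1}" using that(1) by auto
        then show ?thesis by (simp add: indicator_def)
      qed
    qed
    have Xn: "X x \<ge> 0" "D x \<ge> 0" for x
      unfolding X_def D_def set_lebesgue_integral_def
      using Q(4,7) m0 by (auto intro!: Bochner_Integration.integral_nonneg)
    have dX: "(X has_real_derivative D x) (at x)" for x
    proof (rule DERIV_quadratic_remainder[where \<delta> = 1 and C = "Cq * (LINT t:{1..t1}|lborel. m t)"])
      fix h :: real
      have "X (x + h) - X x - h * D x =
        (LINT t:{1..t1}|lborel. Q (x + h - ln t) * m t - Q (x - ln t) * m t - h * (Q1 (x - ln t) * m t))"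
      proof -
        have i3: "set_integrable lborel {1..t1} (\<lambda>t. h * (Q1 (x - ln t) * m t))"
          by (rule set_integrable_mult_right) (rule qmi)
        show ?thesis
          unfolding X_def D_def
          by (simp only: set_integral_diff(2)[OF set_integral_diff(1)[OF qmi(1)[of "x + h"] qmi(1)[of x]] i3]
              set_integral_diff(2)[OF qmi(1)[of "x + h"] qmi(1)[of x]] set_integral_mult_right)
      qed
      also have "\<bar>\<dots>\<bar> \<le> (LINT t:{1..t1}|lborel. (Cq * h\<^sup>2) * m t)"
        unfolding real_norm_def[symmetric] set_lebesgue_integral_def
      proof (rule norm_LINT_le)
        show "integrable lborel (\<lambda>t. indicator {1..t1} t *\<^sub>R (Q (x + h - ln t) * m t - Q (x - ln t) * m t - h * (Q1 (x - ln t) * m t)))"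
          using set_integral_diff(1)[OF set_integral_diff(1)[OF qmi(1)[of "x + h"] qmi(1)[of x]] set_integrable_mult_right[OF qmi(2)[of x], of h]]
          by (simp add: set_integrable_def)
        show "integrable lborel (\<lambda>t. indicator {1..t1} t *\<^sub>R ((Cq * h\<^sup>2) * m t))"
          using set_integrable_mult_right[OF mi, of "Cq * h\<^sup>2"] by (simp add: set_integrable_def)
        fix t
        have "\<bar>Q ((x - ln t) + h) - Q (x - ln t) - h * Q1 (x - ln t)\<bar> \<le> Cq * h\<^sup>2"
          by (rule second_order_remainder_le[OF Q(1,2,12)])
        then have "\<bar>Q (x + h - ln t) - Q (x - ln t) - h * Q1 (x - ln t)\<bar> * m t \<le> (Cq * h\<^sup>2) * m t"
          using m0[of t] by (intro mult_right_mono) (auto simp: algebra_simps)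
        moreover have "Q (x + h - ln t) * m t - Q (x - ln t) * m t - h * (Q1 (x - ln t) * m t)
           = (Q (x + h - ln t) - Q (x - ln t) - h * Q1 (x - ln t)) * m t" by (simp add: algebra_simps)
        ultimately have "\<bar>Q (x + h - ln t) * m t - Q (x - ln t) * m t - h * (Q1 (x - ln t) * m t)\<bar> \<le> (Cq * h\<^sup>2) * m t"
          using m0[of t] by (simp add: abs_mult)
        then show "norm (indicator {1..t1} t *\<^sub>R (Q (x + h - ln t) * m t - Q (x - ln t) * m t - h * (Q1 (x - ln t) * m t)))
           \<le> indicator {1..t1} t *\<^sub>R ((Cq * h\<^sup>2) * m t)"
          by (simp add: indicator_def)
      qed
      finally show "\<bar>X (x + h) - X x - h * D x\<bar> \<le> Cq * (LINT t:{1..t1}|lborel. m t) * h\<^sup>2"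
        by (simp add: mult_ac)
    qed simp
    have Fz0: "0 \<le> (LINT t:{1..exp x}|lborel. F t * zeta l x t)"
      if "l > 0" and "AE s in lborel. s \<in> {1..exp x} \<longrightarrow> integrable lebesgue (\<lambda>x. \<bar>u s x\<bar> powr p * eig l x)
                \<and> F s = (LINT x|lebesgue. \<bar>u s x\<bar> powr p * eig l x)" for l F x
      unfolding set_lebesgue_integral_def
    proof (rule integral_nonneg_AE)
      show "AE t in lborel. 0 \<le> indicator {1..exp x} t *\<^sub>R (F t * zeta l x t)"
        using that(2)
      proof eventually_elim
        case (elim t)
        show ?case
        proof (cases "t \<in> {1..exp x}")
          case True
          have "0 \<le> eig l z" for z :: "real ^ 'n" using eig_ge_1[of l z] by simp
          then have "0 \<le> F t" using elim True by (auto intro!: Bochner_Integration.integral_nonneg)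
          moreover have "0 \<le> zeta l x t" using True by (intro zeta_nonneg that(1)) auto
          ultimately show ?thesis using True by simp
        qed simp
      qed
    qed
    have exx: "1 \<le> exp x powr kap" if "1 \<le> x" for x
      using that by (intro powr_kap_ge_1) simp
    have D1: "D x \<ge> c * \<epsilon> powr p" if xx: "x \<in> {1..ln t1}" for x
    proof -
      have x: "1 \<le> x" using xx by simp
      have t1: "exp x \<le> t1" using xx t10 by (simp add: ln_ge_iff)
      have sumB: "(\<Sum>j\<le>nat \<lfloor>rho (exp x)\<rfloor>. exp (- ((1 + real j) / 2)) powr (p / (p - 1))) \<le> B1"
      proof -
        have "exp (- ((1 + real j) / 2)) powr (p / (p - 1)) \<le> r ^ j" for j
        proof -
          have "exp (- ((1 + real j) / 2)) powr q \<le> exp (- ((1 + real j) / 2)) powr 1"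
            using e(5) by (intro powr_mono') auto
          also have "\<dots> \<le> exp (real j * (- (1/2)))" by (simp add: field_simps)
          also have "\<dots> = r ^ j" unfolding r_def by (rule exp_of_nat_mult)
          finally show ?thesis by (simp add: q_def)
        qed
        then have "(\<Sum>j\<le>nat \<lfloor>rho (exp x)\<rfloor>. exp (- ((1 + real j) / 2)) powr (p / (p - 1))) \<le> (\<Sum>j\<le>nat \<lfloor>rho (exp x)\<rfloor>. r ^ j)"
          by (intro sum_mono)
        also have "\<dots> \<le> (\<Sum>j. r ^ j)" using r by (intro sum_le_suminf summable_geometric) auto
        also have "\<dots> = B1" using r by (simp add: suminf_geometric B1_def)
        finally show ?thesis .
      qed
      obtain F where F: "AE s in lborel. s \<in> {1..exp x} \<longrightarrow> integrable lebesgue (\<lambda>x. \<bar>u s x\<bar> powr p * eig 1 x)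
                \<and> F s = (LINT x|lebesgue. \<bar>u s x\<bar> powr p * eig 1 x)"
        and le: "(LINT t:{1..exp x}|lborel. F t * zeta 1 x t) + \<epsilon> * c1 * y (1 / kap)
           \<le> Ck * B1 powr (1 - 1 / p) * (LINT t:{1..exp x}|lborel. Q1 (x - ln t) * (t powr wt * n t)) powr (1 / p)"
        using Ck(2)[OF red x t1, of "{1}" "\<lambda>w. exp (- (w / 2))" B1] exx[OF x] sumB by auto
      have "\<epsilon> * c1 * y (1 / kap) \<le> KA * D x powr (1 / p)"
        using le Fz0[OF _ F] trunc[OF t1 Q(8), of "\<lambda>z. z"] trunc[of x Q1] t1 Q(8)
        by (simp add: KA_def e_def D_def m_def)
      then have "(\<epsilon> * c1 * y (1 / kap) / KA) powr p \<le> D x"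
        using \<epsilon> c1 y1 by (intro powr_lower_bound[OF p KAB(1) _ Xn(2)]) auto
      moreover have "(\<epsilon> * c1 * y (1 / kap) / KA) powr p = cA * \<epsilon> powr p"
      proof -
        have "\<epsilon> * c1 * y (1 / kap) / KA = (c1 * y (1 / kap) / KA) * \<epsilon>" by simp
        then show ?thesis unfolding cA_def by (simp only: powr_mult)
      qed
      moreover have "c * \<epsilon> powr p \<le> cA * \<epsilon> powr p" by (intro mult_right_mono) (auto simp: c_def)
      ultimately show ?thesis by linarith
    qed
    have D2: "D x \<ge> c * x powr (1 - p) * X x powr p" if xx: "x \<in> {1..ln t1}" for x
    proof -
      have x: "1 \<le> x" using xx by simp
      have t1: "exp x \<le> t1" using xx t10 by (simp add: ln_ge_iff)
      \<comment> \<open>The lowest frequency 2^(- J) is of the size of exp(- kap x); halving it once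
        more would violate the admissibility condition of \<open>key_estimate\<close>.\<close>
      obtain J where J: "2 ^ J \<le> exp x powr kap" "exp x powr kap < 2 ^ Suc J"
        using dyadic_exists[OF exx[OF x]] by blast
      define L where "L = (\<lambda>j. (1/2 :: real) ^ j) ` {..J}"
      have inj: "inj_on (\<lambda>j. (1/2 :: real) ^ j) {..J}"
        by (rule inj_onI) (auto simp: power_inject_exp' power_one_over)
      have Lsum: "(\<Sum>l\<in>L. f l) = (\<Sum>j\<le>J. f ((1/2) ^ j))" for f :: "real \<Rightarrow> real"
        unfolding L_def by (subst sum.reindex[OF inj]) simp
      have Ll: "0 < l \<and> l \<le> 1 \<and> 1 \<le> l * exp x powr kap" if "l \<in> L" for l
      proof -
        obtain j where j: "j \<le> J" "l = (1/2) ^ j" using \<open>l \<in> L\<close> by (auto simp: L_def)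
        have "(2::real) ^ j \<le> 2 ^ J" using j by (intro power_increasing) auto
        then have "2 ^ j \<le> exp x powr kap" using J(1) by linarith
        then have "(1/2) ^ j * 2 ^ j \<le> (1/2) ^ j * exp x powr kap" by (intro mult_left_mono) auto
        moreover have "(1/2 :: real) ^ j * 2 ^ j = 1" by (simp add: power_mult_distrib[symmetric])
        ultimately show ?thesis using j by (simp add: power_le_one)
      qed
      define h where "h w = Cd * w powr (- e)" for w :: real
      have sumB: "(\<Sum>j\<le>nat \<lfloor>rho (exp x)\<rfloor>. h (1 + real j) powr (p / (p - 1))) \<le> CB * x"
      proof -
        \<comment> \<open>Because \<open>e * q = 1\<close>, shell j contributes exactly a multiple
          of 1 / (1 + j): the sum is harmonic.\<close>
        have hq: "h (1 + real j) powr (p / (p - 1)) = Cd powr q * (1 / (1 + real j))" for j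
        proof -
          have "((1 + real j) powr (- e)) powr q = (1 + real j) powr (- (e * q))" by (simp add: powr_powr)
          also have "\<dots> = 1 / (1 + real j)" unfolding e(3) by (simp add: powr_minus_divide)
          finally show ?thesis by (simp add: h_def q_def[symmetric] powr_mult)
        qed
        define M where "M = nat \<lfloor>rho (exp x)\<rfloor>"
        have "rho (exp x) > 0" using x by (intro rho_pos) simp
        then have "1 + real M \<le> 1 + rho (exp x)" unfolding M_def by linarith
        also have "\<dots> \<le> exp x powr kap + (1 / kap + R) * exp x powr kap"
          using rho_le[of "exp x"] exx[OF x] x by (intro add_mono) auto
        also have "\<dots> = W * exp x powr kap" by (simp add: W_def algebra_simps)
        finally have "ln (1 + real M) \<le> ln (W * exp x powr kap)" by (subst ln_le_cancel_iff) (use W exx[OF x] in auto)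
        also have "\<dots> = ln W + kap * x" using W by (simp add: ln_mult ln_powr)
        also have "\<dots> \<le> ln W * x + 1 * x"
          using W x kap mult_left_mono[of 1 x "ln W"] by (intro add_mono mult_right_mono) auto
        finally have "1 + ln (1 + real M) \<le> (2 + ln W) * x" using x by (simp add: algebra_simps)
        then have "(\<Sum>j\<le>M. 1 / (1 + real j)) \<le> (2 + ln W) * x" using harmonic_sum_le[of M] by linarith
        then have "Cd powr q * (\<Sum>j\<le>M. 1 / (1 + real j)) \<le> Cd powr q * ((2 + ln W) * x)" by (intro mult_left_mono) auto
        then show ?thesis unfolding hq M_def[symmetric] sum_distrib_left[symmetric] CB_def by (simp only: mult.assoc)
      qed
      have hmeas: "h \<in> borel_measurable borel" unfolding h_def[abs_def] by measurable
      have hdec: "h w \<le> h v" if "1 \<le> v" "v \<le> w" for v w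
        unfolding h_def using that e Cd(1) by (intro mult_left_mono powr_mono2') auto
      have hnn: "0 \<le> h w" for w using Cd(1) by (simp add: h_def)
      have hsum: "(\<Sum>l\<in>L. l powr (1 - 1 / p) * exp (- (l * w / 2))) \<le> h w" if "1 \<le> w" for w
        unfolding Lsum using Cd(2)[of w J] that by (simp add: h_def e_def)
      have Lfin: "finite L" by (simp add: L_def)
      obtain F where Fi: "\<And>l. l \<in> L \<Longrightarrow> set_integrable lborel {1..exp x} (F l)"
        and F: "\<And>l. l \<in> L \<Longrightarrow> AE s in lborel. s \<in> {1..exp x} \<longrightarrow> integrable lebesgue (\<lambda>x. \<bar>u s x\<bar> powr p * eig l x)
                \<and> F l s = (LINT x|lebesgue. \<bar>u s x\<bar> powr p * eig l x)"
        and le: "(\<Sum>l\<in>L. l powr bet * ((LINT t:{1..exp x}|lborel. F l t * zeta l x t) + \<epsilon> * c1 * y (l / kap)))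
          \<le> Ck * (CB * x) powr (1 - 1 / p) * (LINT t:{1..exp x}|lborel. Q1 (x - ln t) * (t powr wt * n t)) powr (1 / p)"
        using Ck(2)[OF red x t1 Lfin Ll hmeas hdec hnn hsum sumB] by blast
      have Fzi: "set_integrable lborel {1..exp x} (\<lambda>t. l powr bet * (F l t * zeta l x t))" if "l \<in> L" for l
        using set_integrable_mult_continuous[OF Fi[OF that] zeta_continuous[of l "exp x" x]] Ll[OF that]
        by (intro set_integrable_mult_right) (simp add: mult.commute)
      have Fall: "AE s in lborel. \<forall>l\<in>L. s \<in> {1..exp x} \<longrightarrow> integrable lebesgue (\<lambda>x. \<bar>u s x\<bar> powr p * eig l x)
                \<and> F l s = (LINT x|lebesgue. \<bar>u s x\<bar> powr p * eig l x)"
        by (rule AE_finite_allI[OF Lfin F])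
      have "c2 * X x = (LINT t:{1..exp x}|lborel. c2 * (Q (x - ln t) * m t))"
        using trunc[OF t1, of Q] Q(5) by (simp add: X_def)
      also have "\<dots> \<le> (LINT t:{1..exp x}|lborel. (\<Sum>l\<in>L. l powr bet * (F l t * zeta l x t)))"
        unfolding set_lebesgue_integral_def
      proof (rule integral_mono_AE)
        have "set_integrable lborel {1..exp x} (\<lambda>t. c2 * (Q (x - ln t) * m t))"
          using t1 by (intro set_integrable_mult_right set_integrable_subset[OF qmi(1)]) auto
        then show "integrable lborel (\<lambda>t. indicator {1..exp x} t *\<^sub>R (c2 * (Q (x - ln t) * m t)))"
          by (simp add: set_integrable_def)
        show "integrable lborel (\<lambda>t. indicator {1..exp x} t *\<^sub>R (\<Sum>l\<in>L. l powr bet * (F l t * zeta l x t)))"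
          unfolding scaleR_sum_right using Fzi by (intro Bochner_Integration.integrable_sum) (simp add: set_integrable_def)
        show "AE t in lborel. indicator {1..exp x} t *\<^sub>R (c2 * (Q (x - ln t) * m t))
            \<le> indicator {1..exp x} t *\<^sub>R (\<Sum>l\<in>L. l powr bet * (F l t * zeta l x t))"
          using nae Fall
        proof eventually_elim
          case (elim t)
          show ?case
          proof (cases "t \<in> {1..exp x}")
            case True
            then have t: "1 \<le> t" "t \<in> {1..t1}" using t1 by auto
            have up: "integrable lebesgue (\<lambda>z. \<bar>u t z\<bar> powr p)" "n t = (LINT z|lebesgue. \<bar>u t z\<bar> powr p)"
              using elim(1) t by auto
            have Fl: "integrable lebesgue (\<lambda>z. \<bar>u t z\<bar> powr p * eig l z)" "F l t = (LINT z|lebesgue. \<bar>u t z\<bar> powr p * eig l z)"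
              if "l \<in> L" for l using elim(2) that True by auto
            define a where "a = Q (x - ln t) * t powr \<mu>"
            have a: "a \<ge> 0" using Q(4) by (simp add: a_def)
            have tJ: "t powr kap < 2 ^ Suc J"
            proof -
              have "t powr kap \<le> exp x powr kap" using True kap by (intro powr_mono2) auto
              then show ?thesis using J(2) by linarith
            qed
            have "(LINT z|lebesgue. (c2 * t powr (- kap * bet)) * \<bar>u t z\<bar> powr p)
              \<le> (LINT z|lebesgue. (\<Sum>l\<in>L. (l powr bet * Y l t) * (\<bar>u t z\<bar> powr p * eig l z)))"
            proof (rule integral_mono)
              show "integrable lebesgue (\<lambda>z. (c2 * t powr (- kap * bet)) * \<bar>u t z\<bar> powr p)" using up by simp
              show "integrable lebesgue (\<lambda>z. \<Sum>l\<in>L. (l powr bet * Y l t) * (\<bar>u t z\<bar> powr p * eig l z))"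
                using Fl(1) by (intro Bochner_Integration.integrable_sum integrable_mult_right) auto
              fix z
              have "(c2 * t powr (- kap * bet)) * \<bar>u t z\<bar> powr p \<le> (\<Sum>l\<in>L. l powr bet * (Y l t * eig l z)) * \<bar>u t z\<bar> powr p"
                unfolding Lsum c2_def by (intro mult_right_mono test_function_lower[OF t(1) tJ]) simp
              then show "(c2 * t powr (- kap * bet)) * \<bar>u t z\<bar> powr p \<le> (\<Sum>l\<in>L. (l powr bet * Y l t) * (\<bar>u t z\<bar> powr p * eig l z))"
                unfolding sum_distrib_right by (simp only: mult_ac)
            qed
            also have "\<dots> = (\<Sum>l\<in>L. (l powr bet * Y l t) * F l t)"
              using Fl by (subst Bochner_Integration.integral_sum) auto
            finally have "c2 * t powr (- kap * bet) * n t \<le> (\<Sum>l\<in>L. (l powr bet * Y l t) * F l t)" using up(2) by simp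
            then have "a * (c2 * t powr (- kap * bet) * n t) \<le> a * (\<Sum>l\<in>L. (l powr bet * Y l t) * F l t)"
              using a by (rule mult_left_mono)
            moreover have "a * (c2 * t powr (- kap * bet) * n t) = c2 * (Q (x - ln t) * m t)"
            proof -
              have "t powr \<mu> * t powr (- kap * bet) = t powr wt" by (simp add: powr_add[symmetric] wt_def)
              then show ?thesis unfolding a_def m_def by (metis (no_types, opaque_lifting) mult.assoc mult.commute)
            qed
            moreover have "a * (\<Sum>l\<in>L. (l powr bet * Y l t) * F l t) = (\<Sum>l\<in>L. l powr bet * (F l t * zeta l x t))"
              by (simp add: a_def zeta_def sum_distrib_left mult_ac)
            ultimately have "c2 * (Q (x - ln t) * m t) \<le> (\<Sum>l\<in>L. l powr bet * (F l t * zeta l x t))"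
              by (simp only:)
            then show ?thesis using True by simp
          qed simp
        qed
      qed
      also have "\<dots> = (\<Sum>l\<in>L. (LINT t:{1..exp x}|lborel. l powr bet * (F l t * zeta l x t)))"
        unfolding set_lebesgue_integral_def scaleR_sum_right
        using Fzi by (intro Bochner_Integration.integral_sum) (simp add: set_integrable_def)
      also have "\<dots> \<le> (\<Sum>l\<in>L. l powr bet * ((LINT t:{1..exp x}|lborel. F l t * zeta l x t) + \<epsilon> * c1 * y (l / kap)))"
      proof (rule sum_mono)
        fix l assume "l \<in> L"
        then have "y (l / kap) > 0" using Ll[of l] kap by (intro y) simp
        then have "0 \<le> \<epsilon> * c1 * y (l / kap)" using \<epsilon> c1 by simp
        then show "(LINT t:{1..exp x}|lborel. l powr bet * (F l t * zeta l x t))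
           \<le> l powr bet * ((LINT t:{1..exp x}|lborel. F l t * zeta l x t) + \<epsilon> * c1 * y (l / kap))"
          by (simp add: distrib_left)
      qed
      also have "\<dots> \<le> Ck * (CB * x) powr e * D x powr (1 / p)"
        using le trunc[OF t1, of Q1] Q(8) by (simp add: e_def D_def m_def)
      finally have "c2 * X x \<le> (Ck * (CB * x) powr e) * D x powr (1 / p)" .
      then have "(c2 * X x / (Ck * (CB * x) powr e)) powr p \<le> D x"
        using c2 Xn Ck(1) CB x by (intro powr_lower_bound[OF p]) auto
      moreover have "(c2 * X x / (Ck * (CB * x) powr e)) powr p = cB * x powr (1 - p) * X x powr p"
      proof -
        have "(x powr (- e)) powr p = x powr (1 - p)" using e(4) by (simp add: powr_powr)
        moreover have "c2 * X x / (Ck * (CB * x) powr e) = (c2 / KB) * (x powr (- e)) * X x"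
          using x by (simp add: KB_def powr_mult powr_minus_divide)
        ultimately show ?thesis by (simp only: powr_mult cB_def)
      qed
      moreover have "c * x powr (1 - p) * X x powr p \<le> cB * x powr (1 - p) * X x powr p"
        by (intro mult_right_mono) (auto simp: c_def)
      ultimately show ?thesis by linarith
    qed
    show ?thesis unfolding C_def
      by (rule lifespan_ode_bound[OF p c \<epsilon> dX Xn(1) D1 D2])
  qed
  show ?thesis by (rule that[OF C]) (rule main)
qed

end

text \<open>For a > 0 the roots have product - 1 / a, so exactly one is positive and the definite
  description is meaningful. Since b = a + 1 + 2 k / (1 - k), the quadratic rearranges to (p - 1) a
  = 1 + 2 k / (1 - k) + 1 / p; the right side is positive, hence p > 1.\<close>

lemma crit_exp_root:
  fixes k n \<mu> p :: real
  assumes k: "0 \<le> k" "k < 1" and fin: "crit_exp k n \<mu> < \<infinity>" and p: "ereal p = crit_exp k n \<mu>"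
  shows "p > 1" and "(p - 1) * ((n - 1 + (\<mu> - k) / (1 - k)) / 2) = 1 + 2 * k / (1 - k) + 1 / p"
proof -
  define a where "a = (n - 1) / 2 + (\<mu> - k) / (2 * (1 - k))"
  define b where "b = (n + 1) / 2 + (\<mu> + 3 * k) / (2 * (1 - k))"
  have ce: "crit_exp k n \<mu> = (if a > 0 then ereal (THE p. p > 0 \<and> a * p\<^sup>2 - b * p - 1 = 0) else \<infinity>)"
    by (simp add: crit_exp_def a_def b_def Let_def)
  have a: "a > 0" using fin ce by (auto split: if_splits)
  have pT: "p = (THE p. p > 0 \<and> a * p\<^sup>2 - b * p - 1 = 0)" using p ce a by simp
  have "\<exists>!p. p > 0 \<and> a * p\<^sup>2 - b * p - 1 = 0"
  proof (rule ex_ex1I)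
    define s where "s = sqrt (b\<^sup>2 + 4 * a)"
    have s2: "s * s = b\<^sup>2 + 4 * a" using a by (simp add: s_def)
    have "s > \<bar>b\<bar>" unfolding s_def using a by (intro real_less_rsqrt) simp
    then have "(b + s) / (2 * a) > 0" using a by (intro divide_pos_pos) auto
    moreover have "a * ((b + s) / (2 * a))\<^sup>2 - b * ((b + s) / (2 * a)) - 1 = 0"
    proof -
      have "a * ((b + s) / (2 * a))\<^sup>2 - b * ((b + s) / (2 * a)) - 1 = (s * s - (b\<^sup>2 + 4 * a)) / (4 * a)"
        using a by (simp add: field_simps power2_eq_square)
      then show ?thesis using s2 by simp
    qed
    ultimately show "\<exists>p. p > 0 \<and> a * p\<^sup>2 - b * p - 1 = 0" by blast
  next
    fix v w assume v: "v > 0 \<and> a * v\<^sup>2 - b * v - 1 = 0" and w: "w > 0 \<and> a * w\<^sup>2 - b * w - 1 = 0"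
    have "(a * v * w + 1) * (v - w) = (a * v\<^sup>2 - b * v - 1) * w - (a * w\<^sup>2 - b * w - 1) * v"
      by (simp add: algebra_simps power2_eq_square)
    also have "\<dots> = 0" using v w by simp
    finally have "a * v * w + 1 = 0 \<or> v - w = 0" by simp
    moreover have "a * v * w > 0" using a v w by simp
    ultimately show "v = w" by auto
  qed
  from theI'[OF this] have root: "p > 0" "a * p\<^sup>2 - b * p - 1 = 0" unfolding pT[symmetric] by auto
  have ba: "b = a + 1 + 2 * k / (1 - k)"
  proof -
    have "2 * k / (1 - k) = 4 * k / (2 * (1 - k))"
      using mult_divide_mult_cancel_left[of 2 "2 * k" "1 - k"] by simp
    moreover have "(\<mu> + 3 * k) / (2 * (1 - k)) = (\<mu> - k) / (2 * (1 - k)) + 4 * k / (2 * (1 - k))"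
      by (simp only: add_divide_distrib[symmetric]) simp
    moreover have "(n + 1) / 2 = (n - 1) / 2 + 1" by (simp add: field_simps)
    ultimately show ?thesis unfolding a_def b_def by (simp only: add_ac)
  qed
  have "a * p\<^sup>2 - a * p = (1 + 2 * k / (1 - k)) * p + 1" using root(2) unfolding ba by (simp add: algebra_simps)
  then have eq: "(p - 1) * a * p = (1 + 2 * k / (1 - k) + 1 / p) * p"
    using root(1) by (simp add: algebra_simps power2_eq_square)
  then have eq': "(p - 1) * a = 1 + 2 * k / (1 - k) + 1 / p" using root(1) by simp
  also have "\<dots> > 0" using k root(1) by (intro add_nonneg_pos add_nonneg_nonneg) auto
  finally show "p > 1" using a by (simp add: zero_less_mult_iff)
  have aX: "a = (n - 1 + (\<mu> - k) / (1 - k)) / 2" by (simp add: a_def add_divide_distrib)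
  show "(p - 1) * ((n - 1 + (\<mu> - k) / (1 - k)) / 2) = 1 + 2 * k / (1 - k) + 1 / p" using eq' unfolding aX .
qed

theorem theorem1p3:
  fixes u0 u1 :: "real ^ 'n \<Rightarrow> real" and k \<mu> p R :: real
  assumes "0 \<le> k" "k < 1"
    and "0 \<le> \<mu>" "\<mu> \<le> \<mu>\<^sub>0 k (real CARD('n))"
    and "\<mu> \<le> k \<or> \<mu> \<ge> 2 - k"
    and "crit_exp k (real CARD('n)) \<mu> < \<infinity>"
    and "ereal p = crit_exp k (real CARD('n)) \<mu>"
    and "R > 0"
    and "in_H1 u0" "AE x in lebesgue. u0 x \<ge> 0" "\<not> (AE x in lebesgue. u0 x = 0)"
    and "compact (ess_support u0)" "ess_support u0 \<subseteq> cball 0 R"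
    and "in_L2 u1" "AE x in lebesgue. u1 x \<ge> 0" "\<not> (AE x in lebesgue. u1 x = 0)"
    and "compact (ess_support u1)" "ess_support u1 \<subseteq> cball 0 R"
  shows "\<exists>\<epsilon>0>0. \<exists>C>0. \<forall>\<epsilon> T u.
           0 < \<epsilon> \<and> \<epsilon> \<le> \<epsilon>0 \<and>
           energy_solution_lifespan k \<mu> p \<epsilon> u0 u1 T u \<and>
           (\<forall>t. 1 < t \<and> ereal t < T \<longrightarrow> ess_support (u t) \<subseteq> cball 0 (A_speed k t + R)) \<longrightarrow>
           T < \<infinity> \<and> T \<le> ereal (exp (C * \<epsilon> powr (- (p * (p - 1)))))"
proof -
  note k = assms(1,2)
  note root = crit_exp_root[OF k assms(6,7)]
  interpret critical_exponents k \<mu> p R "CARD('n)"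
    by unfold_locales (use k root assms(8) card_ge_1 in auto)
  \<comment> \<open>In conformal time the alternative for \<mu> becomes this one, because 2 - k = k
    + 2 (1 - k).\<close>
  have "nu \<le> 0 \<or> nu \<ge> 2"
    using assms(5) kap by (auto simp: nu_def kap_def divide_nonpos_pos le_divide_eq)
  then obtain y y' where y: "\<And>z. z > 0 \<Longrightarrow> y z > 0"
    "\<And>z. z > 0 \<Longrightarrow> (y has_real_derivative y' z) (at z)"
    "\<And>z. z > 0 \<Longrightarrow> (y' has_real_derivative y z - nu / z * y' z) (at z)"
    "\<And>z. z > 0 \<Longrightarrow> y' z \<le> 0"
    "\<And>z0. z0 > 0 \<Longrightarrow> \<exists>C>0. \<forall>z\<ge>z0. y z + \<bar>y' z\<bar> \<le> C * z powr (- nu / 2) * exp (- z)"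
    using decaying_solution by blast
  obtain Q Q1 Q2 :: "real \<Rightarrow> real" and Cq where Q:
    "\<And>y. (Q has_real_derivative Q1 y) (at y)" "\<And>y. (Q1 has_real_derivative Q2 y) (at y)"
    "continuous_on UNIV Q2" "\<And>y. 0 \<le> Q y" "\<And>y. y \<le> 0 \<Longrightarrow> Q y = 0" "\<And>y. y \<ge> 1 \<Longrightarrow> Q y = 1"
    "\<And>y. 0 \<le> Q1 y" "\<And>y. y \<le> 0 \<or> y \<ge> 1 \<Longrightarrow> Q1 y = 0"
    "Cq > 0" "\<And>y. Q1 y \<le> Cq * Q1 y powr (1 / p)" "\<And>y. \<bar>Q2 y\<bar> \<le> Cq * Q1 y powr (1 / p)"
    "\<And>y. \<bar>Q2 y\<bar> \<le> Cq"
    using cutoff_exists[OF p] by blast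
  interpret critical_problem k \<mu> p R "CARD('n)" y y' Q Q1 Q2 Cq
    by unfold_locales (fact y Q)+
  obtain c1 where c1: "c1 > 0" "\<And>\<omega> r. r \<ge> R \<Longrightarrow> (LINT x|lebesgue. u1 x * eig_cut \<omega> r x) \<ge> c1"
    using data_pairing_lower[OF assms(14,15,16,18)] by blast
  obtain C where C: "C > 0"
    "\<And>(u :: real \<Rightarrow> real ^ 'n \<Rightarrow> real) n t1 \<epsilon>. 0 < \<epsilon> \<Longrightarrow> \<epsilon> \<le> 1 \<Longrightarrow> 1 < t1 \<Longrightarrow> reduced_solution k \<mu> p R u n t1 (\<epsilon> * c1) \<Longrightarrow>
      ln t1 \<le> C * \<epsilon> powr (- (p * (p - 1)))"
    using main_bound[OF refl c1(1)] by blast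
  have u0: "in_L2 u0" using assms(9) by (simp add: in_H1_def)
  have bound: "T \<le> ereal (exp (C * \<epsilon> powr (- (p * (p - 1)))))"
    if \<epsilon>: "0 < \<epsilon>" "\<epsilon> \<le> 1" and es: "energy_solution k \<mu> p \<epsilon> u0 u1 T u"
      and supp: "\<And>t. 1 < t \<Longrightarrow> ereal t < T \<Longrightarrow> ess_support (u t) \<subseteq> cball 0 (A_speed k t + R)" for \<epsilon> T u
  proof (rule ccontr)
    define E where "E = exp (C * \<epsilon> powr (- (p * (p - 1))))"
    assume "\<not> T \<le> ereal (exp (C * \<epsilon> powr (- (p * (p - 1)))))"
    then have "ereal E < T" by (simp add: E_def)
    \<comment> \<open>Every time \<open>t1 > 1\<close> before T satisfies the bound on
      \<open>ln t1\<close>, so none can lie beyond \<open>E\<close>.\<close>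
    then obtain t1 where t1: "ereal E < ereal t1" "ereal t1 < T" using ereal_dense2 by blast
    have "E > 1" using C(1) \<epsilon> by (simp add: E_def)
    then have t1': "1 < t1" "E < t1" using t1 by auto
    obtain n where "reduced_solution k \<mu> p R u n t1 (\<epsilon> * c1)"
      using energy_solution_reduction[OF es \<epsilon>(1) supp t1'(1) t1(2) u0 assms(10) c1(2)] by blast
    from C(2)[OF \<epsilon> t1'(1) this] have "ln t1 \<le> C * \<epsilon> powr (- (p * (p - 1)))" .
    then have "exp (ln t1) \<le> E" unfolding E_def by simp
    then show False using t1' by simp
  qed
  \<comment> \<open>The estimates hold for all \<epsilon> \<le> 1; the dependence on the data sits
    in \<open>C\<close>, through the lower bound \<open>c1\<close> for the pairing with
    \<open>u1\<close>.\<close>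
  show ?thesis
  proof (rule exI[of _ "1 :: real"], rule conjI, simp, rule exI[of _ C], rule conjI, rule C(1), intro allI impI conjI)
    fix \<epsilon> T u
    assume A: "0 < \<epsilon> \<and> \<epsilon> \<le> 1 \<and> energy_solution_lifespan k \<mu> p \<epsilon> u0 u1 T u \<and>
           (\<forall>t. 1 < t \<and> ereal t < T \<longrightarrow> ess_support (u t) \<subseteq> cball 0 (A_speed k t + R))"
    then show le: "T \<le> ereal (exp (C * \<epsilon> powr (- (p * (p - 1)))))"
      by (intro bound) (auto simp: energy_solution_lifespan_def)
    then show "T < \<infinity>" by (rule le_less_trans) simp
  qed
qed

end
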